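(* Let $d=1$, so $\Theta\subseteq\mathbb R$. Suppose that the $Y_i$ are identically distributed; that the distributions $f_\theta(y_i)\gamma_i(\mathrm dy_i)$, $\theta\in\Theta$, all have the same null sets for every $i$; that for every $\theta'\in\Theta$ there exists an open ball $B=B(\theta')\subseteq\mathbb R$ centered at $\theta'$ such that (i) $\nabla^2\ell^1(\theta;y_1)$ exists on $B$ for almost every $y_1$ and is continuous in $(\theta,y_1)$, and (ii) $$\sup_{\theta\in B\cap\Theta,\ \tilde\theta\in B}\int|\nabla^2\ell^1(\tilde\theta;y_1)|^{2+\delta}f_\theta(y_1)\,\gamma_1(\mathrm dy_1)<\infty$$ for some $\delta=\delta(\theta')>0$; and that $\operatorname{var}_\theta\{\nabla^2\ell^1(\theta;Y_1)\}>0$ for every critical $\theta$. Then: (a) for any $n\ge1$ there is a set $\mathcal Y^n$ of full measure such that $T_n(\theta;y^n)=s_n(\theta;y^n)^2/\mathcal I_n(\theta)$ (defined at non-critical $\theta$) has a continuous extension on $\Theta\times\mathcal Y^n$, and that extension is $T_n(\theta;y^n)=\tilde s_n(\theta;y^n)^2/\operatorname{var}_\theta\{\tilde s_n(\theta;Y^n)\}$, where $\tilde s_n(\theta;y^n)=s_n(\theta;y^n)$ at non-critical $\theta$ and $\tilde s_n(\theta;y^n)=\nabla s_n(\theta;y^n)=\nabla^2\ell_n(\theta;y^n)$ at critical $\theta$; (b) with $T_n$ denoting this extension and $\mathcal R_n(\alpha)=\{\theta\in\Theta:T_n(\theta;Y^n)\le q_{1,1-\alpha}\}$, where $q_{1,1-\alpha}$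 is the $(1-\alpha)$th quantile of the chi-square distribution with one degree of freedom, it holds for every $\alpha\in(0,1)$ and every non-empty compact $C\subseteq\Theta$ that $$\lim_{n\to\infty}\inf_{\theta\in C}\mathsf P_\theta\{\theta\in\mathcal R_n(\alpha)\}=1-\alpha .$$
   Context: For $i=1,2,\dots$, the random vectors $Y_i\in\mathbb{R}^{r_i}$ ($r_i\ge1$) are independent and, when the parameter is $\theta\in\Theta\subseteq\mathbb R^d$, $Y_i$ has density $f^i_\theta$ (also written $f_\theta(y_i)$) with respect to a dominating measure $\gamma_i$. $Y^n=(Y_1,\dots,Y_n)$ has realization $y^n=(y_1,\dots,y_n)$. A subscript $\theta$ on $\mathsf P,\operatorname{var}$ means the data have the distribution indexed by $\theta$. $\nabla$ is the derivative with respect to $\theta$ and $\nabla^2$ the second derivative; $\ell^i(\theta;y_i)=\log f_\theta(y_i)$, $\ell_n(\theta;y^n)=\sum_{i=1}^n\ell^i(\theta;y_i)$, $s_n=\nabla\ell_n$, $\mathcal I_n(\theta)=\operatorname{var}_\theta\{s_n(\theta;Y^n)\}$ (Fisher information). A point $\theta\in\Theta$ is critical if $\mathcal I_n(\theta)$ is singular (here, zero), and non-critical otherwise; with identically distributed $Y_i$ this does not depend on $n$. "Almost every" and "full measure" refer to $f_\theta(y_i)\gamma_i(\mathrm dy_i)$ (or the corresponding product measure) for any $\theta\in\Theta$. When $B\not\subseteq\Theta$, the conditions on $B$ mean that an extension of the derivative to $B\times\mathcal Y_1$, for some set $\mathcal Y_1$ of full measure, exists and satisfies them.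
   Formalization: In (a), joint continuity off critical points is assumed (it can fail); continuity in θ and joint continuity at critical points are proved. The Y_i share one density version, points of Θ are limit points, and extended derivatives come from an extended log-likelihood. *)

theory Defs
  imports "HOL-Probability.Probability"
begin

definition full_measure :: "'a measure \<Rightarrow> 'a set \<Rightarrow> bool" where
  "full_measure M A \<longleftrightarrow> A \<in> sets M \<and> (AE x in M. x \<in> A)"

definition chi_square :: "nat \<Rightarrow> real measure" where
  "chi_square k = distr (\<Pi>\<^sub>M i\<in>{..<k}. density lborel (\<lambda>x. ennreal (std_normal_density x)))
     borel (\<lambda>z. \<Sum>i<k. (z i)\<^sup>2)"

definition quantile :: "real measure \<Rightarrow> real \<Rightarrow> real" where
  "quantile M p = Inf {x. p \<le> measure M {..x}}"

definition obs_law ::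
  "(nat \<Rightarrow> 'a measure) \<Rightarrow> (nat \<Rightarrow> real \<Rightarrow> 'a \<Rightarrow> real) \<Rightarrow> nat \<Rightarrow> real \<Rightarrow> 'a measure" where
  "obs_law \<gamma> f i \<theta> = density (\<gamma> i) (\<lambda>z. ennreal (f i \<theta> z))"

text \<open>The law of \<open>(Y\<^sub>1, \<dots>, Y\<^sub>n)\<close>. It is completed because the score and the second derivative
  of the log-likelihood are determined only on a set of full measure: without the completion, their
  values on the remaining null set could make them non-measurable, and the
  integral and \<^const>\<open>measure\<close> would then return the default value \<open>0\<close>.\<close>

definition data_law ::
  "(nat \<Rightarrow> 'a measure) \<Rightarrow> (nat \<Rightarrow> real \<Rightarrow> 'a \<Rightarrow> real) \<Rightarrow> nat \<Rightarrow> real \<Rightarrow> (nat \<Rightarrow> 'a) measure" where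
  "data_law \<gamma> f n \<theta> = completion (\<Pi>\<^sub>M i\<in>{1..n}. obs_law \<gamma> f i \<theta>)"

definition loglik ::
  "(nat \<Rightarrow> real \<Rightarrow> 'a \<Rightarrow> real) \<Rightarrow> nat \<Rightarrow> real \<Rightarrow> (nat \<Rightarrow> 'a) \<Rightarrow> real" where
  "loglik f n \<theta> y = (\<Sum>i = 1..n. ln (f i \<theta> (y i)))"

text \<open>Derivatives with respect to the parameter are taken within the parameter set, so that they
  are one-sided where \<open>\<Theta>\<close> is. They are uniquely determined at the limit points of \<open>\<Theta>\<close>.\<close>

definition score ::
  "real set \<Rightarrow> (nat \<Rightarrow> real \<Rightarrow> 'a \<Rightarrow> real) \<Rightarrow> nat \<Rightarrow> real \<Rightarrow> (nat \<Rightarrow> 'a) \<Rightarrow> real" where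
  "score \<Theta> f n \<theta> y = vector_derivative (\<lambda>t. loglik f n t y) (at \<theta> within \<Theta>)"

definition hess ::
  "real set \<Rightarrow> (nat \<Rightarrow> real \<Rightarrow> 'a \<Rightarrow> real) \<Rightarrow> nat \<Rightarrow> real \<Rightarrow> (nat \<Rightarrow> 'a) \<Rightarrow> real" where
  "hess \<Theta> f n \<theta> y = vector_derivative (\<lambda>t. score \<Theta> f n t y) (at \<theta> within \<Theta>)"

definition fisher_info ::
  "real set \<Rightarrow> (nat \<Rightarrow> 'a measure) \<Rightarrow> (nat \<Rightarrow> real \<Rightarrow> 'a \<Rightarrow> real) \<Rightarrow> nat \<Rightarrow> real \<Rightarrow> real" where
  "fisher_info \<Theta> \<gamma> f n \<theta> = prob_space.variance (data_law \<gamma> f n \<theta>) (score \<Theta> f n \<theta>)"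

definition critical ::
  "real set \<Rightarrow> (nat \<Rightarrow> 'a measure) \<Rightarrow> (nat \<Rightarrow> real \<Rightarrow> 'a \<Rightarrow> real) \<Rightarrow> nat \<Rightarrow> real set" where
  "critical \<Theta> \<gamma> f n = {\<theta> \<in> \<Theta>. fisher_info \<Theta> \<gamma> f n \<theta> = 0}"

definition score_stat ::
  "real set \<Rightarrow> (nat \<Rightarrow> 'a measure) \<Rightarrow> (nat \<Rightarrow> real \<Rightarrow> 'a \<Rightarrow> real) \<Rightarrow>
    nat \<Rightarrow> real \<Rightarrow> (nat \<Rightarrow> 'a) \<Rightarrow> real" where
  "score_stat \<Theta> \<gamma> f n \<theta> y = (score \<Theta> f n \<theta> y)\<^sup>2 / fisher_info \<Theta> \<gamma> f n \<theta>"

definition mod_score ::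
  "real set \<Rightarrow> (nat \<Rightarrow> 'a measure) \<Rightarrow> (nat \<Rightarrow> real \<Rightarrow> 'a \<Rightarrow> real) \<Rightarrow>
    nat \<Rightarrow> real \<Rightarrow> (nat \<Rightarrow> 'a) \<Rightarrow> real" where
  "mod_score \<Theta> \<gamma> f n \<theta> y =
     (if \<theta> \<in> critical \<Theta> \<gamma> f n then hess \<Theta> f n \<theta> y else score \<Theta> f n \<theta> y)"

definition mod_score_stat ::
  "real set \<Rightarrow> (nat \<Rightarrow> 'a measure) \<Rightarrow> (nat \<Rightarrow> real \<Rightarrow> 'a \<Rightarrow> real) \<Rightarrow>
    nat \<Rightarrow> real \<Rightarrow> (nat \<Rightarrow> 'a) \<Rightarrow> real" where
  "mod_score_stat \<Theta> \<gamma> f n \<theta> y =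
     (mod_score \<Theta> \<gamma> f n \<theta> y)\<^sup>2 / prob_space.variance (data_law \<gamma> f n \<theta>) (mod_score \<Theta> \<gamma> f n \<theta>)"

definition conf_region ::
  "real set \<Rightarrow> (nat \<Rightarrow> 'a measure) \<Rightarrow> (nat \<Rightarrow> real \<Rightarrow> 'a \<Rightarrow> real) \<Rightarrow>
    nat \<Rightarrow> real \<Rightarrow> (nat \<Rightarrow> 'a) \<Rightarrow> real set" where
  "conf_region \<Theta> \<gamma> f n \<alpha> y =
     {\<theta> \<in> \<Theta>. mod_score_stat \<Theta> \<gamma> f n \<theta> y \<le> quantile (chi_square 1) (1 - \<alpha>)}"

text \<open>\<open>G\<close> is a continuous extension to \<open>B\<close> of the function \<open>g\<close> defined on the subset \<open>A\<close>.\<close>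

definition continuous_extension ::
  "('a::topological_space \<Rightarrow> real) \<Rightarrow> 'a set \<Rightarrow> 'a set \<Rightarrow> ('a \<Rightarrow> real) \<Rightarrow> bool" where
  "continuous_extension g A B G \<longleftrightarrow> A \<subseteq> B \<and> continuous_on B G \<and> (\<forall>x\<in>A. G x = g x)"

text \<open>The regularity and moment conditions on the ball \<open>B\<close>. The function \<open>L\<close> extends the log-likelihood of one
  observation from \<open>B \<inter> \<Theta>\<close> to \<open>B\<close> (it is the log-likelihood itself if \<open>B \<subseteq> \<Theta>\<close>), and \<open>L''\<close> is
  its second derivative. Positivity of the density on \<open>Y\<close> is part of differentiability of the
  log-likelihood, because \<open>ln 0 = 0\<close>.\<close>

definition regular_on_ball ::
  "real set \<Rightarrow> (nat \<Rightarrow> ('a::topological_space) measure) \<Rightarrow> (nat \<Rightarrow> real \<Rightarrow> 'a \<Rightarrow> real) \<Rightarrow>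
    real set \<Rightarrow> real \<Rightarrow> bool" where
  "regular_on_ball \<Theta> \<gamma> f B \<delta> \<longleftrightarrow>
    (\<exists>Y L L' L''.
      (\<forall>\<theta>\<in>\<Theta>. full_measure (obs_law \<gamma> f 1 \<theta>) Y) \<and>
      (\<forall>z\<in>Y. \<forall>\<theta>\<in>B \<inter> \<Theta>. f 1 \<theta> z > 0 \<and> L \<theta> z = ln (f 1 \<theta> z)) \<and>
      (\<forall>z\<in>Y. \<forall>\<theta>\<in>B.
        ((\<lambda>t. L t z) has_real_derivative L' \<theta> z) (at \<theta>) \<and>
        ((\<lambda>t. L' t z) has_real_derivative L'' \<theta> z) (at \<theta>)) \<and>
      continuous_on (B \<times> Y) (\<lambda>(\<theta>, z). L'' \<theta> z) \<and>
      (SUP (\<theta>, \<theta>') \<in> (B \<inter> \<Theta>) \<times> B.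
        \<integral>\<^sup>+ z. ennreal (\<bar>L'' \<theta>' z\<bar> powr (2 + \<delta>) * f 1 \<theta> z) \<partial>\<gamma> 1) < \<infinity>)"

end

theory Submission
  imports Defs
begin

text \<open>Fix \<open>\<theta>\<close>. The second-order expansion of the log-likelihood and the moment bound on its second
  derivative give the score at \<open>\<theta>\<close> mean zero and finite variance, even at boundary points of \<open>\<Theta>\<close>: with
  \<open>X\<close> the log-likelihood ratio of \<open>t\<close> and \<open>\<theta>\<close>, one has \<open>E\<^sub>\<theta> X \<le> 0 \<le> E\<^sub>t X\<close>, which squeezes the mean to zero
  as \<open>t\<close> tends to \<open>\<theta>\<close>, and then \<open>E\<^sub>\<theta> (exp X - 1 - X)\<close> is of second order. Moreover the Fisher information is
  continuous. At a critical \<open>\<theta>\<close> the score vanishes almost surely, so near \<open>\<theta>\<close> the score at \<open>t\<close> divided by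
  \<open>t - \<theta>\<close> is an average of second derivatives, whose variance tends to that of the second derivative
  at \<open>\<theta>\<close>. Hence critical points are isolated, and the score statistic, which is invariant under the
  rescaling by \<open>t - \<theta>\<close>, extends continuously. Convergence of the second moments also yields the Lindeberg
  condition for the rescaled scores along every sequence \<open>t\<close> converging to \<open>\<theta>\<close>. The central limit theorem for
  triangular arrays then gives the asymptotic coverage along such sequences, and this is uniform coverage
  on compact sets.\<close>

section \<open>Convergence of integrals and the central limit theorem for triangular arrays\<close>

text \<open>Domination is replaced by the fact that likelihood ratios integrate to one. This bounds,
  under the approaching law, the positive part of the log-ratio between a point further out and the
  current one, hence, up to Taylor errors, the positive part of the score. Integrals are split where
  the current density exceeds \<open>exp 1\<close> times the limit density: below, the limit law
  dominates; above, the probability tends to zero, and moments of order above two make the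
  contribution vanish. There the log-ratio is positive, so a negative score is no larger than a
  Taylor error.

  Only the second derivative is continuous in the observation: adding \<open>\<theta>\<close> times
  a discontinuous function of the observation to the log-likelihood leaves it unchanged, but not the
  score. At critical points, however, quotients of the score are values of the second derivative, so
  joint continuity of the extension is proved there and elsewhere inherited from the score
  statistic.\<close>

lemma Scheffe_L1:
  fixes G :: "nat \<Rightarrow> 'a \<Rightarrow> real"
  assumes [measurable]: "\<And>k. integrable M (G k)" "integrable M H"
    and nonneg: "\<And>k. AE x in M. 0 \<le> G k x"
    and lim: "AE x in M. (\<lambda>k. G k x) \<longlonglongrightarrow> H x"
    and int: "(\<lambda>k. \<integral>x. G k x \<partial>M) \<longlonglongrightarrow> (\<integral>x. H x \<partial>M)"
  shows "(\<lambda>k. \<integral>x. \<bar>G k x - H x\<bar> \<partial>M) \<longlonglongrightarrow> 0"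
proof -
  have Hnn: "AE x in M. 0 \<le> H x"
  proof -
    have "AE x in M. \<forall>k. 0 \<le> G k x" using nonneg by (simp add: AE_all_countable)
    with lim show ?thesis
      by eventually_elim (auto intro: LIMSEQ_le_const)
  qed
  \<comment> \<open>Only the positive part of \<open>H - G k\<close> is dominated, by
    \<open>H\<close>; the negative part is recovered from the convergence of the integrals.\<close>
  have m: "(\<lambda>k. \<integral>x. max 0 (H x - G k x) \<partial>M) \<longlonglongrightarrow> (\<integral>x. 0 \<partial>M)"
  proof (rule integral_dominated_convergence[where w="\<lambda>x. H x"])
    show "AE x in M. (\<lambda>k. max 0 (H x - G k x)) \<longlonglongrightarrow> 0"
      using lim by eventually_elim (auto intro!: tendsto_eq_intros)
    show "\<And>k. AE x in M. norm (max 0 (H x - G k x)) \<le> H x" for k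
      using nonneg Hnn by (eventually_elim) auto
  qed (use assms in auto)
  have eq: "(\<integral>x. \<bar>G k x - H x\<bar> \<partial>M) = 2 * (\<integral>x. max 0 (H x - G k x) \<partial>M) - ((\<integral>x. H x \<partial>M) - (\<integral>x. G k x \<partial>M))" for k
  proof -
    have "(\<integral>x. \<bar>G k x - H x\<bar> \<partial>M) = (\<integral>x. 2 * max 0 (H x - G k x) - (H x - G k x) \<partial>M)"
      by (rule Bochner_Integration.integral_cong) (auto simp: max_def)
    also have "\<dots> = 2 * (\<integral>x. max 0 (H x - G k x) \<partial>M) - ((\<integral>x. H x \<partial>M) - (\<integral>x. G k x \<partial>M))"
      using assms(1)[of k] assms(2) by simp
    finally show ?thesis .
  qed
  have "(\<lambda>k. 2 * (\<integral>x. max 0 (H x - G k x) \<partial>M) - ((\<integral>x. H x \<partial>M) - (\<integral>x. G k x \<partial>M))) \<longlonglongrightarrow> 2 * 0 - ((\<integral>x. H x \<partial>M) - (\<integral>x. H x \<partial>M))"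
    using m int by (intro tendsto_intros) auto
  then show ?thesis unfolding eq by simp
qed

text \<open>Dominated convergence with a majorant that moves along with the sequence, as it must
  when the density moves. Clipping \<open>g k\<close> to the range between \<open>- G'\<close> and
  \<open>G'\<close> makes ordinary dominated convergence apply, and the clipping costs at most
  \<open>\<bar>G k - G'\<bar>\<close>, which vanishes in mean by Scheffe's lemma.\<close>

lemma Pratt:
  fixes g :: "nat \<Rightarrow> 'a \<Rightarrow> real"
  assumes g [measurable]: "\<And>k. g k \<in> borel_measurable M" "g' \<in> borel_measurable M"
    and G: "\<And>k. integrable M (G k)" "integrable M G'"
    and glim: "AE x in M. (\<lambda>k. g k x) \<longlonglongrightarrow> g' x"
    and Glim: "AE x in M. (\<lambda>k. G k x) \<longlonglongrightarrow> G' x"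
    and bound: "\<And>k. AE x in M. \<bar>g k x\<bar> \<le> G k x"
    and int: "(\<lambda>k. \<integral>x. G k x \<partial>M) \<longlonglongrightarrow> (\<integral>x. G' x \<partial>M)"
  shows "integrable M g'" "(\<lambda>k. \<integral>x. g k x \<partial>M) \<longlonglongrightarrow> (\<integral>x. g' x \<partial>M)"
proof -
  have [measurable]: "\<And>k. G k \<in> borel_measurable M" "G' \<in> borel_measurable M" using G by auto
  have g'b: "AE x in M. \<bar>g' x\<bar> \<le> G' x"
  proof -
    have "AE x in M. \<forall>k. \<bar>g k x\<bar> \<le> G k x" using bound by (simp add: AE_all_countable)
    with glim Glim show ?thesis
      by eventually_elim (blast intro: LIMSEQ_le tendsto_rabs)
  qed
  show "integrable M g'"
    by (rule Bochner_Integration.integrable_bound[OF G(2)]) (use g'b in \<open>auto elim!: eventually_mono\<close>)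
  have gi: "integrable M (g k)" for k
    by (rule Bochner_Integration.integrable_bound[OF G(1)[of k]]) (use bound[of k] in \<open>auto elim!: eventually_mono\<close>)
  define c where "c k x = max (- G' x) (min (g k x) (G' x))" for k x
  have [measurable]: "c k \<in> borel_measurable M" for k unfolding c_def by measurable
  have cb: "AE x in M. \<bar>c k x\<bar> \<le> G' x" for k
    using g'b by eventually_elim (auto simp: c_def)
  have ci: "integrable M (c k)" for k
    by (rule Bochner_Integration.integrable_bound[OF G(2)]) (use cb[of k] in \<open>auto elim!: eventually_mono\<close>)
  have clim: "(\<lambda>k. \<integral>x. c k x \<partial>M) \<longlonglongrightarrow> (\<integral>x. g' x \<partial>M)"
  proof (rule integral_dominated_convergence[where w=G'])
    show "AE x in M. (\<lambda>k. c k x) \<longlonglongrightarrow> g' x"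
      using glim g'b
    proof eventually_elim
      case (elim x)
      then have "(\<lambda>k. c k x) \<longlonglongrightarrow> max (- G' x) (min (g' x) (G' x))"
        unfolding c_def by (intro tendsto_intros)
      also have "max (- G' x) (min (g' x) (G' x)) = g' x" using elim by auto
      finally show ?case .
    qed
  qed (use cb G in auto)
  have S: "(\<lambda>k. \<integral>x. \<bar>G k x - G' x\<bar> \<partial>M) \<longlonglongrightarrow> 0"
  proof (rule Scheffe_L1)
    show "AE x in M. 0 \<le> G k x" for k
      using bound[of k] by eventually_elim auto
  qed (use G Glim int in auto)
  have d: "\<bar>(\<integral>x. g k x \<partial>M) - (\<integral>x. c k x \<partial>M)\<bar> \<le> (\<integral>x. \<bar>G k x - G' x\<bar> \<partial>M)" for k
  proof -
    have "\<bar>(\<integral>x. g k x \<partial>M) - (\<integral>x. c k x \<partial>M)\<bar> = \<bar>\<integral>x. g k x - c k x \<partial>M\<bar>"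
      using gi ci by simp
    also have "\<dots> \<le> (\<integral>x. \<bar>g k x - c k x\<bar> \<partial>M)" by (rule integral_abs_bound)
    also have "\<dots> \<le> (\<integral>x. \<bar>G k x - G' x\<bar> \<partial>M)"
    proof (rule integral_mono_AE)
      show "AE x in M. \<bar>g k x - c k x\<bar> \<le> \<bar>G k x - G' x\<bar>"
        using bound[of k] g'b by eventually_elim (auto simp: c_def max_def min_def)
    qed (use gi ci G in auto)
    finally show ?thesis .
  qed
  have "(\<lambda>k. (\<integral>x. g k x \<partial>M) - (\<integral>x. c k x \<partial>M)) \<longlonglongrightarrow> 0"
    by (rule Lim_null_comparison[OF _ S]) (use d in auto)
  from tendsto_add[OF this clim] show "(\<lambda>k. \<integral>x. g k x \<partial>M) \<longlonglongrightarrow> (\<integral>x. g' x \<partial>M)" by simp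
qed

text \<open>Fatou's lemma in a form that delivers integrability of the limit. A bound on the Bochner
  integral alone would be void, since the integral of a non-integrable function is zero.\<close>

lemma integrable_limit_bounded:
  fixes g :: "nat \<Rightarrow> 'a \<Rightarrow> real"
  assumes g: "\<And>k. integrable M (g k)" "g' \<in> borel_measurable M"
    and nonneg: "\<And>k. AE x in M. 0 \<le> g k x"
    and lim: "AE x in M. (\<lambda>k. g k x) \<longlonglongrightarrow> g' x"
    and le: "\<And>k. (\<integral>x. g k x \<partial>M) \<le> C"
  shows "integrable M g'" "(\<integral>x. g' x \<partial>M) \<le> C"
proof -
  have nn: "AE x in M. 0 \<le> g' x"
  proof -
    have "AE x in M. \<forall>k. 0 \<le> g k x" using nonneg by (simp add: AE_all_countable)
    with lim show ?thesis
      by eventually_elim (auto intro: LIMSEQ_le_const)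
  qed
  have C: "0 \<le> C" using integral_nonneg_AE[OF nonneg[of 0]] le[of 0] by linarith
  have "(\<integral>\<^sup>+x. ennreal (g' x) \<partial>M) = (\<integral>\<^sup>+x. liminf (\<lambda>k. ennreal (g k x)) \<partial>M)"
  proof (rule nn_integral_cong_AE)
    show "AE x in M. ennreal (g' x) = liminf (\<lambda>k. ennreal (g k x))"
      using lim by eventually_elim (metis lim_imp_Liminf sequentially_bot tendsto_ennrealI)
  qed
  also have "\<dots> \<le> liminf (\<lambda>k. \<integral>\<^sup>+x. ennreal (g k x) \<partial>M)"
    by (rule nn_integral_liminf) (use g in auto)
  also have "\<dots> \<le> ennreal C"
  proof -
    have "(\<integral>\<^sup>+x. ennreal (g k x) \<partial>M) \<le> ennreal C" for k
      using le[of k] by (subst nn_integral_eq_integral[OF g(1) nonneg]) (rule ennreal_leI)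
    then have "liminf (\<lambda>k. \<integral>\<^sup>+x. ennreal (g k x) \<partial>M) \<le> liminf (\<lambda>k. ennreal C)"
      by (intro Liminf_mono) auto
    also have "\<dots> = ennreal C" by (rule Liminf_const) simp
    finally show ?thesis .
  qed
  finally have b: "(\<integral>\<^sup>+x. ennreal (g' x) \<partial>M) \<le> ennreal C" .
  show i: "integrable M g'"
    by (rule integrableI_nonneg[OF g(2) nn]) (use b in \<open>auto simp: less_top[symmetric] top_unique\<close>)
  show "(\<integral>x. g' x \<partial>M) \<le> C"
    using b C by (subst (asm) nn_integral_eq_integral[OF i nn]) (simp add: ennreal_le_iff)
qed

section \<open>Characteristic functions and the central limit theorem\<close>

lemma char_PiM_sum:
  fixes V :: "'a \<Rightarrow> real"
  assumes "prob_space M" and V [measurable]: "V \<in> borel_measurable M"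
  shows "char (distr (\<Pi>\<^sub>M i\<in>{1..n::nat}. M) borel (\<lambda>y. \<Sum>i=1..n. V (y i))) t = (char (distr M borel V) t) ^ n"
proof -
  interpret prob_space M by fact
  interpret P: product_prob_space "\<lambda>_::nat. M" "{1..n}" by unfold_locales
  have "char (distr (\<Pi>\<^sub>M i\<in>{1..n}. M) borel (\<lambda>y. \<Sum>i=1..n. V (y i))) t
      = (\<integral>y. (\<Prod>i\<in>{1..n}. iexp (t * V (y i))) \<partial>(\<Pi>\<^sub>M i\<in>{1..n}. M))"
    unfolding char_def
    by (subst integral_distr) (auto simp: exp_sum[symmetric] sum_distrib_left sum_distrib_right)
  also have "\<dots> = (\<Prod>i\<in>{1..n}. (\<integral>x. iexp (t * V x) \<partial>M))"
    by (rule P.product_integral_prod) (auto intro!: integrable_iexp)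
  also have "\<dots> = (char (distr M borel V) t) ^ n"
    unfolding char_def by (subst integral_distr) auto
  finally show ?thesis .
qed

text \<open>The characteristic function of a normalized summand and its quadratic approximation both
  have modulus at most one (the latter eventually), so raising them to the power \<open>N k\<close>
  multiplies their distance by at most \<open>N k\<close>. That distance is of order
  \<open>1 / N k\<close> times a factor which Lindeberg's condition sends to zero.\<close>

lemma triangular_clt:
  fixes V :: "nat \<Rightarrow> 'a \<Rightarrow> real" and N :: "nat \<Rightarrow> nat" and v :: "nat \<Rightarrow> real" and v' :: real
  assumes P: "\<And>k. prob_space (M k)"
    and V [measurable]: "\<And>k. V k \<in> borel_measurable (M k)"
    and sq: "\<And>k. integrable (M k) (\<lambda>x. (V k x)\<^sup>2)"
    and mean: "\<And>k. (\<integral>x. V k x \<partial>M k) = 0"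
    and var: "\<And>k. (\<integral>x. (V k x)\<^sup>2 \<partial>M k) = v k" "v \<longlonglongrightarrow> v'" "v' > 0" "\<And>k. v k > 0"
    and N: "filterlim N at_top sequentially"
    and Lindeberg: "\<And>e. e > 0 \<Longrightarrow>
      (\<lambda>k. \<integral>x. (V k x)\<^sup>2 * indicator {x. \<bar>V k x\<bar> > e * sqrt (N k)} x \<partial>M k) \<longlonglongrightarrow> 0"
  shows "weak_conv_m (\<lambda>k. distr (\<Pi>\<^sub>M i\<in>{1..N k}. M k) borel (\<lambda>y. (\<Sum>i=1..N k. V k (y i)) / sqrt (N k * v k)))
           std_normal_distribution"
proof (rule levy_continuity)
  show "real_distribution (distr (\<Pi>\<^sub>M i\<in>{1..N k}. M k) borel (\<lambda>y. (\<Sum>i=1..N k. V k (y i)) / sqrt (N k * v k)))" for k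
  proof -
    interpret prob_space "M k" by (rule P)
    interpret Q: product_prob_space "\<lambda>_::nat. M k" "{1..N k}" by unfold_locales
    show ?thesis by (rule Q.real_distribution_distr) measurable
  qed
next
  show "real_distribution std_normal_distribution" by (rule real_dist_normal_dist)
next
  fix t :: real
  define W where "W k x = V k x / sqrt (v k)" for k x
  define u where "u k = t / sqrt (N k)" for k
  have [measurable]: "W k \<in> borel_measurable (M k)" for k unfolding W_def by measurable
  \<comment> \<open>The remainder of the second-order expansion of the characteristic function:
    cubic where \<open>W\<close> is moderate, capped by a quadratic where it is large. The variance
    of \<open>W k\<close> is one.\<close>
  define e where "e k = (\<integral>x. min (6 * (W k x)\<^sup>2) (\<bar>u k\<bar> * \<bar>W k x\<bar>^3) \<partial>M k)" for k
  have W2: "(W k x)\<^sup>2 = (V k x)\<^sup>2 / v k" for k x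
    using var(4)[of k] by (simp add: W_def power_divide)
  have Wi: "integrable (M k) (\<lambda>x. (W k x)\<^sup>2)" for k unfolding W2 using sq by auto
  have WE: "(\<integral>x. (W k x)\<^sup>2 \<partial>M k) = 1" for k unfolding W2 using var(1)[of k] var(4)[of k] by simp
  have app: "cmod (char (distr (M k) borel (W k)) (u k) - (1 - (u k)\<^sup>2 / 2)) \<le> (u k)\<^sup>2 / 6 * e k" for k
  proof -
    interpret prob_space "M k" by (rule P)
    have W0: "(\<integral>x. W k x \<partial>M k) = 0" unfolding W_def using mean[of k] by simp
    have "cmod (char (distr (M k) borel (W k)) (u k) - (1 - (u k)\<^sup>2 * 1 / 2)) \<le> (u k)\<^sup>2 / 6 * e k"
      unfolding e_def
      by (rule char_approx3') (use W0 Wi WE square_integrable_imp_integrable[OF _ Wi] in auto)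
    then show ?thesis by simp
  qed
  have c1: "cmod (char (distr (M k) borel (W k)) s) \<le> 1" for k s
  proof -
    interpret prob_space "M k" by (rule P)
    show ?thesis by (rule real_distribution.cmod_char_le_1) (auto intro: real_distribution_distr)
  qed
  have e0: "e \<longlonglongrightarrow> 0"
  proof (rule tendstoI)
    fix \<epsilon> :: real assume \<epsilon>: "\<epsilon> > 0"
    \<comment> \<open>Below the truncation level the cubic bound is at most
      \<open>\<bar>t\<bar> * d\<close> times the square of \<open>W k\<close>; above it the
      quadratic bound is left to Lindeberg's condition. The level is formed with
      \<open>v' / 2\<close> in place of the row variance, because the condition is assumed for
      constants \<open>e\<close> that do not depend on \<open>k\<close>.\<close>
    define d where "d = \<epsilon> / (2 * (\<bar>t\<bar> + 1))"
    have d: "d > 0" "\<bar>t\<bar> * d < \<epsilon>" using \<epsilon> by (auto simp: d_def field_simps) 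
       (smt (verit, best) mult_nonneg_nonneg zero_le_mult_iff)
    let ?U = "\<lambda>k x. (V k x)\<^sup>2 * indicator {x. \<bar>V k x\<bar> > (d * sqrt (v'/2)) * sqrt (N k)} x"
    define L where "L k = (\<integral>x. ?U k x \<partial>M k)" for k
    have L: "L \<longlonglongrightarrow> 0" unfolding L_def by (rule Lindeberg) (use d var(3) in auto)
    have le: "e k \<le> \<bar>t\<bar> * d + 6 * L k / v k" if vk: "v k \<ge> v' / 2" and Nk: "N k > 0" for k
    proof -
      interpret prob_space "M k" by (rule P)
      have Li: "integrable (M k) (\<lambda>x. ?U k x)"
        by (rule Bochner_Integration.integrable_bound[OF sq[of k]]) (auto simp: indicator_def)
      have "e k \<le> (\<integral>x. (\<bar>t\<bar> * d) * (W k x)\<^sup>2 + 6 / v k * ?U k x \<partial>M k)"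
        unfolding e_def
      proof (rule integral_mono)
        show "integrable (M k) (\<lambda>x. min (6 * (W k x)\<^sup>2) (\<bar>u k\<bar> * \<bar>W k x\<bar> ^ 3))"
          by (rule Bochner_Integration.integrable_bound[OF integrable_mult_right[OF Wi[of k], of 6]]) auto
        show "integrable (M k) (\<lambda>x. (\<bar>t\<bar> * d) * (W k x)\<^sup>2 + 6 / v k * ?U k x)"
          using Wi Li by auto
        fix x
        show "min (6 * (W k x)\<^sup>2) (\<bar>u k\<bar> * \<bar>W k x\<bar> ^ 3) \<le> (\<bar>t\<bar> * d) * (W k x)\<^sup>2 + 6 / v k * ?U k x"
        proof (cases "\<bar>V k x\<bar> > (d * sqrt (v'/2)) * sqrt (N k)")
          case True
          have "min (6 * (W k x)\<^sup>2) (\<bar>u k\<bar> * \<bar>W k x\<bar> ^ 3) \<le> 6 * (W k x)\<^sup>2" by simp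
          also have "\<dots> = 6 / v k * (V k x)\<^sup>2" unfolding W2 by simp
          finally show ?thesis using True d by (simp add: add_increasing)
        next
          case False
          have s: "sqrt (v'/2) \<le> sqrt (v k)" using vk by simp
          have "\<bar>V k x\<bar> \<le> (d * sqrt (v'/2)) * sqrt (N k)" using False by simp
          also have "\<dots> \<le> d * sqrt (v k) * sqrt (N k)" using s d by (intro mult_right_mono mult_left_mono) auto
          finally have "\<bar>W k x\<bar> \<le> d * sqrt (N k)"
            using var(4)[of k] by (simp add: W_def field_simps abs_if split: if_splits)
          then have "\<bar>u k\<bar> * \<bar>W k x\<bar> \<le> \<bar>u k\<bar> * (d * sqrt (N k))" by (rule mult_left_mono) simp
          also have "\<dots> = \<bar>t\<bar> * d" using Nk by (simp add: u_def)
          finally have "\<bar>u k\<bar> * \<bar>W k x\<bar> * (W k x)\<^sup>2 \<le> \<bar>t\<bar> * d * (W k x)\<^sup>2" by (rule mult_right_mono) simp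
          then have "\<bar>u k\<bar> * \<bar>W k x\<bar>^3 \<le> \<bar>t\<bar> * d * (W k x)\<^sup>2"
            by (simp add: power3_eq_cube power2_eq_square mult.assoc abs_mult_self_eq)
          then show ?thesis using False by simp
        qed
      qed
      also have "\<dots> = \<bar>t\<bar> * d * 1 + 6 / v k * L k"
        unfolding L_def using Wi Li WE by simp
      finally show ?thesis by simp
    qed
    have "(\<lambda>k. \<bar>t\<bar> * d + 6 * L k / v k) \<longlonglongrightarrow> \<bar>t\<bar> * d + 6 * 0 / v'"
      by (intro tendsto_intros L var(2)) (use var(3) in simp)
    then have "\<forall>\<^sub>F k in sequentially. \<bar>t\<bar> * d + 6 * L k / v k < \<epsilon>"
      using d(2) by (intro order_tendstoD(2)) auto
    moreover have "\<forall>\<^sub>F k in sequentially. v k \<ge> v' / 2"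
      using order_tendstoD(1)[OF var(2), of "v'/2"] var(3) by (auto elim: eventually_mono)
    moreover have "\<forall>\<^sub>F k in sequentially. N k > 0"
      using N[unfolded filterlim_at_top, rule_format, of 1] by (auto elim: eventually_mono)
    ultimately show "\<forall>\<^sub>F k in sequentially. dist (e k) 0 < \<epsilon>"
    proof eventually_elim
      case (elim k)
      moreover have "e k \<ge> 0" unfolding e_def by (rule integral_nonneg_AE) auto
      ultimately show ?case using le[of k] by simp
    qed
  qed
  have Nr: "filterlim (\<lambda>k. real (N k)) at_top sequentially"
    using N filterlim_compose[OF filterlim_real_sequentially] by blast
  have chr: "char (distr (\<Pi>\<^sub>M i\<in>{1..N k}. M k) borel (\<lambda>y. (\<Sum>i=1..N k. V k (y i)) / sqrt (N k * v k))) t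
      = (char (distr (M k) borel (W k)) (u k)) ^ N k" for k
  proof -
    interpret prob_space "M k" by (rule P)
    have "char (distr (\<Pi>\<^sub>M i\<in>{1..N k}. M k) borel (\<lambda>y. (\<Sum>i=1..N k. V k (y i)) / sqrt (N k * v k))) t
      = char (distr (\<Pi>\<^sub>M i\<in>{1..N k}. M k) borel (\<lambda>y. \<Sum>i=1..N k. W k (y i))) (u k)"
      unfolding char_def W_def u_def
      by (subst (1 2) integral_distr) (auto simp: real_sqrt_mult sum_divide_distrib[symmetric] field_simps)
    then show ?thesis using char_PiM_sum[OF P, of "W k" k "N k" "u k"] by simp
  qed
  have main: "\<forall>\<^sub>F k in sequentially. cmod ((char (distr (M k) borel (W k)) (u k)) ^ N k - complex_of_real ((1 + (- (t\<^sup>2) / 2) / N k) ^ N k)) \<le> t\<^sup>2 / 6 * e k"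
  proof -
    \<comment> \<open>Beyond \<open>t\<^sup>2 / 4\<close> the approximating factor is at least
      \<open>-1\<close>, so its modulus does not exceed one.\<close>
    have "\<forall>\<^sub>F k in sequentially. real (N k) > max 0 (t\<^sup>2 / 4)"
      using Nr unfolding filterlim_at_top_dense by blast
    then show ?thesis
    proof eventually_elim
      case (elim k)
      have u2: "(u k)\<^sup>2 = t\<^sup>2 / N k" by (simp add: u_def power_divide)
      have Nk: "real (N k) > 0" "t\<^sup>2 / 2 \<le> 2 * real (N k)"
        using elim max.cobounded1[of 0 "t\<^sup>2 / 4"] max.cobounded2[of "t\<^sup>2 / 4" 0] by linarith+
      let ?b = "complex_of_real (1 + (- (t\<^sup>2) / 2) / N k)"
      have "cmod ?b \<le> 1"
      proof -
        from Nk have "t\<^sup>2 / 2 / N k \<le> 2" by (simp only: pos_divide_le_eq)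
        moreover have "0 \<le> t\<^sup>2 / 2 / N k" by simp
        ultimately have "\<bar>1 + (- (t\<^sup>2) / 2) / N k\<bar> \<le> 1" by (simp only: divide_minus_left abs_le_iff) simp
        then show ?thesis by (simp only: norm_of_real)
      qed
      then have "cmod ((char (distr (M k) borel (W k)) (u k)) ^ N k - ?b ^ N k) \<le> N k * cmod (char (distr (M k) borel (W k)) (u k) - ?b)"
        by (intro norm_power_diff c1)
      also have b: "?b = 1 - (u k)\<^sup>2 / 2" unfolding u2 by simp
      also have "real (N k) * cmod (char (distr (M k) borel (W k)) (u k) - (1 - (u k)\<^sup>2 / 2)) \<le> N k * ((u k)\<^sup>2 / 6 * e k)"
        by (intro mult_left_mono) (use app[of k] in \<open>simp_all\<close>)
      also have "\<dots> = t\<^sup>2 / 6 * e k" unfolding u2 using Nk(1) by simp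
      finally show ?case by (simp only: of_real_power b)
    qed
  qed
  have "(\<lambda>n. complex_of_real ((1 + (-(t^2) / 2) / real n)^n)) \<longlonglongrightarrow> complex_of_real (exp (-(t^2) / 2))"
    by (rule isCont_tendsto_compose [OF _ tendsto_exp_limit_sequentially]) auto
  from filterlim_compose[OF this N]
  have l1: "(\<lambda>k. complex_of_real ((1 + (-(t^2) / 2) / N k)^N k)) \<longlonglongrightarrow> complex_of_real (exp (-(t^2) / 2))" .
  have "(\<lambda>k. t\<^sup>2 / 6 * e k) \<longlonglongrightarrow> 0" using tendsto_mult_right_zero[OF e0] by simp
  with main have "(\<lambda>k. (char (distr (M k) borel (W k)) (u k)) ^ N k - complex_of_real ((1 + (- (t\<^sup>2) / 2) / N k) ^ N k)) \<longlonglongrightarrow> 0"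
    by (rule Lim_null_comparison)
  from Lim_transform[OF l1 this]
  show "(\<lambda>k. char (distr (\<Pi>\<^sub>M i\<in>{1..N k}. M k) borel (\<lambda>y. (\<Sum>i=1..N k. V k (y i)) / sqrt (N k * v k))) t) \<longlonglongrightarrow> char std_normal_distribution t"
    unfolding chr by (simp add: char_std_normal_distribution)
qed

section \<open>Quantiles of the chi-square distribution and uniform convergence\<close>

text \<open>Without atoms the distribution function is continuous. Hence the infimum defining the
  quantile is attained, which gives one inequality, and the values to its left stay below
  \<open>p\<close>, which gives the other. The limits at both ends make the set non-empty and
  bounded below, so the infimum is a genuine one.\<close>

lemma measure_quantile:
  assumes "real_distribution M" and cont: "\<And>x. measure M {x} = 0" and p: "0 < p" "p < 1"
  shows "measure M {..quantile M p} = p"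
proof -
  interpret real_distribution M by fact
  have cdf: "cdf M x = measure M {..x}" for x by (simp add: cdf_def)
  have c: "isCont (cdf M) x" for x
    using isCont_cdf[of x] cont by simp
  define A where "A = {x. p \<le> cdf M x}"
  have "\<exists>x. p \<le> cdf M x"
  proof -
    have "\<forall>\<^sub>F x in at_top. p < cdf M x" by (rule order_tendstoD(1)[OF cdf_lim_at_top_prob p(2)])
    then show ?thesis using eventually_happens'[OF trivial_limit_at_top_linorder] less_imp_le by blast
  qed
  then have ne: "A \<noteq> {}" by (auto simp: A_def)
  have "\<forall>\<^sub>F x in at_bot. cdf M x < p" by (rule order_tendstoD(2)[OF cdf_lim_at_bot p(1)])
  then obtain b where b: "\<And>x. x \<le> b \<Longrightarrow> cdf M x < p" by (auto simp: eventually_at_bot_linorder)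
  have bdd: "bdd_below A"
    by (rule bdd_belowI[of _ b]) (use b in \<open>auto simp: A_def not_less[symmetric] intro!: ccontr[of "b \<le> _"]\<close>)
  have closed: "closed A"
    unfolding A_def by (intro closed_Collect_le continuous_intros continuous_at_imp_continuous_on ballI c)
  define q where "q = quantile M p"
  have q: "q = Inf A" by (simp add: q_def quantile_def A_def cdf)
  have "q \<in> A" unfolding q by (rule closed_contains_Inf[OF ne bdd closed])
  then have ge: "p \<le> cdf M q" by (simp add: A_def)
  have "cdf M q \<le> p"
  proof (rule tendsto_upperbound)
    show "(cdf M \<longlongrightarrow> cdf M q) (at_left q)" using c[of q] by (simp add: isCont_def filterlim_at_split)
    have "cdf M x \<le> p" if "x < q" for x
      using cInf_lower[OF _ bdd, of x] that by (force simp: q A_def)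
    then show "\<forall>\<^sub>F x in at_left q. cdf M x \<le> p" by (auto simp: eventually_at_filter)
  qed simp
  with ge show ?thesis by (simp add: cdf q_def)
qed

lemma chi_square_1: "chi_square 1 = distr std_normal_distribution borel (\<lambda>x. x\<^sup>2)"
proof -
  let ?N = "density lborel (\<lambda>x. ennreal (std_normal_density x))"
  interpret N: prob_space ?N by (rule prob_space_normal_density) simp
  interpret P: product_prob_space "\<lambda>_::nat. ?N" "{..<1}" by unfold_locales
  have "distr (\<Pi>\<^sub>M i\<in>{..<1::nat}. ?N) ?N (\<lambda>z. z 0) = ?N"
    by (rule distr_PiM_component) (auto intro: N.prob_space_axioms)
  then have "distr ?N borel (\<lambda>x. x\<^sup>2) = distr (distr (\<Pi>\<^sub>M i\<in>{..<1::nat}. ?N) ?N (\<lambda>z. z 0)) borel (\<lambda>x. x\<^sup>2)"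
    by simp
  also have "\<dots> = distr (\<Pi>\<^sub>M i\<in>{..<1::nat}. ?N) borel (\<lambda>z. (z 0)\<^sup>2)"
    by (subst distr_distr) (auto simp: comp_def)
  finally show ?thesis by (simp add: chi_square_def lessThan_Suc)
qed

lemma std_normal_null: "finite A \<Longrightarrow> emeasure std_normal_distribution A = 0"
  by (subst emeasure_density) (auto intro!: nn_integral_null_set finite_imp_null_set_lborel borel_closed finite_imp_closed)

text \<open>The second claim makes the event a continuity set: weak convergence controls only
  probabilities of events with null boundary. Here the boundary consists of solutions of
  \<open>z\<^sup>2 = q\<close>, hence of at most two points.\<close>

lemma chi_square_1_quantile:
  fixes \<alpha> :: real
  assumes "0 < \<alpha>" "\<alpha> < 1"
  defines "q \<equiv> quantile (chi_square 1) (1 - \<alpha>)"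
  shows "measure std_normal_distribution {z. z\<^sup>2 \<le> q} = 1 - \<alpha>" "emeasure std_normal_distribution (frontier {z. z\<^sup>2 \<le> q}) = 0"
proof -
  interpret N: real_distribution std_normal_distribution by (rule real_dist_normal_dist)
  have rd: "real_distribution (chi_square 1)" unfolding chi_square_1 by (rule N.real_distribution_distr) simp
  have fin: "finite {z::real. z\<^sup>2 = x}" for x
    by (rule finite_subset[of _ "{sqrt x, - sqrt x}"]) (auto simp: real_sqrt_abs abs_if split: if_splits)
  have "measure (chi_square 1) {x} = 0" for x
    unfolding chi_square_1 using fin[of x]
    by (subst measure_distr) (auto simp: vimage_def measure_def std_normal_null)
  from measure_quantile[OF rd this, of "1 - \<alpha>"] assms(1,2)
  have "measure (chi_square 1) {..q} = 1 - \<alpha>" by (simp add: q_def)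
  then show "measure std_normal_distribution {z. z\<^sup>2 \<le> q} = 1 - \<alpha>"
    unfolding chi_square_1 by (subst (asm) measure_distr) (auto simp: vimage_def)
  have "frontier {z::real. z\<^sup>2 \<le> q} \<subseteq> {z. z\<^sup>2 = q}"
  proof -
    have "closed {z::real. z\<^sup>2 \<le> q}" by (intro closed_Collect_le continuous_intros)
    moreover have "{z::real. z\<^sup>2 < q} \<subseteq> interior {z. z\<^sup>2 \<le> q}"
      by (intro interior_maximal open_Collect_less continuous_intros) auto
    ultimately show ?thesis by (auto simp: frontier_def closure_closed less_le)
  qed
  then have "finite (frontier {z::real. z\<^sup>2 \<le> q})" using fin finite_subset by blast
  then show "emeasure std_normal_distribution (frontier {z. z\<^sup>2 \<le> q}) = 0" by (rule std_normal_null)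
qed

text \<open>Uniform convergence may fail along a subsequence only, so the hypothesis has to admit
  sample sizes along any strictly increasing \<open>r\<close>; compactness then thins the offending
  indices once more.\<close>

lemma uniform_limit_on_compactI:
  fixes g :: "nat \<Rightarrow> real \<Rightarrow> real"
  assumes C: "compact C"
    and lim: "\<And>r t \<theta>. strict_mono r \<Longrightarrow> (\<And>k. t k \<in> C) \<Longrightarrow> \<theta> \<in> C \<Longrightarrow> t \<longlonglongrightarrow> \<theta> \<Longrightarrow> (\<lambda>k. g (r k) (t k)) \<longlonglongrightarrow> c"
  shows "uniform_limit C g (\<lambda>_. c) sequentially"
proof (rule ccontr)
  assume "\<not> uniform_limit C g (\<lambda>_. c) sequentially"
  then obtain e where e: "e > 0" and "\<exists>\<^sub>F n in sequentially. \<exists>x\<in>C. dist (g n x) c \<ge> e"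
    by (auto simp: uniform_limit_iff frequently_def not_le)
  then have "\<exists>\<^sub>\<infinity>n. \<exists>x\<in>C. dist (g n x) c \<ge> e" by (simp add: cofinite_eq_sequentially)
  then have inf: "infinite {n. \<exists>x\<in>C. dist (g n x) c \<ge> e}" by (simp add: INFM_iff_infinite)
  obtain r :: "nat \<Rightarrow> nat" where r: "strict_mono r" and "\<And>k. r k \<in> {n. \<exists>x\<in>C. dist (g n x) c \<ge> e}"
    using infinite_enumerate[OF inf] by blast
  then have "\<forall>k. \<exists>x\<in>C. dist (g (r k) x) c \<ge> e" by auto
  then obtain t where t: "\<And>k. t k \<in> C" "\<And>k. dist (g (r k) (t k)) c \<ge> e" by metis
  obtain \<theta> s where s: "\<theta> \<in> C" "strict_mono (s::nat\<Rightarrow>nat)" "(t \<circ> s) \<longlonglongrightarrow> \<theta>"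
    using C t(1) unfolding compact_def by metis
  have "(\<lambda>k. g ((r \<circ> s) k) ((t \<circ> s) k)) \<longlonglongrightarrow> c"
    by (rule lim[OF strict_mono_o[OF r s(2)] _ s(1,3)]) (simp add: t)
  then have "\<forall>\<^sub>F k in sequentially. dist (g (r (s k)) (t (s k))) c < e" using tendstoD[OF _ e] by fastforce
  then obtain k where "dist (g (r (s k)) (t (s k))) c < e" using eventually_happens'[OF sequentially_bot] by blast
  with t(2)[of "s k"] show False by simp
qed

lemma tendsto_INF_uniform:
  fixes g :: "nat \<Rightarrow> 'b \<Rightarrow> real"
  assumes u: "uniform_limit C g (\<lambda>_. c) sequentially" and ne: "C \<noteq> {}"
  shows "(\<lambda>n. INF x\<in>C. g n x) \<longlonglongrightarrow> c"
proof (rule tendstoI)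
  fix e :: real assume e: "e > 0"
  then have "\<forall>\<^sub>F n in sequentially. \<forall>x\<in>C. dist (g n x) c < e/2" 
    using u[unfolded uniform_limit_iff, rule_format, of "e/2"] by simp
  then show "\<forall>\<^sub>F n in sequentially. dist (INF x\<in>C. g n x) c < e"
  proof eventually_elim
    case (elim n)
    have b: "bdd_below (g n ` C)"
      by (rule bdd_belowI2[of _ "c - e/2"]) (use elim in \<open>force simp: dist_real_def abs_if split: if_splits\<close>)
    obtain x where x: "x \<in> C" using ne by auto
    have "(INF x\<in>C. g n x) \<le> g n x" by (rule cINF_lower[OF b x])
    moreover have "c - e/2 \<le> (INF x\<in>C. g n x)"
      by (rule cINF_greatest[OF ne]) (use elim in \<open>force simp: dist_real_def abs_if split: if_splits\<close>)
    ultimately show ?case using elim x e by (force simp: dist_real_def abs_if split: if_splits)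
  qed
qed

section \<open>Moments of the score\<close>

text \<open>Raise \<open>y / p \<le> exp (y / p)\<close> to the power \<open>p\<close>. When
  \<open>y\<close> is a positive log-likelihood ratio, the right-hand side is a multiple of the
  ratio itself, whose integral is one; this bounds all moments of the positive part of the
  logarithm.\<close>

lemma powr_le_exp:
  fixes y p :: real
  assumes "0 \<le> y" "0 < p"
  shows "y powr p \<le> p powr p * exp y"
proof -
  have "y / p \<le> exp (y / p)" using exp_ge_add_one_self[of "y/p"] by linarith
  then have "y \<le> p * exp (y / p)" using assms by (simp add: field_simps)
  then have "y powr p \<le> (p * exp (y / p)) powr p" using assms by (intro powr_mono2) auto
  also have "\<dots> = p powr p * exp y" using assms by (simp add: powr_mult exp_powr_real)
  finally show ?thesis .
qed

text \<open>The coefficient of the quadratic remainder is at least \<open>exp (- 1) / 2\<close>, and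
  \<open>exp 1 \<le> 3\<close> turns this into one sixth.\<close>

lemma sq_div_6_le_exp:
  fixes x :: real
  assumes "\<bar>x\<bar> \<le> 1"
  shows "x\<^sup>2 / 6 \<le> exp x - 1 - x"
proof -
  obtain t where t: "\<bar>t\<bar> \<le> \<bar>x\<bar>" "exp x = (\<Sum>m<2. x ^ m / fact m) + exp t / fact 2 * x ^ 2"
    using Maclaurin_exp_le[of x 2] by blast
  have "1 / 3 \<le> exp (-1 :: real)" using exp_le by (simp add: exp_minus field_simps)
  also have "\<dots> \<le> exp t" using t(1) assms by simp
  finally have "1 / 3 * x\<^sup>2 \<le> exp t * x\<^sup>2" by (rule mult_right_mono) simp
  with t(2) show ?thesis by (simp add: eval_nat_numeral)
qed

lemma add3_powr_le:
  fixes a b c p :: real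
  assumes "0 \<le> a" "0 \<le> b" "0 \<le> c" "0 < p"
  shows "(a + b + c) powr p \<le> 3 powr p * (a powr p + b powr p + c powr p)"
proof -
  define m where "m = max a (max b c)"
  have "(a + b + c) powr p \<le> (3 * m) powr p"
    using assms by (intro powr_mono2) (auto simp: m_def)
  also have "\<dots> = 3 powr p * m powr p" using assms by (intro powr_mult)
  also have "m powr p \<le> a powr p + b powr p + c powr p"
    by (auto simp: m_def max_def)
  finally show ?thesis by simp
qed

lemma sq_le_one_plus_powr:
  fixes x p :: real
  assumes "0 \<le> x" "2 \<le> p"
  shows "x\<^sup>2 \<le> 1 + x powr p"
proof (cases "x \<le> 1")
  case True
  then have "x\<^sup>2 \<le> 1" using assms by (simp add: power_le_one)
  then show ?thesis by (simp add: add_increasing2)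
next
  case False
  then have "x powr 2 \<le> x powr p" using assms by (intro powr_mono) auto
  then show ?thesis using False by simp
qed

lemma abs_le_one_plus_sq: "\<bar>x\<bar> \<le> 1 + x\<^sup>2" for x :: real
proof -
  have "2 * \<bar>x\<bar> \<le> 1 + x\<^sup>2" using zero_le_power2[of "\<bar>x\<bar> - 1"] by (simp add: power2_diff)
  moreover have "0 \<le> x\<^sup>2" by simp
  ultimately show ?thesis by linarith
qed

text \<open>For \<open>p\<close> above two the factor \<open>m powr (2 - p)\<close> tends to zero as
  \<open>m\<close> grows: this is how moments of order above two make squares uniformly
  integrable.\<close>

lemma sq_le_powr_split:
  fixes x p m :: real
  assumes "0 \<le> x" "2 \<le> p" "0 < m"
  shows "x\<^sup>2 \<le> m\<^sup>2 + m powr (2 - p) * x powr p" "x > m \<Longrightarrow> x\<^sup>2 \<le> m powr (2 - p) * x powr p"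
proof -
  show *: "x\<^sup>2 \<le> m powr (2 - p) * x powr p" if "x > m"
  proof -
    have "x powr (2 - p) \<le> m powr (2 - p)" using that assms by (intro powr_mono2') auto
    then have "x powr (2 - p) * x powr p \<le> m powr (2 - p) * x powr p" by (rule mult_right_mono) simp
    also have "x powr (2 - p) * x powr p = x\<^sup>2" using that assms by (simp add: powr_add[symmetric])
    finally show ?thesis .
  qed
  show "x\<^sup>2 \<le> m\<^sup>2 + m powr (2 - p) * x powr p"
  proof (cases "x > m")
    case False
    then have "x\<^sup>2 \<le> m\<^sup>2" using assms by (intro power_mono) auto
    then show ?thesis by (simp add: add_increasing2)
  next
    case True
    from *[OF this] show ?thesis by (simp add: add_increasing)
  qed
qed

text \<open>The crude constants come from bounding a square by one plus the power \<open>p\<close>,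
  and a number by one plus its square. Later only boundedness matters, so no Hoelder exponents are
  carried along.\<close>

lemma moment_le:
  fixes W :: "'a \<Rightarrow> real"
  assumes "prob_space Q" and [measurable]: "W \<in> borel_measurable Q" and nn: "\<And>x. x \<in> space Q \<Longrightarrow> 0 \<le> W x" and p: "2 \<le> p"
    and i: "integrable Q (\<lambda>x. W x powr p)" and le: "(\<integral>x. W x powr p \<partial>Q) \<le> C"
  shows "integrable Q (\<lambda>x. (W x)\<^sup>2)" "(\<integral>x. (W x)\<^sup>2 \<partial>Q) \<le> 1 + C"
    "integrable Q W" "(\<integral>x. W x \<partial>Q) \<le> 2 + C"
proof -
  interpret prob_space Q by fact
  have i1: "integrable Q (\<lambda>x. 1 + W x powr p)" using i by auto
  have e1: "(\<integral>x. 1 + W x powr p \<partial>Q) \<le> 1 + C" using i le by (simp add: prob_space)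
  show i2: "integrable Q (\<lambda>x. (W x)\<^sup>2)"
    by (rule Bochner_Integration.integrable_bound[OF i1])
      (use nn p sq_le_one_plus_powr in \<open>auto intro!: AE_I2\<close>)
  have "(\<integral>x. (W x)\<^sup>2 \<partial>Q) \<le> (\<integral>x. 1 + W x powr p \<partial>Q)"
    by (rule integral_mono[OF i2 i1]) (use nn p sq_le_one_plus_powr in auto)
  with e1 show e2: "(\<integral>x. (W x)\<^sup>2 \<partial>Q) \<le> 1 + C" by simp
  show i3: "integrable Q W" by (rule square_integrable_imp_integrable[OF _ i2]) simp
  have "W x \<le> 1 + (W x)\<^sup>2" for x using abs_le_one_plus_sq[of "W x"] by linarith
  then have "(\<integral>x. W x \<partial>Q) \<le> (\<integral>x. 1 + (W x)\<^sup>2 \<partial>Q)"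
    by (intro integral_mono i3) (use i2 in auto)
  also have "\<dots> = 1 + (\<integral>x. (W x)\<^sup>2 \<partial>Q)" using i2 by (simp add: prob_space)
  finally show "(\<integral>x. W x \<partial>Q) \<le> 2 + C" using e2 by simp
qed

text \<open>Uniform integrability under laws that vary with \<open>k\<close>. The level
  \<open>m\<close> is fixed first, so that the part of the squares above it is small uniformly in
  \<open>k\<close>; the vanishing mass of \<open>B k\<close> then absorbs the part below, weighted
  by \<open>m\<^sup>2\<close>.\<close>

lemma moment_tail_tendsto_0:
  fixes W B :: "nat \<Rightarrow> 'a \<Rightarrow> real"
  assumes "\<And>k. prob_space (Q k)" and [measurable]: "\<And>k. W k \<in> borel_measurable (Q k)" "\<And>k. B k \<in> borel_measurable (Q k)"
    and nn: "\<And>k x. x \<in> space (Q k) \<Longrightarrow> 0 \<le> W k x" and p: "2 < p"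
    and i: "\<And>k. integrable (Q k) (\<lambda>x. W k x powr p)" and le: "\<And>k. (\<integral>x. W k x powr p \<partial>Q k) \<le> C"
    and B: "\<And>k x. 0 \<le> B k x" "\<And>k x. B k x \<le> 1" and B0: "(\<lambda>k. \<integral>x. B k x \<partial>Q k) \<longlonglongrightarrow> 0"
  shows "(\<lambda>k. \<integral>x. (W k x)\<^sup>2 * B k x \<partial>Q k) \<longlonglongrightarrow> 0"
proof (rule LIMSEQ_I)
  fix e :: real assume e: "e > 0"
  have "((\<lambda>m. m powr (2 - p) * C) \<longlongrightarrow> 0 * C) at_top"
    by (intro tendsto_intros tendsto_neg_powr filterlim_ident) (use p in auto)
  then have "\<forall>\<^sub>F m in at_top. m powr (2 - p) * C < e / 2" using e by (intro order_tendstoD(2)) auto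
  then obtain m where m: "m > 0" "m powr (2 - p) * C < e / 2"
    using eventually_happens'[OF _ eventually_conj[OF _ eventually_gt_at_top[of 0]]] trivial_limit_at_top_linorder by blast
  have bd: "\<bar>\<integral>x. (W k x)\<^sup>2 * B k x \<partial>Q k\<bar> \<le> m powr (2-p) * C + m\<^sup>2 * (\<integral>x. B k x \<partial>Q k)" for k
  proof -
    interpret prob_space "Q k" by fact
    have Bi: "integrable (Q k) (B k)" by (rule integrable_const_bound[of _ 1]) (use B in auto)
    have pw: "(W k x)\<^sup>2 * B k x \<le> m powr (2-p) * W k x powr p + m\<^sup>2 * B k x" if "x \<in> space (Q k)" for x
    proof -
      have "(W k x)\<^sup>2 * B k x \<le> (m\<^sup>2 + m powr (2 - p) * W k x powr p) * B k x"
        by (intro mult_right_mono sq_le_powr_split) (use nn that m p B in auto)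
      also have "\<dots> \<le> m\<^sup>2 * B k x + m powr (2 - p) * W k x powr p * 1"
        unfolding distrib_right by (intro add_mono mult_left_mono order_refl B) auto
      finally show ?thesis by simp
    qed
    have "(\<integral>x. (W k x)\<^sup>2 * B k x \<partial>Q k) \<le> (\<integral>x. m powr (2-p) * W k x powr p + m\<^sup>2 * B k x \<partial>Q k)"
    proof (rule integral_mono)
      show "integrable (Q k) (\<lambda>x. (W k x)\<^sup>2 * B k x)"
        by (rule Bochner_Integration.integrable_bound[where f="\<lambda>x. m powr (2-p) * W k x powr p + m\<^sup>2 * B k x"])
          (use i Bi B pw in \<open>auto intro!: AE_I2 order_trans[OF pw] simp: abs_mult\<close>)
    qed (use pw i Bi in auto)
    also have "\<dots> = m powr (2-p) * (\<integral>x. W k x powr p \<partial>Q k) + m\<^sup>2 * (\<integral>x. B k x \<partial>Q k)" using i Bi by simp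
    also have "\<dots> \<le> m powr (2-p) * C + m\<^sup>2 * (\<integral>x. B k x \<partial>Q k)"
      by (intro add_right_mono mult_left_mono le) auto
    finally show ?thesis using B by (subst abs_of_nonneg) (auto intro!: integral_nonneg_AE)
  qed
  have "(\<lambda>k. m powr (2-p) * C + m\<^sup>2 * (\<integral>x. B k x \<partial>Q k)) \<longlonglongrightarrow> m powr (2-p) * C + m\<^sup>2 * 0"
    by (intro tendsto_intros B0)
  then have "\<forall>\<^sub>F k in sequentially. m powr (2-p) * C + m\<^sup>2 * (\<integral>x. B k x \<partial>Q k) < e"
    by (rule order_tendstoD(2)) (use m e in auto)
  then show "\<exists>no. \<forall>k\<ge>no. norm ((\<integral>x. (W k x)\<^sup>2 * B k x \<partial>Q k) - 0) < e"
    using bd unfolding eventually_sequentially by (auto intro: order.strict_trans1)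
qed

section \<open>Likelihood ratios and the one-sided approach to a parameter\<close>

lemma density_integral_1:
  assumes [measurable]: "u \<in> borel_measurable N" and "AE z in N. 0 \<le> u z" and "prob_space (density N (\<lambda>z. ennreal (u z)))"
  shows "integrable N u" "(\<integral>z. u z \<partial>N) = 1"
proof -
  interpret prob_space "density N (\<lambda>z. ennreal (u z))" by fact
  have "integrable (density N (\<lambda>z. ennreal (u z))) (\<lambda>z. 1::real)" by simp
  then show "integrable N u" by (subst (asm) integrable_real_density) (use assms(2) in auto)
  have "(\<integral>z. 1 \<partial>density N (\<lambda>z. ennreal (u z))) = (1::real)" using prob_space by simp
  then show "(\<integral>z. u z \<partial>N) = 1" by (subst (asm) integral_real_density) (use assms(2) in auto)
qed

lemma density_ratio:
  fixes u v :: "'a \<Rightarrow> real"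
  assumes [measurable]: "u \<in> borel_measurable N" "v \<in> borel_measurable N"
    and pos: "\<And>z. z \<in> space N \<Longrightarrow> 0 < u z" "\<And>z. z \<in> space N \<Longrightarrow> 0 < v z"
    and v: "prob_space (density N (\<lambda>z. ennreal (v z)))"
  shows "integrable (density N u) (\<lambda>z. v z / u z)" "(\<integral>z. v z / u z \<partial>density N u) = 1"
proof -
  have nn: "AE z in N. 0 \<le> u z" "AE z in N. 0 \<le> v z" by (auto intro!: AE_I2 less_imp_le pos)
  have eq: "u z * (v z / u z) = v z" if "z \<in> space N" for z using pos(1)[OF that] by simp
  have "integrable N (\<lambda>z. u z * (v z / u z)) = integrable N v" "(\<integral>z. u z * (v z / u z) \<partial>N) = (\<integral>z. v z \<partial>N)"
    by (rule Bochner_Integration.integrable_cong[OF refl eq] Bochner_Integration.integral_cong[OF refl eq]; assumption)+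
  note r = this density_integral_1[OF assms(2) nn(2) v]
  show "integrable (density N u) (\<lambda>z. v z / u z)" by (subst integrable_real_density) (use nn(1) r in auto)
  show "(\<integral>z. v z / u z \<partial>density N u) = 1" by (subst integral_real_density) (use nn(1) r in auto)
qed

lemma mult_indicator_integrable:
  "integrable M (\<phi> :: 'a \<Rightarrow> real) \<Longrightarrow> {z \<in> space M. z \<in> E} \<in> sets M \<Longrightarrow> integrable M (\<lambda>z. \<phi> z * indicat_real E z)"
  by (rule Bochner_Integration.integrable_bound[where f=\<phi>]) (auto simp: indicator_def)

text \<open>Here \<open>g0\<close> is the density at \<open>\<theta>\<close>, \<open>g k\<close> are the densities at points approaching \<open>\<theta>\<close> from one side,
  at distance \<open>h k\<close>, and \<open>gs\<close> is the density at a fixed point on the same side, at distance \<open>hs\<close>. The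
  function \<open>D\<close> is the score at \<open>\<theta>\<close> in the direction of approach. One-sidedness is the point: when \<open>\<theta>\<close> is
  a boundary point of \<open>\<Theta>\<close>, likelihood ratios control moments of the score in one direction only.\<close>

locale one_sided_approach =
  fixes N :: "'a measure" and g0 gs :: "'a \<Rightarrow> real" and g :: "nat \<Rightarrow> 'a \<Rightarrow> real"
    and h :: "nat \<Rightarrow> real" and hs :: real and D As :: "'a \<Rightarrow> real" and A :: "nat \<Rightarrow> 'a \<Rightarrow> real" and p K :: real
  assumes meas [measurable]: "g0 \<in> borel_measurable N" "gs \<in> borel_measurable N" "\<And>k. g k \<in> borel_measurable N"
      "D \<in> borel_measurable N" "As \<in> borel_measurable N" "\<And>k. A k \<in> borel_measurable N"
    and pos: "\<And>z. z \<in> space N \<Longrightarrow> 0 < g0 z" "\<And>z. z \<in> space N \<Longrightarrow> 0 < gs z" "\<And>k z. z \<in> space N \<Longrightarrow> 0 < g k z"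
    and prob0: "prob_space (density N g0)" and probs: "prob_space (density N gs)" and probk: "\<And>k. prob_space (density N (g k))"
    and h: "\<And>k. 0 < h k" "\<And>k. h k \<le> hs / 2" "h \<longlonglongrightarrow> 0"
    and A_nonneg: "\<And>z. z \<in> space N \<Longrightarrow> 0 \<le> As z" "\<And>k z. z \<in> space N \<Longrightarrow> 0 \<le> A k z"
    and taylor: "\<And>k z. z \<in> space N \<Longrightarrow> \<bar>ln (g k z) - ln (g0 z) - h k * D z\<bar> \<le> (h k)\<^sup>2 * A k z"
    and taylors: "\<And>z. z \<in> space N \<Longrightarrow> \<bar>ln (gs z) - ln (g0 z) - hs * D z\<bar> \<le> hs\<^sup>2 * As z"
    and hA: "\<And>z. z \<in> space N \<Longrightarrow> (\<lambda>k. h k * A k z) \<longlonglongrightarrow> 0"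
    and p: "2 < p"
    and mom0: "\<And>k. integrable (density N g0) (\<lambda>z. A k z powr p)" "\<And>k. (\<integral>z. A k z powr p \<partial>density N g0) \<le> K"
    and momk: "\<And>k. integrable (density N (g k)) (\<lambda>z. A k z powr p)" "\<And>k. (\<integral>z. A k z powr p \<partial>density N (g k)) \<le> K"
    and moms: "\<And>k. integrable (density N (g k)) (\<lambda>z. As z powr p)" "\<And>k. (\<integral>z. As z powr p \<partial>density N (g k)) \<le> K"
begin

abbreviation "P \<equiv> density N g0"
abbreviation "Q k \<equiv> density N (g k)"
abbreviation "X k z \<equiv> ln (g k z) - ln (g0 z)"
abbreviation "B k \<equiv> indicat_real {z. g k z \<le> exp 1 * g0 z}"
abbreviation "Bc k \<equiv> indicat_real {z. \<not> g k z \<le> exp 1 * g0 z}"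
text \<open>A majorant of \<open>D\<close> from the difference quotient of the log-likelihood
  between the current point and the fixed one. Their distance is at least \<open>hs / 2\<close>
  because \<open>h k \<le> hs / 2\<close>, whence the factor \<open>2 / hs\<close>; the last two
  terms are the Taylor errors of the two expansions at \<open>\<theta>\<close>, both with step at
  most \<open>hs\<close>.\<close>

definition "W k z = 2 / hs * max 0 (ln (gs z) - ln (g k z)) + 2 * hs * As z + 2 * hs * A k z"

lemma hs: "0 < hs" using h(1,2)[of 0] by linarith

lemma W_meas [measurable]: "W k \<in> borel_measurable N" unfolding W_def by measurable

lemma AE_pos: "AE z in N. 0 \<le> g0 z" "AE z in N. 0 \<le> g k z" "AE z in N. 0 \<le> gs z"
  by (auto intro!: AE_I2 less_imp_le pos)

lemma int_P:
  fixes \<phi> :: "'a \<Rightarrow> real"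
  assumes [measurable]: "\<phi> \<in> borel_measurable N"
  shows "(\<integral>z. \<phi> z \<partial>P) = (\<integral>z. g0 z * \<phi> z \<partial>N)" "integrable P \<phi> \<longleftrightarrow> integrable N (\<lambda>z. g0 z * \<phi> z)"
  by (subst integral_real_density integrable_real_density; use AE_pos in simp)+

lemma int_Q:
  fixes \<phi> :: "'a \<Rightarrow> real"
  assumes [measurable]: "\<phi> \<in> borel_measurable N"
  shows "(\<integral>z. \<phi> z \<partial>Q k) = (\<integral>z. g k z * \<phi> z \<partial>N)" "integrable (Q k) \<phi> \<longleftrightarrow> integrable N (\<lambda>z. g k z * \<phi> z)"
  by (subst integral_real_density integrable_real_density; use AE_pos in simp)+

lemma X_lim: assumes z: "z \<in> space N" shows "(\<lambda>k. X k z / h k) \<longlonglongrightarrow> D z"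
proof -
  have "(\<lambda>k. X k z / h k - D z) \<longlonglongrightarrow> 0"
  proof (rule Lim_null_comparison[OF always_eventually hA[OF z]], rule allI)
    fix k
    have "\<bar>(X k z - h k * D z) / h k\<bar> \<le> (h k)\<^sup>2 * A k z / h k"
      using taylor[OF z, of k] h(1)[of k] by (simp add: abs_divide divide_right_mono)
    moreover have "(X k z - h k * D z) / h k = X k z / h k - D z" using h(1)[of k] by (simp add: field_simps)
    ultimately show "norm (X k z / h k - D z) \<le> h k * A k z" using h(1)[of k] by (simp add: power2_eq_square)
  qed
  then show ?thesis by (simp add: LIM_zero_iff)
qed

lemma X_lim0: assumes z: "z \<in> space N" shows "(\<lambda>k. X k z) \<longlonglongrightarrow> 0"
proof -
  have "(\<lambda>k. X k z / h k * h k) \<longlonglongrightarrow> D z * 0" by (intro tendsto_mult X_lim z h)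
  moreover have "X k z / h k * h k = X k z" for k using h(1)[of k] by simp
  ultimately show ?thesis by simp
qed

lemma g_lim: assumes z: "z \<in> space N" shows "(\<lambda>k. g k z) \<longlonglongrightarrow> g0 z"
proof -
  have "(\<lambda>k. exp (X k z) * g0 z) \<longlonglongrightarrow> exp 0 * g0 z" by (intro tendsto_intros X_lim0 z)
  moreover have "exp (X k z) * g0 z = g k z" for k using pos(1)[OF z] pos(3)[OF z, of k] by (simp add: exp_diff)
  ultimately show ?thesis by simp
qed

lemma B_lim: assumes z: "z \<in> space N" shows "(\<lambda>k. B k z) \<longlonglongrightarrow> 1"
proof -
  have "g0 z < exp 1 * g0 z" using pos(1)[OF z] by simp
  then have "\<forall>\<^sub>F k in sequentially. g k z < exp 1 * g0 z" by (rule order_tendstoD(2)[OF g_lim[OF z]])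
  then have "\<forall>\<^sub>F k in sequentially. B k z = 1" by eventually_elim simp
  then show ?thesis by (rule tendsto_eventually)
qed

lemma trunc_integrable:
  assumes [measurable]: "\<phi> \<in> borel_measurable N" and i: "integrable P \<phi>"
  shows "integrable (Q k) (\<lambda>z. \<phi> z * B k z)"
proof -
  have "integrable N (\<lambda>z. exp 1 * (g0 z * \<phi> z))" using i by (simp add: int_P)
  then have "integrable N (\<lambda>z. g k z * (\<phi> z * B k z))"
  proof (rule Bochner_Integration.integrable_bound)
    show "AE z in N. norm (g k z * (\<phi> z * B k z)) \<le> norm (exp 1 * (g0 z * \<phi> z))"
      by (auto intro!: AE_I2 mult_right_mono simp: abs_mult indicator_def pos less_imp_le mult.assoc[symmetric])
  qed measurable
  then show ?thesis by (subst int_Q(2)) auto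
qed

text \<open>On the truncation event the moving density is at most \<open>exp 1 * g0 z\<close>, so
  integrability under the limit law is all that dominated convergence asks for. Any threshold above
  one would make the event exhaust the space, since the densities converge pointwise.\<close>

lemma trunc_tendsto:
  assumes [measurable]: "\<phi> \<in> borel_measurable N" and i: "integrable P \<phi>"
  shows "(\<lambda>k. \<integral>z. \<phi> z * B k z \<partial>Q k) \<longlonglongrightarrow> (\<integral>z. \<phi> z \<partial>P)"
proof -
  have "(\<lambda>k. \<integral>z. g k z * (\<phi> z * B k z) \<partial>N) \<longlonglongrightarrow> (\<integral>z. g0 z * \<phi> z \<partial>N)"
  proof (rule integral_dominated_convergence[where w="\<lambda>z. exp 1 * \<bar>g0 z * \<phi> z\<bar>"])
    show "integrable N (\<lambda>z. exp 1 * \<bar>g0 z * \<phi> z\<bar>)" using i by (simp add: int_P)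
    show "AE z in N. (\<lambda>k. g k z * (\<phi> z * B k z)) \<longlonglongrightarrow> g0 z * \<phi> z"
    proof (rule AE_I2)
      fix z assume "z \<in> space N"
      then have "(\<lambda>k. g k z * (\<phi> z * B k z)) \<longlonglongrightarrow> g0 z * (\<phi> z * 1)" by (intro tendsto_intros g_lim B_lim)
      then show "(\<lambda>k. g k z * (\<phi> z * B k z)) \<longlonglongrightarrow> g0 z * \<phi> z" by simp
    qed
    show "AE z in N. norm (g k z * (\<phi> z * B k z)) \<le> exp 1 * \<bar>g0 z * \<phi> z\<bar>" for k
      by (auto intro!: AE_I2 mult_right_mono simp: abs_mult indicator_def pos less_imp_le mult.assoc[symmetric])
  qed measurable
  then show ?thesis by (simp add: int_P int_Q)
qed

text \<open>The truncated mass tends to the mass of the limit law, which is one, and the approaching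
  laws have mass one as well: no mass escapes to where the densities are far apart.\<close>

lemma Bc_tendsto: "(\<lambda>k. \<integral>z. Bc k z \<partial>Q k) \<longlonglongrightarrow> 0"
proof -
  interpret P: prob_space P by (rule prob0)
  have "(\<lambda>k. \<integral>z. 1 * B k z \<partial>Q k) \<longlonglongrightarrow> (\<integral>z. 1 \<partial>P)" by (rule trunc_tendsto) auto
  then have 1: "(\<lambda>k. 1 - (\<integral>z. B k z \<partial>Q k)) \<longlonglongrightarrow> 1 - 1"
    by (intro tendsto_intros) (use P.prob_space in simp)
  have "(\<integral>z. Bc k z \<partial>Q k) = 1 - (\<integral>z. B k z \<partial>Q k)" for k
  proof -
    interpret Q: prob_space "Q k" by (rule probk)
    have "(\<integral>z. Bc k z \<partial>Q k) = (\<integral>z. 1 - B k z \<partial>Q k)"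
      by (rule Bochner_Integration.integral_cong) (auto simp: indicator_def)
    also have "\<dots> = (\<integral>z. 1 \<partial>Q k) - (\<integral>z. B k z \<partial>Q k)"
      by (rule Bochner_Integration.integral_diff) (auto intro!: Q.integrable_const_bound[of _ 1])
    finally show ?thesis using Q.prob_space by simp
  qed
  with 1 show ?thesis by simp
qed

lemma W_nonneg: "z \<in> space N \<Longrightarrow> 0 \<le> W k z"
  using hs A_nonneg by (auto simp: W_def intro!: add_nonneg_nonneg mult_nonneg_nonneg)

text \<open>The positive part of the directional score is controlled at every point between \<open>\<theta>\<close> and the
  fixed one: the likelihood ratio of the two integrates to one, so the positive part of its logarithm has all moments.\<close>

lemma D_le_W: assumes z: "z \<in> space N" shows "D z \<le> W k z"
proof (cases "D z \<le> 0")
  case True then show ?thesis using W_nonneg[OF z, of k] by simp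
next
  case False
  let ?Y = "ln (gs z) - ln (g k z)"
  have "hs / 2 * D z \<le> (hs - h k) * D z" using h(2)[of k] False by (intro mult_right_mono) auto
  also have "\<dots> \<le> ?Y + hs\<^sup>2 * As z + (h k)\<^sup>2 * A k z"
    using taylor[OF z, of k] taylors[OF z] by (simp add: abs_le_iff algebra_simps)
  also have "\<dots> \<le> max 0 ?Y + hs\<^sup>2 * As z + hs\<^sup>2 * A k z"
    using h(1,2)[of k] hs A_nonneg(1)[OF z] A_nonneg(2)[OF z, of k] by (intro add_mono mult_right_mono power_mono) auto
  finally have "2 / hs * (hs / 2 * D z) \<le> 2 / hs * (max 0 ?Y + hs\<^sup>2 * As z + hs\<^sup>2 * A k z)"
    using hs by (intro mult_left_mono) auto
  then show ?thesis using hs by (simp add: W_def field_simps power2_eq_square)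
qed

lemma W_moment: "\<exists>C. \<forall>k. integrable (Q k) (\<lambda>z. W k z powr p) \<and> (\<integral>z. W k z powr p \<partial>Q k) \<le> C"
proof -
  define C where "C = 3 powr p * ((2/hs) powr p * (p powr p) + (2*hs) powr p * K + (2*hs) powr p * K)"
  have "integrable (Q k) (\<lambda>z. W k z powr p) \<and> (\<integral>z. W k z powr p \<partial>Q k) \<le> C" for k
  proof -
    define \<rho> where "\<rho> z = gs z / g k z" for z
    have [measurable]: "\<rho> \<in> borel_measurable N" unfolding \<rho>_def by measurable
    define V where "V z = 3 powr p * ((2/hs) powr p * (p powr p * \<rho> z) + (2*hs) powr p * As z powr p + (2*hs) powr p * A k z powr p)" for z
    have [measurable]: "V \<in> borel_measurable N" unfolding V_def by measurable
    have r: "integrable (Q k) \<rho>" "(\<integral>z. \<rho> z \<partial>Q k) = 1"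
      unfolding \<rho>_def[abs_def] by (rule density_ratio[OF meas(3,2) pos(3,2) probs]; assumption)+
    have Vi: "integrable (Q k) V" unfolding V_def using r(1) momk moms by auto
    have "(\<integral>z. V z \<partial>Q k) = 3 powr p * ((2/hs) powr p * (p powr p * 1) + (2*hs) powr p * (\<integral>z. As z powr p \<partial>Q k) + (2*hs) powr p * (\<integral>z. A k z powr p \<partial>Q k))"
      unfolding V_def r(2)[symmetric] using r(1) momk moms by simp
    also have "\<dots> \<le> C" unfolding C_def
      by (intro mult_left_mono add_mono momk moms) auto
    finally have VC: "(\<integral>z. V z \<partial>Q k) \<le> C" .
    have WV: "W k z powr p \<le> V z" if z: "z \<in> space N" for z
    proof -
      have m: "(max 0 (ln (gs z) - ln (g k z))) powr p \<le> p powr p * \<rho> z"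
      proof (cases "ln (gs z) - ln (g k z) \<le> 0")
        case True then show ?thesis using p pos z by (simp add: \<rho>_def less_imp_le)
      next
        case False
        then have "(max 0 (ln (gs z) - ln (g k z))) powr p \<le> p powr p * exp (ln (gs z) - ln (g k z))"
          using powr_le_exp[of "ln (gs z) - ln (g k z)" p] p by simp
        then show ?thesis using pos z by (simp add: \<rho>_def exp_diff)
      qed
      have "W k z powr p \<le> 3 powr p * ((2 / hs * max 0 (ln (gs z) - ln (g k z))) powr p + (2 * hs * As z) powr p + (2 * hs * A k z) powr p)"
        unfolding W_def by (rule add3_powr_le) (use hs A_nonneg z p in auto)
      also have "\<dots> = 3 powr p * ((2 / hs) powr p * max 0 (ln (gs z) - ln (g k z)) powr p + (2 * hs) powr p * As z powr p + (2 * hs) powr p * A k z powr p)"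
        using hs A_nonneg z by (subst (1 2 3) powr_mult) auto
      also have "\<dots> \<le> V z"
        unfolding V_def by (intro mult_left_mono add_mono m order_refl) auto
      finally show ?thesis .
    qed
    have Wi: "integrable (Q k) (\<lambda>z. W k z powr p)"
      by (rule Bochner_Integration.integrable_bound[OF Vi]) (use WV in \<open>auto intro!: AE_I2 order_trans[OF WV]\<close>)
    have "(\<integral>z. W k z powr p \<partial>Q k) \<le> (\<integral>z. V z \<partial>Q k)"
      by (rule integral_mono[OF Wi Vi]) (use WV in auto)
    with Wi VC show ?thesis by auto
  qed
  then show ?thesis by blast
qed

lemma
  assumes "V \<in> borel_measurable N" "\<And>z. z \<in> space N \<Longrightarrow> 0 \<le> V z"
    and "integrable (Q k) (\<lambda>z. V z powr p)" "(\<integral>z. V z powr p \<partial>Q k) \<le> C"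
  shows Q_moment: "integrable (Q k) (\<lambda>x. (V x)\<^sup>2)" "(\<integral>x. (V x)\<^sup>2 \<partial>Q k) \<le> 1 + C"
    "integrable (Q k) V" "(\<integral>x. V x \<partial>Q k) \<le> 2 + C"
  by (rule moment_le[OF probk, of V k p C]; use assms p in simp)+

lemma
  assumes "V \<in> borel_measurable N" "\<And>z. z \<in> space N \<Longrightarrow> 0 \<le> V z"
    and "integrable P (\<lambda>z. V z powr p)" "(\<integral>z. V z powr p \<partial>P) \<le> C"
  shows P_moment: "integrable P V" "(\<integral>x. V x \<partial>P) \<le> 2 + C"
  by (rule moment_le[OF prob0, of V p C]; use assms p in simp)+

lemma A_moments:
  "integrable (Q k) (A k)" "(\<integral>z. A k z \<partial>Q k) \<le> 2 + K" "integrable (Q k) (\<lambda>z. (A k z)\<^sup>2)" "(\<integral>z. (A k z)\<^sup>2 \<partial>Q k) \<le> 1 + K"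
  "integrable P (A k)" "(\<integral>z. A k z \<partial>P) \<le> 2 + K"
  by (rule Q_moment[OF meas(6) A_nonneg(2) momk] P_moment[OF meas(6) A_nonneg(2) mom0]; assumption)+

lemma A_integral_nonneg: "0 \<le> (\<integral>z. A k z \<partial>Q k)" "0 \<le> (\<integral>z. (A k z)\<^sup>2 \<partial>Q k)"
  by (intro integral_nonneg_AE AE_I2; use A_nonneg in simp)+

text \<open>Gibbs' inequality: \<open>X k\<close> lies above \<open>1 - g0 z / g k z\<close>, whose
  mean under \<open>Q k\<close> is zero, so its own mean is nonnegative, and the expansion hands
  this on to \<open>D\<close>. Integrability of \<open>X k\<close> has to come first; it is enclosed
  between this ratio and the upper bound by \<open>W k\<close>, and \<open>D\<close> then inherits
  integrability from \<open>X k\<close>.\<close>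

lemma D_Q:
  shows "integrable (Q k) D" "- h k * (2 + K) \<le> (\<integral>z. D z \<partial>Q k)"
proof -
  interpret Q: prob_space "Q k" by (rule probk)
  obtain C where C: "integrable (Q k) (\<lambda>z. W k z powr p)" "(\<integral>z. W k z powr p \<partial>Q k) \<le> C"
    using W_moment by blast
  have Wi: "integrable (Q k) (W k)" by (rule Q_moment[OF W_meas W_nonneg C])
  have r: "integrable (Q k) (\<lambda>z. g0 z / g k z)" "(\<integral>z. g0 z / g k z \<partial>Q k) = 1"
    by (rule density_ratio[OF meas(3,1) pos(3,1) prob0]; assumption)+
  have lo: "1 - g0 z / g k z \<le> X k z" if "z \<in> space N" for z
    using exp_ge_add_one_self[of "- X k z"] pos that by (simp add: exp_diff)
  have up: "X k z \<le> h k * W k z + (h k)\<^sup>2 * A k z" if z: "z \<in> space N" for z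
  proof -
    have "h k * D z \<le> h k * W k z" using h(1)[of k] D_le_W[OF z, of k] by (intro mult_left_mono) auto
    then show ?thesis using taylor[OF z, of k] by linarith
  qed
  have Xi: "integrable (Q k) (X k)"
  proof (rule Bochner_Integration.integrable_bound[where f="\<lambda>z. 1 + g0 z / g k z + (h k * W k z + (h k)\<^sup>2 * A k z)"])
    show "integrable (Q k) (\<lambda>z. 1 + g0 z / g k z + (h k * W k z + (h k)\<^sup>2 * A k z))"
      using r(1) Wi A_moments by auto
    show "AE z in Q k. norm (X k z) \<le> norm (1 + g0 z / g k z + (h k * W k z + (h k)\<^sup>2 * A k z))"
    proof (rule AE_I2)
      fix z assume "z \<in> space (Q k)"
      then have z: "z \<in> space N" by simp
      have "0 \<le> g0 z / g k z" "0 \<le> h k * W k z + (h k)\<^sup>2 * A k z"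
        using pos z W_nonneg[OF z] A_nonneg z h(1)[of k] by (auto simp: less_imp_le intro!: add_nonneg_nonneg mult_nonneg_nonneg)
      with lo[OF z] up[OF z] show "norm (X k z) \<le> norm (1 + g0 z / g k z + (h k * W k z + (h k)\<^sup>2 * A k z))"
        by (simp add: abs_le_iff)
    qed
  qed measurable
  have "(\<integral>z. 1 - g0 z / g k z \<partial>Q k) \<le> (\<integral>z. X k z \<partial>Q k)"
    by (rule integral_mono) (use r Xi lo in auto)
  then have X0: "0 \<le> (\<integral>z. X k z \<partial>Q k)" using r Q.prob_space by simp
  show Di: "integrable (Q k) D"
  proof (rule Bochner_Integration.integrable_bound[where f="\<lambda>z. (\<bar>X k z\<bar> + (h k)\<^sup>2 * A k z) / h k"])
    show "integrable (Q k) (\<lambda>z. (\<bar>X k z\<bar> + (h k)\<^sup>2 * A k z) / h k)" using Xi A_moments by auto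
    show "AE z in Q k. norm (D z) \<le> norm ((\<bar>X k z\<bar> + (h k)\<^sup>2 * A k z) / h k)"
    proof (rule AE_I2)
      fix z assume "z \<in> space (Q k)"
      then have z: "z \<in> space N" by simp
      have "h k * \<bar>D z\<bar> = \<bar>h k * D z\<bar>" using h(1)[of k] by (simp add: abs_mult)
      also have "\<dots> \<le> \<bar>X k z\<bar> + (h k)\<^sup>2 * A k z" using taylor[OF z, of k] by (simp add: abs_le_iff abs_if split: if_splits)
      finally show "norm (D z) \<le> norm ((\<bar>X k z\<bar> + (h k)\<^sup>2 * A k z) / h k)"
        using h(1)[of k] by (simp add: field_simps)
    qed
  qed measurable
  have "0 \<le> (\<integral>z. X k z \<partial>Q k)" by (rule X0)
  also have "\<dots> \<le> (\<integral>z. h k * D z + (h k)\<^sup>2 * A k z \<partial>Q k)"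
  proof (rule integral_mono)
    fix z assume "z \<in> space (Q k)"
    then have "z \<in> space N" by simp
    from taylor[OF this, of k] show "X k z \<le> h k * D z + (h k)\<^sup>2 * A k z" by linarith
  qed (use Xi Di A_moments in auto)
  also have "\<dots> = h k * (\<integral>z. D z \<partial>Q k) + (h k)\<^sup>2 * (\<integral>z. A k z \<partial>Q k)" using Di A_moments by simp
  also have "\<dots> \<le> h k * (\<integral>z. D z \<partial>Q k) + (h k)\<^sup>2 * (2 + K)" by (intro add_left_mono mult_left_mono A_moments) auto
  also have "\<dots> = h k * ((\<integral>z. D z \<partial>Q k) + h k * (2 + K))" by (simp add: algebra_simps power2_eq_square)
  finally show "- h k * (2 + K) \<le> (\<integral>z. D z \<partial>Q k)" using h(1)[of k] by (simp add: zero_le_mult_iff)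
qed

text \<open>The absolute value of \<open>D\<close> is twice its positive part minus
  \<open>D\<close>. The positive part lies below \<open>W k\<close>, the mean of \<open>D\<close> is
  bounded below, so the absolute moments under the approaching laws are bounded, and Fatou's lemma
  carries this to the limit law.\<close>

lemma D_P_integrable: "integrable P D"
proof -
  obtain C where C: "\<And>k. integrable (Q k) (\<lambda>z. W k z powr p)" "\<And>k. (\<integral>z. W k z powr p \<partial>Q k) \<le> C"
    using W_moment by blast
  have Wi: "integrable (Q k) (W k)" "(\<integral>z. W k z \<partial>Q k) \<le> 2 + C" for k
    by (rule Q_moment[OF W_meas W_nonneg C]; assumption)+
  have K: "0 \<le> 2 + K" using A_moments(2)[of 0] A_integral_nonneg(1)[of 0] by linarith
  have le: "(\<integral>z. \<bar>D z\<bar> \<partial>Q k) \<le> 2 * (2 + C) + hs * (2 + K)" for k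
  proof -
    have "(\<integral>z. \<bar>D z\<bar> \<partial>Q k) \<le> (\<integral>z. 2 * W k z - D z \<partial>Q k)"
    proof (rule integral_mono)
      fix z assume "z \<in> space (Q k)"
      then have z: "z \<in> space N" by simp
      show "\<bar>D z\<bar> \<le> 2 * W k z - D z" using D_le_W[OF z, of k] W_nonneg[OF z, of k] by linarith
    qed (use D_Q Wi in auto)
    also have "\<dots> = 2 * (\<integral>z. W k z \<partial>Q k) - (\<integral>z. D z \<partial>Q k)" using D_Q Wi by simp
    also have "\<dots> \<le> 2 * (2 + C) + h k * (2 + K)" using Wi(2)[of k] D_Q(2)[of k] by simp
    also have "\<dots> \<le> 2 * (2 + C) + hs * (2 + K)" using h(1,2)[of k] K by (intro add_left_mono mult_right_mono) auto
    finally show ?thesis .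
  qed
  have "integrable N (\<lambda>z. g0 z * \<bar>D z\<bar>)"
  proof (rule integrable_limit_bounded(1)[where g="\<lambda>k z. g k z * \<bar>D z\<bar>"])
    show "integrable N (\<lambda>z. g k z * \<bar>D z\<bar>)" for k using integrable_abs[OF D_Q(1)[of k]] by (subst (asm) int_Q) auto
    show "AE z in N. (\<lambda>k. g k z * \<bar>D z\<bar>) \<longlonglongrightarrow> g0 z * \<bar>D z\<bar>" by (intro AE_I2 tendsto_intros g_lim)
    show "(\<integral>z. g k z * \<bar>D z\<bar> \<partial>N) \<le> 2 * (2 + C) + hs * (2 + K)" for k using le[of k] by (subst (asm) int_Q) auto
  qed (auto intro!: AE_I2 mult_nonneg_nonneg less_imp_le[OF pos(3)])
  then have "integrable P (\<lambda>z. \<bar>D z\<bar>)" by (subst int_P) auto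
  then show ?thesis by (rule integrable_abs_cancel) measurable
qed

lemma W_tail: "(\<lambda>k. \<integral>z. (W k z)\<^sup>2 * Bc k z \<partial>Q k) \<longlonglongrightarrow> 0" "integrable (Q k) (\<lambda>z. (W k z)\<^sup>2)"
proof -
  obtain C where C: "\<And>k. integrable (Q k) (\<lambda>z. W k z powr p)" "\<And>k. (\<integral>z. W k z powr p \<partial>Q k) \<le> C"
    using W_moment by blast
  show "(\<lambda>k. \<integral>z. (W k z)\<^sup>2 * Bc k z \<partial>Q k) \<longlonglongrightarrow> 0"
    by (rule moment_tail_tendsto_0[OF probk _ _ _ p C _ _ Bc_tendsto]) (auto simp: W_nonneg)
  show "integrable (Q k) (\<lambda>z. (W k z)\<^sup>2)"
    by (rule Q_moment[OF W_meas W_nonneg C])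
qed

lemma D_mean_zero: "(\<integral>z. D z \<partial>P) = 0"
proof (rule antisym)
  interpret P: prob_space P by (rule prob0)
  have r: "integrable P (\<lambda>z. g k z / g0 z)" "(\<integral>z. g k z / g0 z \<partial>P) = 1" for k
    by (rule density_ratio[OF meas(1,3) pos(1,3) probk]; assumption)+
  have le: "(\<integral>z. D z \<partial>P) \<le> h k * (2 + K)" for k
  proof -
    have pw: "h k * D z - (h k)\<^sup>2 * A k z \<le> g k z / g0 z - 1" if z: "z \<in> space N" for z
      using exp_ge_add_one_self[of "X k z"] pos z taylor[OF z, of k] by (simp add: exp_diff abs_le_iff)
    have "(\<integral>z. h k * D z - (h k)\<^sup>2 * A k z \<partial>P) \<le> (\<integral>z. g k z / g0 z - 1 \<partial>P)"
      by (rule integral_mono) (use r D_P_integrable A_moments pw in auto)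
    then have "h k * (\<integral>z. D z \<partial>P) \<le> (h k)\<^sup>2 * (\<integral>z. A k z \<partial>P)"
      using r D_P_integrable A_moments P.prob_space by simp
    also have "\<dots> \<le> (h k)\<^sup>2 * (2 + K)" by (intro mult_left_mono A_moments) auto
    finally show ?thesis using h(1)[of k] by (simp add: power2_eq_square)
  qed
  have "(\<lambda>k. h k * (2 + K)) \<longlonglongrightarrow> 0 * (2 + K)" by (intro tendsto_intros h)
  then show "(\<integral>z. D z \<partial>P) \<le> 0" using le by (intro LIMSEQ_le_const) auto
  \<comment> \<open>Off the truncation event \<open>D\<close> is bounded only from above, by
    \<open>1 + (W k z)\<^sup>2\<close>. That is the right direction: the aim is a lower bound for
    the limit, and \<open>R\<close> tends to zero.\<close>
  define R where "R k = (\<integral>z. Bc k z \<partial>Q k) + (\<integral>z. (W k z)\<^sup>2 * Bc k z \<partial>Q k)" for k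
  have lim: "(\<lambda>k. (\<integral>z. D z * B k z \<partial>Q k) + R k + h k * (2 + K)) \<longlonglongrightarrow> (\<integral>z. D z \<partial>P) + (0 + 0) + 0 * (2 + K)"
    unfolding R_def by (intro tendsto_intros trunc_tendsto D_P_integrable Bc_tendsto W_tail h) simp
  have "0 \<le> (\<integral>z. D z * B k z \<partial>Q k) + R k + h k * (2 + K)" for k
  proof -
    interpret Q: prob_space "Q k" by (rule probk)
    have Bci: "integrable (Q k) (Bc k)" by (rule Q.integrable_const_bound[of _ 1]) auto
    have i: "integrable (Q k) (\<lambda>z. (W k z)\<^sup>2 * Bc k z)" by (rule mult_indicator_integrable[OF W_tail(2)]) measurable
    have iB: "integrable (Q k) (\<lambda>z. D z * B k z)" by (rule trunc_integrable) (auto intro: D_P_integrable)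
    have "(\<integral>z. D z \<partial>Q k) \<le> (\<integral>z. D z * B k z + (Bc k z + (W k z)\<^sup>2 * Bc k z) \<partial>Q k)"
    proof (rule integral_mono)
      fix z assume "z \<in> space (Q k)"
      then have "D z \<le> W k z" using D_le_W by simp
      also have "\<dots> \<le> 1 + (W k z)\<^sup>2" using abs_le_one_plus_sq[of "W k z"] by linarith
      finally show "D z \<le> D z * B k z + (Bc k z + (W k z)\<^sup>2 * Bc k z)" by (auto simp: indicator_def)
    qed (use D_Q Bci i iB in auto)
    also have "\<dots> = (\<integral>z. D z * B k z \<partial>Q k) + R k" unfolding R_def using Bci i iB by simp
    finally show ?thesis using D_Q(2)[of k] by simp
  qed
  then show "0 \<le> (\<integral>z. D z \<partial>P)" using LIMSEQ_le_const[OF lim] by auto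
qed

text \<open>The relative entropy of the approximating law with respect to the limit is of second order because
  the score has mean zero, which bounds the second moment of the score by Fatou's lemma.\<close>

lemma D_square_integrable: "integrable P (\<lambda>z. (D z)\<^sup>2)"
proof -
  interpret P: prob_space P by (rule prob0)
  \<comment> \<open>The restriction to \<open>\<bar>X k z\<bar> \<le> 1\<close> is forced, since
    \<open>exp x - 1 - x\<close> grows only linearly for negative \<open>x\<close>; it disappears in
    the limit because \<open>X k\<close> tends to zero pointwise.\<close>
  define u where "u k z = (X k z / h k)\<^sup>2 * indicat_real {z. \<bar>X k z\<bar> \<le> 1} z" for k z
  have [measurable]: "u k \<in> borel_measurable N" for k unfolding u_def by measurable
  have r: "integrable P (\<lambda>z. g k z / g0 z)" "(\<integral>z. g k z / g0 z \<partial>P) = 1" for k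
    by (rule density_ratio[OF meas(1,3) pos(1,3) probk]; assumption)+
  have ui: "integrable P (u k) \<and> (\<integral>z. u k z \<partial>P) \<le> 6 * (2 + K)" for k
  proof -
    define \<rho> where "\<rho> z = g k z / g0 z" for z
    have [measurable]: "\<rho> \<in> borel_measurable N" unfolding \<rho>_def by measurable
    have \<rho>: "integrable P \<rho>" "(\<integral>z. \<rho> z \<partial>P) = 1" using r[of k] by (simp_all add: \<rho>_def[abs_def])
    \<comment> \<open>In the mean of this majorant the ratio cancels against one and
      \<open>D\<close> contributes zero; what remains is \<open>6\<close> times the mean of
      \<open>A k\<close>, with the factor \<open>(h k)\<^sup>2\<close> cancelled.\<close>
    define E where "E z = 6 / (h k)\<^sup>2 * (\<rho> z - 1 - (h k * D z - (h k)\<^sup>2 * A k z))" for z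
    have [measurable]: "E \<in> borel_measurable N" unfolding E_def by measurable
    have Ei: "integrable P E" unfolding E_def using \<rho> D_P_integrable A_moments by auto
    have "(\<integral>z. E z \<partial>P) = 6 * (\<integral>z. A k z \<partial>P)"
      unfolding E_def using \<rho> D_P_integrable A_moments P.prob_space D_mean_zero h(1)[of k] by simp
    also have "\<dots> \<le> 6 * (2 + K)" using A_moments(6)[of k] by simp
    finally have EK: "(\<integral>z. E z \<partial>P) \<le> 6 * (2 + K)" .
    have uE: "u k z \<le> E z" if z: "z \<in> space N" for z
    proof -
      have e: "exp (X k z) - 1 - X k z \<le> \<rho> z - 1 - (h k * D z - (h k)\<^sup>2 * A k z)"
        using pos z taylor[OF z, of k] by (simp add: \<rho>_def exp_diff abs_le_iff)
      have "u k z = 6 / (h k)\<^sup>2 * ((X k z)\<^sup>2 / 6 * indicat_real {z. \<bar>X k z\<bar> \<le> 1} z)"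
        using h(1)[of k] by (simp add: u_def power_divide)
      also have "\<dots> \<le> 6 / (h k)\<^sup>2 * (exp (X k z) - 1 - X k z)"
      proof (rule mult_left_mono)
        have "0 \<le> exp (X k z) - 1 - X k z" using exp_ge_add_one_self[of "X k z"] by linarith
        then show "(X k z)\<^sup>2 / 6 * indicat_real {z. \<bar>X k z\<bar> \<le> 1} z \<le> exp (X k z) - 1 - X k z"
          using sq_div_6_le_exp[of "X k z"] by (simp add: indicator_def)
      qed simp
      also have "\<dots> \<le> E z" unfolding E_def by (intro mult_left_mono e) simp
      finally show ?thesis .
    qed
    have unn: "0 \<le> u k z" for z by (simp add: u_def)
    have 1: "integrable P (u k)"
      by (rule Bochner_Integration.integrable_bound[OF Ei]) (use uE unn in \<open>auto intro!: AE_I2 order_trans[OF uE]\<close>)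
    have "(\<integral>z. u k z \<partial>P) \<le> (\<integral>z. E z \<partial>P)" by (rule integral_mono[OF 1 Ei]) (use uE in auto)
    with 1 EK show ?thesis by simp
  qed
  show ?thesis
  proof (rule integrable_limit_bounded(1)[where g=u])
    show "AE z in P. (\<lambda>k. u k z) \<longlonglongrightarrow> (D z)\<^sup>2"
    proof (rule AE_I2)
      fix z assume "z \<in> space P"
      then have z: "z \<in> space N" by simp
      have "\<forall>\<^sub>F k in sequentially. \<bar>X k z\<bar> < 1"
        by (rule order_tendstoD(2)[OF tendsto_rabs[OF X_lim0[OF z]]]) simp
      then have "\<forall>\<^sub>F k in sequentially. (X k z / h k)\<^sup>2 = u k z"
        by eventually_elim (simp add: u_def)
      moreover have "(\<lambda>k. (X k z / h k)\<^sup>2) \<longlonglongrightarrow> (D z)\<^sup>2" by (intro tendsto_intros X_lim z)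
      ultimately show "(\<lambda>k. u k z) \<longlonglongrightarrow> (D z)\<^sup>2" by (rule Lim_transform_eventually[rotated])
    qed
  qed (use ui in \<open>auto simp: u_def\<close>)
qed

text \<open>Off the truncation event the likelihood ratio exceeds one, so \<open>X k\<close> is
  positive. There either \<open>D\<close> is nonnegative and lies below \<open>W k\<close>, or it is
  negative and the expansion forces \<open>\<bar>D z\<bar> \<le> h k * A k z\<close>. Both
  contributions to the second moment vanish in the limit.\<close>

lemma D_square_tendsto:
  "integrable (Q k) (\<lambda>z. (D z)\<^sup>2)" "(\<lambda>k. \<integral>z. (D z)\<^sup>2 \<partial>Q k) \<longlonglongrightarrow> (\<integral>z. (D z)\<^sup>2 \<partial>P)"
proof -
  define F where "F k z = (W k z)\<^sup>2 * Bc k z + (h k)\<^sup>2 * (A k z)\<^sup>2" for k z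
  have [measurable]: "F k \<in> borel_measurable N" for k unfolding F_def by measurable
  have Fi: "integrable (Q k) (F k)" for k
    unfolding F_def by (intro Bochner_Integration.integrable_add mult_indicator_integrable[OF W_tail(2)] integrable_mult_right A_moments) measurable
  have F0: "(\<lambda>k. \<integral>z. F k z \<partial>Q k) \<longlonglongrightarrow> 0"
  proof -
    have e: "(\<integral>z. F k z \<partial>Q k) = (\<integral>z. (W k z)\<^sup>2 * Bc k z \<partial>Q k) + (h k)\<^sup>2 * (\<integral>z. (A k z)\<^sup>2 \<partial>Q k)" for k
    proof -
      have "integrable (Q k) (\<lambda>z. (W k z)\<^sup>2 * Bc k z)" by (rule mult_indicator_integrable[OF W_tail(2)]) measurable
      then show ?thesis unfolding F_def using A_moments by simp
    qed
    have l: "(\<lambda>k. (h k)\<^sup>2 * (1 + K)) \<longlonglongrightarrow> 0" by (rule tendsto_eq_intros h refl | simp)+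
    have "(\<lambda>k. (h k)\<^sup>2 * (\<integral>z. (A k z)\<^sup>2 \<partial>Q k)) \<longlonglongrightarrow> 0"
    proof (rule Lim_null_comparison[OF always_eventually l], rule allI)
      fix k show "norm ((h k)\<^sup>2 * (\<integral>z. (A k z)\<^sup>2 \<partial>Q k)) \<le> (h k)\<^sup>2 * (1 + K)"
        using A_integral_nonneg(2)[of k] A_moments(4)[of k] by (simp add: abs_mult mult_left_mono)
    qed
    from tendsto_add[OF W_tail(1) this] show ?thesis unfolding e by simp
  qed
  have pw: "(D z)\<^sup>2 * Bc k z \<le> F k z" if z: "z \<in> space N" for k z
  proof (cases "g k z \<le> exp 1 * g0 z")
    case True
    then show ?thesis by (simp add: F_def)
  next
    case False
    have "g0 z \<le> exp 1 * g0 z" using pos(1)[OF z] by simp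
    then have "g0 z < g k z" using False by linarith
    then have X: "0 < X k z" using pos z by simp
    show ?thesis
    proof (cases "0 \<le> D z")
      case True
      then have "(D z)\<^sup>2 \<le> (W k z)\<^sup>2" using D_le_W[OF z] by (intro power_mono)
      then show ?thesis using False by (simp add: F_def add_increasing2)
    next
      case neg: False
      have "h k * \<bar>D z\<bar> \<le> (h k)\<^sup>2 * A k z" using X taylor[OF z, of k] neg by (simp add: abs_le_iff)
      then have "\<bar>D z\<bar> \<le> h k * A k z" using h(1)[of k] by (simp add: power2_eq_square)
      then have "\<bar>D z\<bar>\<^sup>2 \<le> (h k * A k z)\<^sup>2" by (intro power_mono) auto
      then show ?thesis using False by (simp add: F_def power_mult_distrib add_increasing)
    qed
  qed
  have iB: "integrable (Q k) (\<lambda>z. (D z)\<^sup>2 * B k z)" for k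
    by (rule trunc_integrable) (auto intro: D_square_integrable)
  have iBc: "integrable (Q k) (\<lambda>z. (D z)\<^sup>2 * Bc k z)" for k
    by (rule Bochner_Integration.integrable_bound[OF Fi[of k]]) (use pw in \<open>auto intro!: AE_I2 order_trans[OF pw]\<close>)
  have spl: "(D z)\<^sup>2 = (D z)\<^sup>2 * B k z + (D z)\<^sup>2 * Bc k z" for k z by (simp add: indicator_def)
  have "integrable (Q k) (\<lambda>z. (D z)\<^sup>2 * B k z + (D z)\<^sup>2 * Bc k z)" for k using iB iBc by auto
  then show "integrable (Q k) (\<lambda>z. (D z)\<^sup>2)" for k unfolding spl[symmetric] .
  have e: "(\<integral>z. (D z)\<^sup>2 \<partial>Q k) = (\<integral>z. (D z)\<^sup>2 * B k z \<partial>Q k) + (\<integral>z. (D z)\<^sup>2 * Bc k z \<partial>Q k)" for k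
    by (subst spl[of _ k]) (rule Bochner_Integration.integral_add[OF iB iBc])
  have "(\<lambda>k. \<integral>z. (D z)\<^sup>2 * Bc k z \<partial>Q k) \<longlonglongrightarrow> 0"
  proof (rule Lim_null_comparison[OF always_eventually F0], rule allI)
    fix k
    have "(\<integral>z. (D z)\<^sup>2 * Bc k z \<partial>Q k) \<le> (\<integral>z. F k z \<partial>Q k)"
      by (rule integral_mono[OF iBc Fi]) (use pw in auto)
    then show "norm (\<integral>z. (D z)\<^sup>2 * Bc k z \<partial>Q k) \<le> (\<integral>z. F k z \<partial>Q k)"
      by (simp add: integral_nonneg_AE)
  qed
  with trunc_tendsto[OF _ D_square_integrable]
  have "(\<lambda>k. (\<integral>z. (D z)\<^sup>2 * B k z \<partial>Q k) + (\<integral>z. (D z)\<^sup>2 * Bc k z \<partial>Q k)) \<longlonglongrightarrow> (\<integral>z. (D z)\<^sup>2 \<partial>P) + 0"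
    by (intro tendsto_add) auto
  then show "(\<lambda>k. \<integral>z. (D z)\<^sup>2 \<partial>Q k) \<longlonglongrightarrow> (\<integral>z. (D z)\<^sup>2 \<partial>P)" unfolding e by simp
qed

end

section \<open>Families of laws with a second-order expansion\<close>

lemma sq_minus_min_le:
  fixes x p c :: real
  assumes "2 \<le> p" "0 < c"
  shows "x\<^sup>2 - min (x\<^sup>2) (c\<^sup>2) \<le> c powr (2 - p) * \<bar>x\<bar> powr p"
proof (cases "\<bar>x\<bar> > c")
  case True
  then have "\<bar>x\<bar>\<^sup>2 \<le> c powr (2 - p) * \<bar>x\<bar> powr p" using assms by (intro sq_le_powr_split(2)) auto
  moreover have "0 \<le> min (x\<^sup>2) (c\<^sup>2)" by simp
  ultimately show ?thesis unfolding power2_abs by linarith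
next
  case False
  then have "\<bar>x\<bar>\<^sup>2 \<le> c\<^sup>2" by (intro power_mono) auto
  then show ?thesis by (simp add: min_absorb1)
qed

text \<open>\<open>S\<close> and \<open>H\<close> play the first and second derivative of the
  log-density. Densities are positive on the whole space, so all laws share the null sets of
  \<open>N\<close>. One function \<open>A t\<close> bounds the remainders of both orders; its
  moments are bounded under the laws of all nearby \<open>u\<close>, chosen independently of
  \<open>t\<close>, because the bound at a fixed point is integrated against the approaching
  laws.\<close>

locale smooth_family =
  fixes N :: "'a measure" and \<Theta> :: "real set" and f S H :: "real \<Rightarrow> 'a \<Rightarrow> real"
  assumes f_meas [measurable]: "\<And>\<theta>. \<theta> \<in> \<Theta> \<Longrightarrow> f \<theta> \<in> borel_measurable N"
    and S_meas [measurable]: "\<And>\<theta>. \<theta> \<in> \<Theta> \<Longrightarrow> S \<theta> \<in> borel_measurable N"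
    and H_meas [measurable]: "\<And>\<theta>. \<theta> \<in> \<Theta> \<Longrightarrow> H \<theta> \<in> borel_measurable N"
    and f_pos: "\<And>\<theta> z. \<theta> \<in> \<Theta> \<Longrightarrow> z \<in> space N \<Longrightarrow> 0 < f \<theta> z"
    and f_prob: "\<And>\<theta>. \<theta> \<in> \<Theta> \<Longrightarrow> prob_space (density N (f \<theta>))"
    and limpt: "\<And>\<theta>. \<theta> \<in> \<Theta> \<Longrightarrow> \<theta> islimpt \<Theta>"
    and S_deriv: "\<And>\<theta> z. \<theta> \<in> \<Theta> \<Longrightarrow> z \<in> space N \<Longrightarrow>
      ((\<lambda>t. (S t z - S \<theta> z) / (t - \<theta>)) \<longlongrightarrow> H \<theta> z) (at \<theta> within \<Theta>)"
    and expansion: "\<And>\<theta>. \<theta> \<in> \<Theta> \<Longrightarrow> \<exists>r>0. \<exists>p>2. \<exists>K. \<exists>A :: real \<Rightarrow> 'a \<Rightarrow> real.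
      (\<forall>t\<in>\<Theta> \<inter> ball \<theta> r. A t \<in> borel_measurable N \<and>
        (\<forall>z\<in>space N. 0 \<le> A t z \<and> \<bar>ln (f t z) - ln (f \<theta> z) - (t - \<theta>) * S \<theta> z\<bar> \<le> (t - \<theta>)\<^sup>2 * A t z \<and>
          \<bar>S t z - S \<theta> z\<bar> \<le> \<bar>t - \<theta>\<bar> * A t z) \<and>
        (\<forall>u\<in>\<Theta> \<inter> ball \<theta> r. integrable (density N (f u)) (\<lambda>z. A t z powr p) \<and>
          (\<integral>z. A t z powr p \<partial>density N (f u)) \<le> K)) \<and>
      (\<forall>z\<in>space N. ((\<lambda>t. (t - \<theta>) * A t z) \<longlongrightarrow> 0) (at \<theta> within \<Theta>))"
begin

abbreviation "P \<theta> \<equiv> density N (\<lambda>z. ennreal (f \<theta> z))"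

lemma AE_f: "\<theta> \<in> \<Theta> \<Longrightarrow> AE z in N. 0 \<le> f \<theta> z"
  by (auto intro!: AE_I2 less_imp_le f_pos)

lemma int_P:
  fixes \<phi> :: "'a \<Rightarrow> real"
  assumes "\<theta> \<in> \<Theta>" and [measurable]: "\<phi> \<in> borel_measurable N"
  shows "(\<integral>z. \<phi> z \<partial>P \<theta>) = (\<integral>z. f \<theta> z * \<phi> z \<partial>N)" "integrable (P \<theta>) \<phi> \<longleftrightarrow> integrable N (\<lambda>z. f \<theta> z * \<phi> z)"
  by (subst integral_real_density integrable_real_density; use AE_f[OF assms(1)] f_meas[OF assms(1)] in simp)+

lemma f_1: "\<theta> \<in> \<Theta> \<Longrightarrow> integrable N (f \<theta>)" "\<theta> \<in> \<Theta> \<Longrightarrow> (\<integral>z. f \<theta> z \<partial>N) = 1"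
  by (rule density_integral_1[OF f_meas AE_f f_prob]; assumption)+

lemma AE_P_iff: "\<theta> \<in> \<Theta> \<Longrightarrow> (AE z in P \<theta>. Q z) \<longleftrightarrow> (AE z in N. Q z)"
  by (subst AE_density) (auto simp: f_pos intro!: AE_cong)

lemma scaled_tendsto_0:
  assumes "\<theta> \<in> \<Theta>" "\<forall>z\<in>space N. ((\<lambda>t. (t - \<theta>) * A t z) \<longlongrightarrow> 0) (at \<theta> within \<Theta>)" "z \<in> space N"
  shows "((\<lambda>t. \<bar>t - \<theta>\<bar> * \<bar>A t z\<bar>) \<longlongrightarrow> 0) (at \<theta> within \<Theta>)"
  using tendsto_rabs[OF bspec[OF assms(2,3)]] by (simp add: abs_mult)

lemma f_continuous:
  assumes th: "\<theta> \<in> \<Theta>" and z: "z \<in> space N"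
  shows "continuous (at \<theta> within \<Theta>) (\<lambda>t. f t z)"
    and "continuous (at \<theta> within \<Theta>) (\<lambda>t. S t z)"
proof -
  obtain r p K A where r: "0 < r" and A: "\<And>t. t \<in> \<Theta> \<inter> ball \<theta> r \<Longrightarrow> 0 \<le> A t z \<and>
        \<bar>ln (f t z) - ln (f \<theta> z) - (t - \<theta>) * S \<theta> z\<bar> \<le> (t - \<theta>)\<^sup>2 * A t z \<and> \<bar>S t z - S \<theta> z\<bar> \<le> \<bar>t - \<theta>\<bar> * A t z"
      and lim: "\<forall>z\<in>space N. ((\<lambda>t. (t - \<theta>) * A t z) \<longlongrightarrow> 0) (at \<theta> within \<Theta>)"
    using expansion[OF th] z by (elim exE conjE) blast
  have hA: "((\<lambda>t. \<bar>t - \<theta>\<bar> * \<bar>A t z\<bar>) \<longlongrightarrow> 0) (at \<theta> within \<Theta>)" by (rule scaled_tendsto_0[OF th lim z])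
  have ev: "\<forall>\<^sub>F t in at \<theta> within \<Theta>. t \<in> \<Theta> \<inter> ball \<theta> r"
    using r by (auto simp: eventually_at dist_commute intro!: exI[of _ r])
  have "((\<lambda>t. S t z - S \<theta> z) \<longlongrightarrow> 0) (at \<theta> within \<Theta>)"
    by (rule Lim_null_comparison[OF _ hA]) (use ev in eventually_elim, use A in auto)
  then show "continuous (at \<theta> within \<Theta>) (\<lambda>t. S t z)" by (simp add: continuous_within LIM_zero_iff)
  have "((\<lambda>t. \<bar>t - \<theta>\<bar> * (\<bar>t - \<theta>\<bar> * \<bar>A t z\<bar>)) \<longlongrightarrow> \<bar>\<theta> - \<theta>\<bar> * 0) (at \<theta> within \<Theta>)"
    by (intro tendsto_intros hA)
  then have h2: "((\<lambda>t. (t - \<theta>)\<^sup>2 * \<bar>A t z\<bar>) \<longlongrightarrow> 0) (at \<theta> within \<Theta>)"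
    by (simp add: mult.assoc[symmetric] power2_eq_square abs_mult_self_eq)
  have "((\<lambda>t. ln (f t z) - ln (f \<theta> z) - (t - \<theta>) * S \<theta> z) \<longlongrightarrow> 0) (at \<theta> within \<Theta>)"
    by (rule Lim_null_comparison[OF _ h2]) (use ev in eventually_elim, use A in auto)
  then have "((\<lambda>t. (ln (f t z) - ln (f \<theta> z) - (t - \<theta>) * S \<theta> z) + (ln (f \<theta> z) + (t - \<theta>) * S \<theta> z)) \<longlongrightarrow> 0 + (ln (f \<theta> z) + (\<theta> - \<theta>) * S \<theta> z)) (at \<theta> within \<Theta>)"
    by (intro tendsto_intros)
  then have "((\<lambda>t. exp (ln (f t z))) \<longlongrightarrow> exp (ln (f \<theta> z))) (at \<theta> within \<Theta>)"
    by (intro tendsto_exp) simp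
  moreover have "\<forall>\<^sub>F t in at \<theta> within \<Theta>. exp (ln (f t z)) = f t z"
    using ev by eventually_elim (use f_pos z in auto)
  ultimately show "continuous (at \<theta> within \<Theta>) (\<lambda>t. f t z)"
    unfolding continuous_within using f_pos[OF th z] by (auto intro: Lim_transform_eventually)
qed

text \<open>The sign \<open>s\<close> reflects the line so that \<open>\<theta>\<close> is always
  approached from the right; it multiplies the score as well and drops out of the claims.\<close>

lemma one_sided_score:
  assumes th: "\<theta> \<in> \<Theta>" and s: "s \<in> {1, -1}" and t: "\<And>k. t k \<in> \<Theta>" "\<And>k::nat. 0 < s * (t k - \<theta>)" "t \<longlonglongrightarrow> \<theta>"
  shows "(\<integral>z. S \<theta> z \<partial>P \<theta>) = 0" "integrable (P \<theta>) (\<lambda>z. (S \<theta> z)\<^sup>2)"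
    "\<forall>\<^sub>F k in sequentially. integrable (P (t k)) (\<lambda>z. (S \<theta> z)\<^sup>2)"
    "(\<lambda>k. \<integral>z. (S \<theta> z)\<^sup>2 \<partial>P (t k)) \<longlonglongrightarrow> (\<integral>z. (S \<theta> z)\<^sup>2 \<partial>P \<theta>)"
proof -
  obtain r p K A where r: "0 < r" and p: "2 < p" and A: "\<forall>t\<in>\<Theta> \<inter> ball \<theta> r. A t \<in> borel_measurable N \<and>
        (\<forall>z\<in>space N. 0 \<le> A t z \<and> \<bar>ln (f t z) - ln (f \<theta> z) - (t - \<theta>) * S \<theta> z\<bar> \<le> (t - \<theta>)\<^sup>2 * A t z \<and>
          \<bar>S t z - S \<theta> z\<bar> \<le> \<bar>t - \<theta>\<bar> * A t z) \<and>
        (\<forall>u\<in>\<Theta> \<inter> ball \<theta> r. integrable (P u) (\<lambda>z. A t z powr p) \<and> (\<integral>z. A t z powr p \<partial>P u) \<le> K)"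
      and lim: "\<forall>z\<in>space N. ((\<lambda>t. (t - \<theta>) * A t z) \<longlongrightarrow> 0) (at \<theta> within \<Theta>)"
    using expansion[OF th] by (elim exE conjE) blast
  have "\<forall>\<^sub>F k in sequentially. dist (t k) \<theta> < r" by (rule tendstoD[OF t(3) r])
  then obtain a where a: "\<And>k. a \<le> k \<Longrightarrow> t k \<in> \<Theta> \<inter> ball \<theta> r"
    using t(1) by (auto simp: eventually_sequentially dist_commute)
  have abss: "\<bar>s * x\<bar> = \<bar>x\<bar>" for x using s by auto
  have eqs: "s * (t k - \<theta>) = dist (t k) \<theta>" for k using t(2)[of k] abss[of "t k - \<theta>"] by (simp add: dist_real_def)
  \<comment> \<open>The fixed point of the approach is the term \<open>t a\<close> of the sequence
    itself. From some index on the terms are at most half as far from \<open>\<theta>\<close>, as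
    the comparison of slopes requires.\<close>
  have "\<forall>\<^sub>F k in sequentially. dist (t k) \<theta> < s * (t a - \<theta>) / 2" by (rule tendstoD[OF t(3)]) (use t(2)[of a] in simp)
  then obtain b where b: "\<And>k. b \<le> k \<Longrightarrow> s * (t k - \<theta>) \<le> s * (t a - \<theta>) / 2"
    by (auto simp: eventually_sequentially eqs intro: less_imp_le)
  define c where "c = max a b"
  define u where "u k = t (k + c)" for k
  have u3: "0 < s * (u k - \<theta>)" for k unfolding u_def by (rule t(2))
  have u: "u k \<in> \<Theta>" "u k \<in> \<Theta> \<inter> ball \<theta> r" "0 < s * (u k - \<theta>)" "u k \<noteq> \<theta>" for k
    using t(1) a[of "k + c"] u3[of k] by (auto simp: u_def c_def)
  have u_lim: "u \<longlonglongrightarrow> \<theta>" unfolding u_def by (rule LIMSEQ_ignore_initial_segment[OF t(3)])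
  have ss: "s * x * (s * y) = x * y" for x y using s by auto
  have ss2: "(s * x)\<^sup>2 = x\<^sup>2" for x using s by auto
  have ta: "t a \<in> \<Theta>" "t a \<in> \<Theta> \<inter> ball \<theta> r" by (rule t(1)) (rule a, simp)
  have Am: "A v \<in> borel_measurable N" if "v \<in> \<Theta> \<inter> ball \<theta> r" for v using A that by blast
  have A0: "0 \<le> A v z" if "v \<in> \<Theta> \<inter> ball \<theta> r" "z \<in> space N" for v z using A that by blast
  have AT: "\<bar>ln (f v z) - ln (f \<theta> z) - (v - \<theta>) * S \<theta> z\<bar> \<le> (v - \<theta>)\<^sup>2 * A v z" if "v \<in> \<Theta> \<inter> ball \<theta> r" "z \<in> space N" for v z
    using A that by blast
  have AK: "integrable (P w) (\<lambda>z. A v z powr p)" "(\<integral>z. A v z powr p \<partial>P w) \<le> K"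
    if "v \<in> \<Theta> \<inter> ball \<theta> r" "w \<in> \<Theta> \<inter> ball \<theta> r" for v w using A that by blast+
  interpret L: one_sided_approach N "f \<theta>" "f (t a)" "\<lambda>k. f (u k)" "\<lambda>k. s * (u k - \<theta>)" "s * (t a - \<theta>)" "\<lambda>z. s * S \<theta> z" "A (t a)"
    "\<lambda>k. A (u k)" p K
  proof (rule one_sided_approach.intro)
    show "s * (u k - \<theta>) \<le> s * (t a - \<theta>) / 2" for k unfolding u_def by (rule b) (simp add: c_def)
    show "(\<lambda>k. s * (u k - \<theta>)) \<longlonglongrightarrow> 0" using tendsto_mult_left[OF LIM_zero[OF u_lim], of s] by simp
    show "(\<lambda>k. s * (u k - \<theta>) * A (u k) z) \<longlonglongrightarrow> 0" if "z \<in> space N" for z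
    proof -
      have "((\<lambda>t. (t - \<theta>) * A t z) \<circ> u) \<longlonglongrightarrow> 0"
        using lim that u u_lim unfolding tendsto_at_iff_sequentially by blast
      from tendsto_mult_left[OF this, of s] show ?thesis by (simp add: mult.assoc comp_def)
    qed
    show "f \<theta> \<in> borel_measurable N" "f (t a) \<in> borel_measurable N" "\<And>k. f (u k) \<in> borel_measurable N"
      "(\<lambda>z. s * S \<theta> z) \<in> borel_measurable N" "A (t a) \<in> borel_measurable N" "\<And>k. A (u k) \<in> borel_measurable N"
      using f_meas[OF th] f_meas[OF ta(1)] f_meas[OF u(1)] S_meas[OF th] Am[OF ta(2)] Am[OF u(2)] by simp_all
    show "0 < f \<theta> z" if "z \<in> space N" for z by (rule f_pos[OF th that])
    show "0 < f (t a) z" if "z \<in> space N" for z by (rule f_pos[OF ta(1) that])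
    show "0 < f (u k) z" if "z \<in> space N" for k z by (rule f_pos[OF u(1) that])
    show "0 \<le> A (t a) z" if "z \<in> space N" for z by (rule A0[OF ta(2) that])
    show "0 \<le> A (u k) z" if "z \<in> space N" for k z by (rule A0[OF u(2) that])
    show "prob_space (P \<theta>)" by (rule f_prob[OF th])
    show "prob_space (P (t a))" by (rule f_prob[OF ta(1)])
    show "prob_space (P (u k))" for k by (rule f_prob[OF u(1)])
    show "\<bar>ln (f (u k) z) - ln (f \<theta> z) - s * (u k - \<theta>) * (s * S \<theta> z)\<bar> \<le> (s * (u k - \<theta>))\<^sup>2 * A (u k) z" if "z \<in> space N" for k z
      unfolding ss ss2 by (rule AT[OF u(2) that])
    show "\<bar>ln (f (t a) z) - ln (f \<theta> z) - s * (t a - \<theta>) * (s * S \<theta> z)\<bar> \<le> (s * (t a - \<theta>))\<^sup>2 * A (t a) z" if "z \<in> space N" for z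
      unfolding ss ss2 by (rule AT[OF ta(2) that])
    show "2 < p" by (rule p)
    show "0 < s * (u k - \<theta>)" for k by (rule u)
    have th': "\<theta> \<in> \<Theta> \<inter> ball \<theta> r" using th r by simp
    show "integrable (P \<theta>) (\<lambda>z. A (u k) z powr p)" "(\<integral>z. A (u k) z powr p \<partial>P \<theta>) \<le> K" for k
      by (rule AK[OF u(2) th'])+
    show "integrable (P (u k)) (\<lambda>z. A (u k) z powr p)" "(\<integral>z. A (u k) z powr p \<partial>P (u k)) \<le> K" for k
      by (rule AK[OF u(2) u(2)])+
    show "integrable (P (u k)) (\<lambda>z. A (t a) z powr p)" "(\<integral>z. A (t a) z powr p \<partial>P (u k)) \<le> K" for k
      by (rule AK[OF ta(2) u(2)])+
  qed
  show "(\<integral>z. S \<theta> z \<partial>P \<theta>) = 0" using L.D_mean_zero s by auto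
  show "integrable (P \<theta>) (\<lambda>z. (S \<theta> z)\<^sup>2)" using L.D_square_integrable by (simp add: ss2)
  have "integrable (P (t k)) (\<lambda>z. (S \<theta> z)\<^sup>2)" if "c \<le> k" for k
    using L.D_square_tendsto(1)[of "k - c"] that by (simp add: ss2 u_def)
  then show "\<forall>\<^sub>F k in sequentially. integrable (P (t k)) (\<lambda>z. (S \<theta> z)\<^sup>2)" by (auto simp: eventually_sequentially)
  show "(\<lambda>k. \<integral>z. (S \<theta> z)\<^sup>2 \<partial>P (t k)) \<longlonglongrightarrow> (\<integral>z. (S \<theta> z)\<^sup>2 \<partial>P \<theta>)"
    using L.D_square_tendsto(2) unfolding ss2 u_def by (rule LIMSEQ_offset)
qed

text \<open>A limit point of \<open>\<Theta>\<close> is a limit point of the part of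
  \<open>\<Theta>\<close> on one of its two sides, and a single side suffices.\<close>

lemma
  assumes th: "\<theta> \<in> \<Theta>"
  shows score_mean: "(\<integral>z. S \<theta> z \<partial>P \<theta>) = 0"
    and score_square: "integrable (P \<theta>) (\<lambda>z. (S \<theta> z)\<^sup>2)"
proof -
  have "\<theta> islimpt insert \<theta> ({t\<in>\<Theta>. 0 < 1 * (t - \<theta>)} \<union> {t\<in>\<Theta>. 0 < -1 * (t - \<theta>)})"
    by (rule islimpt_subset[OF limpt[OF th]]) auto
  then have "\<exists>s\<in>{1,-1}. \<theta> islimpt {t\<in>\<Theta>. 0 < s * (t - \<theta>)}"
    unfolding islimpt_insert islimpt_Un by blast
  then obtain s where s: "s \<in> {1,-1}" "\<theta> islimpt {t\<in>\<Theta>. 0 < s * (t - \<theta>)}" by blast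
  then obtain t where "\<And>k. t k \<in> {t\<in>\<Theta>. 0 < s * (t - \<theta>)}" "t \<longlonglongrightarrow> \<theta>"
    unfolding islimpt_sequential by blast
  with one_sided_score[OF th s(1), of t]
  show "(\<integral>z. S \<theta> z \<partial>P \<theta>) = 0" "integrable (P \<theta>) (\<lambda>z. (S \<theta> z)\<^sup>2)" by auto
qed

end

section \<open>Continuity of the Fisher information and critical points\<close>

context smooth_family
begin

lemma score_information_at_fixed:
  assumes th: "\<theta> \<in> \<Theta>" and t: "\<And>k. t k \<in> \<Theta> - {\<theta>}" "t \<longlonglongrightarrow> \<theta>"
  shows "(\<lambda>k. \<integral>z. (S \<theta> z)\<^sup>2 \<partial>P (t k)) \<longlonglongrightarrow> (\<integral>z. (S \<theta> z)\<^sup>2 \<partial>P \<theta>)"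
    "\<forall>\<^sub>F k in sequentially. integrable (P (t k)) (\<lambda>z. (S \<theta> z)\<^sup>2)"
proof -
  \<comment> \<open>The default value differs from the limit by one, so convergence of
    \<open>?F\<close> also forces integrability from some index on. In this way both claims pass
    from the two one-sided filters to the two-sided one.\<close>
  let ?F = "\<lambda>t. if integrable (P t) (\<lambda>z. (S \<theta> z)\<^sup>2) then (\<integral>z. (S \<theta> z)\<^sup>2 \<partial>P t) else (\<integral>z. (S \<theta> z)\<^sup>2 \<partial>P \<theta>) - 1"
  have "(?F \<longlongrightarrow> (\<integral>z. (S \<theta> z)\<^sup>2 \<partial>P \<theta>)) (at \<theta> within {t\<in>\<Theta>. 0 < s * (t - \<theta>)})" if s: "s \<in> {1,-1}" for s
    unfolding tendsto_at_iff_sequentially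
  proof (intro allI impI)
    fix u assume u: "\<forall>k. u k \<in> {t\<in>\<Theta>. 0 < s * (t - \<theta>)} - {\<theta>}" "u \<longlonglongrightarrow> \<theta>"
    have u': "\<And>k. u k \<in> \<Theta>" "\<And>k. 0 < s * (u k - \<theta>)" using u by auto
    from one_sided_score(3)[OF th s u' u(2)]
    have "\<forall>\<^sub>F k in sequentially. (\<integral>z. (S \<theta> z)\<^sup>2 \<partial>P (u k)) = (?F \<circ> u) k" by eventually_elim simp
    with one_sided_score(4)[OF th s u' u(2)] show "(?F \<circ> u) \<longlonglongrightarrow> (\<integral>z. (S \<theta> z)\<^sup>2 \<partial>P \<theta>)"
      by (rule Lim_transform_eventually)
  qed
  then have "(?F \<longlongrightarrow> (\<integral>z. (S \<theta> z)\<^sup>2 \<partial>P \<theta>)) (at \<theta> within ({t\<in>\<Theta>. 0 < 1 * (t - \<theta>)} \<union> {t\<in>\<Theta>. 0 < -1 * (t - \<theta>)}))"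
    unfolding Lim_within_Un by blast
  moreover have "{t\<in>\<Theta>. 0 < 1 * (t - \<theta>)} \<union> {t\<in>\<Theta>. 0 < -1 * (t - \<theta>)} = \<Theta> - {\<theta>}" by auto
  ultimately have F: "(?F \<circ> t) \<longlonglongrightarrow> (\<integral>z. (S \<theta> z)\<^sup>2 \<partial>P \<theta>)" using t unfolding tendsto_at_iff_sequentially by auto
  then have "\<forall>\<^sub>F k in sequentially. (\<integral>z. (S \<theta> z)\<^sup>2 \<partial>P \<theta>) - 1 < (?F \<circ> t) k" by (rule order_tendstoD) simp
  then show i: "\<forall>\<^sub>F k in sequentially. integrable (P (t k)) (\<lambda>z. (S \<theta> z)\<^sup>2)"
    by eventually_elim (auto split: if_splits)
  show "(\<lambda>k. \<integral>z. (S \<theta> z)\<^sup>2 \<partial>P (t k)) \<longlonglongrightarrow> (\<integral>z. (S \<theta> z)\<^sup>2 \<partial>P \<theta>)"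
    by (rule Lim_transform_eventually[OF F]) (use i in eventually_elim, simp)
qed

lemma expansion_sequence:
  assumes th: "\<theta> \<in> \<Theta>" and t: "\<And>k. t k \<in> \<Theta> - {\<theta>}" "t \<longlonglongrightarrow> \<theta>"
  obtains n p K and B :: "nat \<Rightarrow> 'a \<Rightarrow> real" where "2 < p"
    "\<And>k. n \<le> k \<Longrightarrow> B k \<in> borel_measurable N"
    "\<And>k z. n \<le> k \<Longrightarrow> z \<in> space N \<Longrightarrow> 0 \<le> B k z"
    "\<And>k z. n \<le> k \<Longrightarrow> z \<in> space N \<Longrightarrow> \<bar>S (t k) z - S \<theta> z\<bar> \<le> \<bar>t k - \<theta>\<bar> * B k z"
    "\<And>k. n \<le> k \<Longrightarrow> integrable (P (t k)) (\<lambda>z. B k z powr p)"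
    "\<And>k. n \<le> k \<Longrightarrow> (\<integral>z. B k z powr p \<partial>P (t k)) \<le> K"
proof -
  obtain r p K A where r: "0 < r" and p: "2 < p" and A: "\<forall>t\<in>\<Theta> \<inter> ball \<theta> r. A t \<in> borel_measurable N \<and>
        (\<forall>z\<in>space N. 0 \<le> A t z \<and> \<bar>ln (f t z) - ln (f \<theta> z) - (t - \<theta>) * S \<theta> z\<bar> \<le> (t - \<theta>)\<^sup>2 * A t z \<and>
          \<bar>S t z - S \<theta> z\<bar> \<le> \<bar>t - \<theta>\<bar> * A t z) \<and>
        (\<forall>u\<in>\<Theta> \<inter> ball \<theta> r. integrable (P u) (\<lambda>z. A t z powr p) \<and> (\<integral>z. A t z powr p \<partial>P u) \<le> K)"
    using expansion[OF th] by (elim exE conjE) blast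
  have "\<forall>\<^sub>F k in sequentially. dist (t k) \<theta> < r" by (rule tendstoD[OF t(2) r])
  then obtain n where n: "\<And>k. n \<le> k \<Longrightarrow> t k \<in> \<Theta> \<inter> ball \<theta> r"
    using t(1) by (auto simp: eventually_sequentially dist_commute)
  show thesis
    by (rule that[of p n "\<lambda>k. A (t k)" K]) (use p A n in blast)+
qed

text \<open>The law is moved first, with the score held at \<open>\<theta>\<close>. Replacing the
  score by the one at \<open>t\<close> then costs \<open>\<bar>t - \<theta>\<bar>\<close> times a
  sum of second moments under the moving law, plus a term of second order; the mixed term is split
  by the inequality between twice a product and the sum of the squares.\<close>

lemma Fisher_continuous:
  assumes th: "\<theta> \<in> \<Theta>"
  shows "continuous (at \<theta> within \<Theta>) (\<lambda>t. \<integral>z. (S t z)\<^sup>2 \<partial>P t)"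
  unfolding continuous_within tendsto_at_iff_sequentially
proof (intro allI impI)
  fix t assume t': "\<forall>k. t k \<in> \<Theta> - {\<theta>}" and tl: "t \<longlonglongrightarrow> \<theta>"
  then have t: "\<And>k. t k \<in> \<Theta> - {\<theta>}" by auto
  obtain n p K B where p: "2 < p" and Bm: "\<And>k. n \<le> k \<Longrightarrow> B k \<in> borel_measurable N"
    and B0: "\<And>k z. n \<le> k \<Longrightarrow> z \<in> space N \<Longrightarrow> 0 \<le> B k z"
    and BS: "\<And>k z. n \<le> k \<Longrightarrow> z \<in> space N \<Longrightarrow> \<bar>S (t k) z - S \<theta> z\<bar> \<le> \<bar>t k - \<theta>\<bar> * B k z"
    and Bp: "\<And>k. n \<le> k \<Longrightarrow> integrable (P (t k)) (\<lambda>z. B k z powr p)" "\<And>k. n \<le> k \<Longrightarrow> (\<integral>z. B k z powr p \<partial>P (t k)) \<le> K"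
    by (rule expansion_sequence[OF th t tl]) (rule that, assumption+)
  note fixed = score_information_at_fixed[OF th t tl]
  define J where "J k = (\<integral>z. (S \<theta> z)\<^sup>2 \<partial>P (t k))" for k
  define E where "E k = \<bar>t k - \<theta>\<bar> * ((1 + K) + J k) + (t k - \<theta>)\<^sup>2 * (1 + K)" for k
  have h0: "(\<lambda>k. t k - \<theta>) \<longlonglongrightarrow> 0" using tl by (simp add: LIM_zero)
  have E0: "E \<longlonglongrightarrow> 0"
  proof -
    have "E \<longlonglongrightarrow> \<bar>0\<bar> * ((1 + K) + (\<integral>z. (S \<theta> z)\<^sup>2 \<partial>P \<theta>)) + 0\<^sup>2 * (1 + K)"
      unfolding E_def J_def by (intro tendsto_intros h0 fixed)
    then show ?thesis by simp
  qed
  have le: "\<bar>(\<integral>z. (S (t k) z)\<^sup>2 \<partial>P (t k)) - J k\<bar> \<le> E k"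
    if k: "n \<le> k" and i: "integrable (P (t k)) (\<lambda>z. (S \<theta> z)\<^sup>2)" for k
  proof -
    let ?h = "\<bar>t k - \<theta>\<bar>"
    have tk: "t k \<in> \<Theta>" using t by auto
    note m = S_meas[OF th] S_meas[OF tk] Bm[OF k]
    note [measurable] = m
    have B2: "integrable (P (t k)) (\<lambda>z. (B k z)\<^sup>2)" "(\<integral>z. (B k z)\<^sup>2 \<partial>P (t k)) \<le> 1 + K"
      by (rule moment_le[OF f_prob[OF tk] _ _ _ Bp[OF k]]; use m B0[OF k] p in simp)+
    note i2 = score_square[OF tk]
    have "\<bar>(\<integral>z. (S (t k) z)\<^sup>2 \<partial>P (t k)) - J k\<bar> = \<bar>\<integral>z. (S (t k) z)\<^sup>2 - (S \<theta> z)\<^sup>2 \<partial>P (t k)\<bar>"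
      unfolding J_def using i i2 by simp
    also have "\<dots> \<le> (\<integral>z. \<bar>(S (t k) z)\<^sup>2 - (S \<theta> z)\<^sup>2\<bar> \<partial>P (t k))" by (rule integral_abs_bound)
    also have "\<dots> \<le> (\<integral>z. ?h * ((B k z)\<^sup>2 + (S \<theta> z)\<^sup>2) + ?h\<^sup>2 * (B k z)\<^sup>2 \<partial>P (t k))"
    proof (rule integral_mono)
      fix z assume "z \<in> space (P (t k))"
      then have z: "z \<in> space N" by simp
      let ?b = "B k z" and ?s = "S \<theta> z" and ?x = "S (t k) z"
      have d: "\<bar>?x - ?s\<bar> \<le> ?h * ?b" by (rule BS[OF k z])
      have "\<bar>?x\<^sup>2 - ?s\<^sup>2\<bar> = \<bar>?x - ?s\<bar> * \<bar>(?x - ?s) + 2 * ?s\<bar>"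
        by (simp add: abs_mult[symmetric] power2_eq_square algebra_simps)
      also have "\<dots> \<le> (?h * ?b) * (?h * ?b + 2 * \<bar>?s\<bar>)"
        by (intro mult_mono) (use d B0[OF k z] in auto)
      also have "\<dots> = ?h\<^sup>2 * ?b\<^sup>2 + ?h * (2 * ?b * \<bar>?s\<bar>)" by (simp add: power2_eq_square algebra_simps)
      also have "\<dots> \<le> ?h\<^sup>2 * ?b\<^sup>2 + ?h * (?b\<^sup>2 + ?s\<^sup>2)"
        using sum_squares_bound[of ?b "\<bar>?s\<bar>"] by (intro add_left_mono mult_left_mono) auto
      finally show "\<bar>?x\<^sup>2 - ?s\<^sup>2\<bar> \<le> ?h * (?b\<^sup>2 + ?s\<^sup>2) + ?h\<^sup>2 * ?b\<^sup>2" by simp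
    qed (use i i2 B2 in auto)
    also have "\<dots> = ?h * ((\<integral>z. (B k z)\<^sup>2 \<partial>P (t k)) + J k) + ?h\<^sup>2 * (\<integral>z. (B k z)\<^sup>2 \<partial>P (t k))"
      unfolding J_def using i B2 by simp
    also have "\<dots> \<le> ?h * ((1 + K) + J k) + ?h\<^sup>2 * (1 + K)"
      by (intro add_mono mult_left_mono B2 order_refl) auto
    finally show ?thesis by (simp add: E_def)
  qed
  have "(\<lambda>k. (\<integral>z. (S (t k) z)\<^sup>2 \<partial>P (t k)) - J k) \<longlonglongrightarrow> 0"
  proof (rule Lim_null_comparison[OF _ E0])
    show "\<forall>\<^sub>F k in sequentially. norm ((\<integral>z. (S (t k) z)\<^sup>2 \<partial>P (t k)) - J k) \<le> E k"
      using eventually_ge_at_top[of n] fixed(2) by eventually_elim (use le in simp)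
  qed
  from tendsto_add[OF this fixed(1)[folded J_def]]
  show "((\<lambda>t. \<integral>z. (S t z)\<^sup>2 \<partial>P t) \<circ> t) \<longlonglongrightarrow> (\<integral>z. (S \<theta> z)\<^sup>2 \<partial>P \<theta>)" by (simp add: comp_def)
qed

text \<open>A vanishing second moment makes the score vanish almost surely at
  \<open>\<theta>\<close>; positivity of the densities turns this into a statement about
  \<open>N\<close>, and so about every law of the family.\<close>

lemma critical_score_zero:
  assumes th: "\<theta> \<in> \<Theta>" and crit: "(\<integral>z. (S \<theta> z)\<^sup>2 \<partial>P \<theta>) = 0"
  shows "AE z in N. S \<theta> z = 0"
proof -
  have "AE z in P \<theta>. (S \<theta> z)\<^sup>2 = 0"
    using integral_nonneg_eq_0_iff_AE[OF score_square[OF th]] crit by simp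
  then show ?thesis unfolding AE_P_iff[OF th] by simp
qed

text \<open>The difference quotient of the score at a critical \<open>\<theta>\<close>, where the
  subtracted term is zero almost everywhere. For \<open>t\<close> different from
  \<open>\<theta>\<close> it is the score up to a factor free of \<open>z\<close>, and such a factor
  cancels in the normalized statistic.\<close>

definition slope where
  "slope \<theta> t z = (if t = \<theta> then H \<theta> z else S t z / (t - \<theta>))"

lemma slope_meas [measurable]: "\<theta> \<in> \<Theta> \<Longrightarrow> t \<in> \<Theta> \<Longrightarrow> slope \<theta> t \<in> borel_measurable N"
  by (cases "t = \<theta>") (auto simp: slope_def[abs_def] S_meas H_meas)

lemma slope_continuous:
  assumes th: "\<theta> \<in> \<Theta>" and z: "z \<in> space N" and S0: "S \<theta> z = 0"
  shows "continuous (at \<theta> within \<Theta>) (\<lambda>t. slope \<theta> t z)"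
proof -
  have "((\<lambda>t. slope \<theta> t z) \<longlongrightarrow> H \<theta> z) (at \<theta> within \<Theta>)"
    by (rule Lim_transform_eventually[OF S_deriv[OF th z]]) (auto simp: eventually_at_filter slope_def S0)
  then show ?thesis by (simp add: continuous_within slope_def)
qed

text \<open>Since the score vanishes at \<open>\<theta>\<close>, the slopes are bounded by the
  remainder function and have bounded moments of order \<open>p\<close> above two under their own
  laws. This gives convergence of their second moments although the laws vary; the mean of
  \<open>H\<close> vanishes as the limit of the means of the slopes. Densities are kept inside the
  integrals, so that all convergence takes place over the single measure \<open>N\<close>.\<close>

lemma critical_slope:
  assumes th: "\<theta> \<in> \<Theta>" and crit: "(\<integral>z. (S \<theta> z)\<^sup>2 \<partial>P \<theta>) = 0"
  shows "integrable (P \<theta>) (\<lambda>z. (H \<theta> z)\<^sup>2)" "(\<integral>z. H \<theta> z \<partial>P \<theta>) = 0"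
    "continuous (at \<theta> within \<Theta>) (\<lambda>t. \<integral>z. (slope \<theta> t z)\<^sup>2 \<partial>P t)"
proof -
  have S0: "AE z in N. S \<theta> z = 0" by (rule critical_score_zero[OF th crit])
  have H2: "integrable (P \<theta>) (\<lambda>z. (H \<theta> z)\<^sup>2) \<and> (\<integral>z. H \<theta> z \<partial>P \<theta>) = 0 \<and>
      (\<lambda>k. \<integral>z. (slope \<theta> (t k) z)\<^sup>2 \<partial>P (t k)) \<longlonglongrightarrow> (\<integral>z. (H \<theta> z)\<^sup>2 \<partial>P \<theta>)"
    if t: "\<And>k. t k \<in> \<Theta> - {\<theta>}" and tl: "t \<longlonglongrightarrow> \<theta>" for t :: "nat \<Rightarrow> real"
  proof -
    obtain n p K B where p: "2 < p" and Bm: "\<And>k. n \<le> k \<Longrightarrow> B k \<in> borel_measurable N"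
      and B0: "\<And>k z. n \<le> k \<Longrightarrow> z \<in> space N \<Longrightarrow> 0 \<le> B k z"
      and BS: "\<And>k z. n \<le> k \<Longrightarrow> z \<in> space N \<Longrightarrow> \<bar>S (t k) z - S \<theta> z\<bar> \<le> \<bar>t k - \<theta>\<bar> * B k z"
      and Bp: "\<And>k. n \<le> k \<Longrightarrow> integrable (P (t k)) (\<lambda>z. B k z powr p)" "\<And>k. n \<le> k \<Longrightarrow> (\<integral>z. B k z powr p \<partial>P (t k)) \<le> K"
      by (rule expansion_sequence[OF th t tl]) (rule that, assumption+)
    define u where "u k = t (k + n)" for k
    define V where "V k = slope \<theta> (u k)" for k
    have u: "u k \<in> \<Theta>" "u k \<noteq> \<theta>" for k using t[of "k+n"] by (auto simp: u_def)
    have ul: "u \<longlonglongrightarrow> \<theta>" unfolding u_def by (rule LIMSEQ_ignore_initial_segment[OF tl])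
    have Vm [measurable]: "V k \<in> borel_measurable N" for k unfolding V_def by (rule slope_meas[OF th u(1)])
    have fm [measurable]: "f (u k) \<in> borel_measurable N" "f \<theta> \<in> borel_measurable N" for k by (rule f_meas[OF u(1)], rule f_meas[OF th])
    have Hm [measurable]: "H \<theta> \<in> borel_measurable N" by (rule H_meas[OF th])
    have VB: "AE z in N. \<bar>V k z\<bar> \<le> B (k + n) z" for k
      using S0
    proof (rule AE_mp, intro AE_I2 impI)
      fix z assume z: "z \<in> space N" "S \<theta> z = 0"
      have "\<bar>S (u k) z\<bar> \<le> \<bar>u k - \<theta>\<bar> * B (k + n) z" using BS[of "k + n" z] z by (simp add: u_def)
      then show "\<bar>V k z\<bar> \<le> B (k + n) z" using u(2)[of k] by (simp add: V_def slope_def abs_divide divide_le_eq mult.commute)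
    qed
    have Vlim: "AE z in N. (\<lambda>k. V k z) \<longlonglongrightarrow> H \<theta> z"
      using S0
    proof (rule AE_mp, intro AE_I2 impI)
      fix z assume z: "z \<in> space N" "S \<theta> z = 0"
      from continuous_within_tendsto_compose'[OF slope_continuous[OF th z] u(1) ul]
      show "(\<lambda>k. V k z) \<longlonglongrightarrow> H \<theta> z" by (simp add: V_def slope_def)
    qed
    have flim: "AE z in N. (\<lambda>k. f (u k) z) \<longlonglongrightarrow> f \<theta> z"
      by (intro AE_I2 continuous_within_tendsto_compose'[OF f_continuous(1)[OF th] u(1) ul])
    have fnn: "AE z in N. 0 \<le> f (u k) z" for k by (rule AE_f[OF u(1)])
    have Vp: "integrable (P (u k)) (\<lambda>z. \<bar>V k z\<bar> powr p)" "(\<integral>z. \<bar>V k z\<bar> powr p \<partial>P (u k)) \<le> K" for k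
    proof -
      have Bi: "integrable (P (u k)) (\<lambda>z. B (k + n) z powr p)" "(\<integral>z. B (k + n) z powr p \<partial>P (u k)) \<le> K"
        using Bp[of "k + n"] by (auto simp: u_def)
      have pw: "AE z in P (u k). \<bar>V k z\<bar> powr p \<le> B (k + n) z powr p"
        unfolding AE_P_iff[OF u(1)] using VB[of k] by eventually_elim (use p in \<open>auto intro!: powr_mono2\<close>)
      show i: "integrable (P (u k)) (\<lambda>z. \<bar>V k z\<bar> powr p)"
        by (rule Bochner_Integration.integrable_bound[OF Bi(1)]) (use pw in \<open>auto elim: eventually_mono\<close>)
      from integral_mono_AE[OF i Bi(1) pw] Bi(2) show "(\<integral>z. \<bar>V k z\<bar> powr p \<partial>P (u k)) \<le> K" by simp
    qed
    have V2: "integrable (P (u k)) (\<lambda>z. (V k z)\<^sup>2)" "(\<integral>z. (V k z)\<^sup>2 \<partial>P (u k)) \<le> 1 + K" for k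
      using moment_le(1,2)[OF f_prob[OF u(1)] _ _ _ Vp[of k]] p by auto
    have VN: "integrable N (\<lambda>z. f (u k) z * (V k z)\<^sup>2)" "(\<integral>z. f (u k) z * (V k z)\<^sup>2 \<partial>N) \<le> 1 + K"
        "integrable N (\<lambda>z. f (u k) z * \<bar>V k z\<bar> powr p)" "(\<integral>z. f (u k) z * \<bar>V k z\<bar> powr p \<partial>N) \<le> K" for k
      using V2[of k] Vp[of k] by (simp_all add: int_P[OF u(1)])
    have fnn2: "AE z in N. 0 \<le> f (u k) z * (V k z)\<^sup>2" for k using fnn[of k] by eventually_elim simp
    have fnnp: "AE z in N. 0 \<le> f (u k) z * \<bar>V k z\<bar> powr p" for k using fnn[of k] by eventually_elim simp
    have lim2: "AE z in N. (\<lambda>k. f (u k) z * (V k z)\<^sup>2) \<longlonglongrightarrow> f \<theta> z * (H \<theta> z)\<^sup>2"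
      using flim Vlim by eventually_elim (intro tendsto_intros)
    have H2: "integrable N (\<lambda>z. f \<theta> z * (H \<theta> z)\<^sup>2)"
      by (rule integrable_limit_bounded(1)[OF VN(1) _ fnn2 lim2 VN(2)]) measurable
    have limp: "AE z in N. (\<lambda>k. f (u k) z * \<bar>V k z\<bar> powr p) \<longlonglongrightarrow> f \<theta> z * \<bar>H \<theta> z\<bar> powr p"
      using flim Vlim by eventually_elim (use p in \<open>intro tendsto_intros tendsto_powr2; auto\<close>)
    have Hp: "integrable N (\<lambda>z. f \<theta> z * \<bar>H \<theta> z\<bar> powr p)" "(\<integral>z. f \<theta> z * \<bar>H \<theta> z\<bar> powr p \<partial>N) \<le> K"
      by (rule integrable_limit_bounded[OF VN(3) _ fnnp limp VN(4)]; measurable)+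
    \<comment> \<open>Capping the squares at \<open>c\<^sup>2\<close> loses at most
      \<open>c powr (2 - p) * K\<close>. The bound is stated for arbitrary \<open>g\<close> and
      \<open>v\<close> because the loss must be controlled both along the sequence and for the
      limit.\<close>
    have tail: "(\<integral>z. g z * (v z)\<^sup>2 \<partial>N) - (\<integral>z. g z * min ((v z)\<^sup>2) (c\<^sup>2) \<partial>N) \<le> c powr (2 - p) * K"
        "(\<integral>z. g z * min ((v z)\<^sup>2) (c\<^sup>2) \<partial>N) \<le> (\<integral>z. g z * (v z)\<^sup>2 \<partial>N)"
      if c: "0 < c" and [measurable]: "g \<in> borel_measurable N" "v \<in> borel_measurable N" and g: "AE z in N. 0 \<le> g z"
        and i: "integrable N (\<lambda>z. g z * (v z)\<^sup>2)" "integrable N (\<lambda>z. g z * \<bar>v z\<bar> powr p)" "(\<integral>z. g z * \<bar>v z\<bar> powr p \<partial>N) \<le> K"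
      for c and g v :: "'a \<Rightarrow> real"
    proof -
      have im: "integrable N (\<lambda>z. g z * min ((v z)\<^sup>2) (c\<^sup>2))"
        by (rule Bochner_Integration.integrable_bound[OF i(1)]) (auto simp: abs_mult intro!: AE_I2 mult_left_mono)
      show "(\<integral>z. g z * min ((v z)\<^sup>2) (c\<^sup>2) \<partial>N) \<le> (\<integral>z. g z * (v z)\<^sup>2 \<partial>N)"
        by (rule integral_mono_AE[OF im i(1)]) (use g in eventually_elim, auto intro!: mult_left_mono)
      have "(\<integral>z. g z * (v z)\<^sup>2 \<partial>N) - (\<integral>z. g z * min ((v z)\<^sup>2) (c\<^sup>2) \<partial>N) = (\<integral>z. g z * (v z)\<^sup>2 - g z * min ((v z)\<^sup>2) (c\<^sup>2) \<partial>N)"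
        using i(1) im by simp
      also have "\<dots> \<le> (\<integral>z. c powr (2-p) * (g z * \<bar>v z\<bar> powr p) \<partial>N)"
      proof (rule integral_mono_AE)
        show "AE z in N. g z * (v z)\<^sup>2 - g z * min ((v z)\<^sup>2) (c\<^sup>2) \<le> c powr (2-p) * (g z * \<bar>v z\<bar> powr p)"
          using g
        proof eventually_elim
          case (elim z)
          have "g z * ((v z)\<^sup>2 - min ((v z)\<^sup>2) (c\<^sup>2)) \<le> g z * (c powr (2 - p) * \<bar>v z\<bar> powr p)"
            by (intro mult_left_mono sq_minus_min_le) (use p c elim in auto)
          then show ?case by (simp add: algebra_simps)
        qed
      qed (use i im in auto)
      also have "\<dots> \<le> c powr (2-p) * K" using i(3) by (simp add: mult_left_mono)
      finally show "(\<integral>z. g z * (v z)\<^sup>2 \<partial>N) - (\<integral>z. g z * min ((v z)\<^sup>2) (c\<^sup>2) \<partial>N) \<le> c powr (2 - p) * K" .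
    qed
    \<comment> \<open>The majorants vary with the density but all have integral
      \<open>c\<^sup>2\<close>, so their integrals converge trivially and the generalized dominated
      convergence theorem applies.\<close>
    have trunc: "(\<lambda>k. \<integral>z. f (u k) z * min ((V k z)\<^sup>2) (c\<^sup>2) \<partial>N) \<longlonglongrightarrow> (\<integral>z. f \<theta> z * min ((H \<theta> z)\<^sup>2) (c\<^sup>2) \<partial>N)" for c
    proof (rule Pratt(2)[where G="\<lambda>k z. f (u k) z * c\<^sup>2" and G'="\<lambda>z. f \<theta> z * c\<^sup>2"])
      show "AE z in N. (\<lambda>k. f (u k) z * min ((V k z)\<^sup>2) (c\<^sup>2)) \<longlonglongrightarrow> f \<theta> z * min ((H \<theta> z)\<^sup>2) (c\<^sup>2)"
        using flim Vlim by eventually_elim (intro tendsto_intros)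
      show "AE z in N. (\<lambda>k. f (u k) z * c\<^sup>2) \<longlonglongrightarrow> f \<theta> z * c\<^sup>2"
        using flim by eventually_elim (intro tendsto_intros)
      show "AE z in N. \<bar>f (u k) z * min ((V k z)\<^sup>2) (c\<^sup>2)\<bar> \<le> f (u k) z * c\<^sup>2" for k
        using fnn[of k] by eventually_elim (auto simp: abs_mult intro!: mult_left_mono)
    qed (use f_1[OF u(1)] f_1[OF th] in auto)
    have lim: "(\<lambda>k. \<integral>z. f (u k) z * (V k z)\<^sup>2 \<partial>N) \<longlonglongrightarrow> (\<integral>z. f \<theta> z * (H \<theta> z)\<^sup>2 \<partial>N)"
    proof (rule LIMSEQ_I)
      fix e :: real assume e: "e > 0"
      have "((\<lambda>c. c powr (2 - p) * K) \<longlongrightarrow> 0 * K) at_top"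
        by (intro tendsto_intros tendsto_neg_powr filterlim_ident) (use p in auto)
      then have "\<forall>\<^sub>F c in at_top. c powr (2 - p) * K < e / 3" using e by (intro order_tendstoD(2)) auto
      then obtain c where c: "c > 0" "c powr (2 - p) * K < e / 3"
        using eventually_happens'[OF _ eventually_conj[OF _ eventually_gt_at_top[of 0]]] trivial_limit_at_top_linorder by blast
      obtain m where m: "\<And>k. k \<ge> m \<Longrightarrow> norm ((\<integral>z. f (u k) z * min ((V k z)\<^sup>2) (c\<^sup>2) \<partial>N) - (\<integral>z. f \<theta> z * min ((H \<theta> z)\<^sup>2) (c\<^sup>2) \<partial>N)) < e / 3"
        using LIMSEQ_D[OF trunc[of c], of "e/3"] e by auto
      have "norm ((\<integral>z. f (u k) z * (V k z)\<^sup>2 \<partial>N) - (\<integral>z. f \<theta> z * (H \<theta> z)\<^sup>2 \<partial>N)) < e" if "k \<ge> m" for k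
        using m[OF that] tail[OF c(1) fm(1) Vm fnn VN(1,3,4), of k] tail[OF c(1) fm(2) Hm AE_f[OF th] H2 Hp] c(2)
        unfolding real_norm_def by linarith
      then show "\<exists>m. \<forall>k\<ge>m. norm ((\<integral>z. f (u k) z * (V k z)\<^sup>2 \<partial>N) - (\<integral>z. f \<theta> z * (H \<theta> z)\<^sup>2 \<partial>N)) < e" by blast
    qed
    \<comment> \<open>A number is at most one plus its square in absolute value; the integrals of
      the resulting majorants converge by the limit of the second moments just obtained.\<close>
    have mean: "(\<lambda>k. \<integral>z. f (u k) z * V k z \<partial>N) \<longlonglongrightarrow> (\<integral>z. f \<theta> z * H \<theta> z \<partial>N)"
    proof (rule Pratt(2)[where G="\<lambda>k z. f (u k) z + f (u k) z * (V k z)\<^sup>2" and G'="\<lambda>z. f \<theta> z + f \<theta> z * (H \<theta> z)\<^sup>2"])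
      show "AE z in N. (\<lambda>k. f (u k) z * V k z) \<longlonglongrightarrow> f \<theta> z * H \<theta> z"
        using flim Vlim by eventually_elim (intro tendsto_intros)
      show "AE z in N. (\<lambda>k. f (u k) z + f (u k) z * (V k z)\<^sup>2) \<longlonglongrightarrow> f \<theta> z + f \<theta> z * (H \<theta> z)\<^sup>2"
        using flim lim2 by eventually_elim (rule tendsto_add)
      show "AE z in N. \<bar>f (u k) z * V k z\<bar> \<le> f (u k) z + f (u k) z * (V k z)\<^sup>2" for k
        using fnn[of k]
      proof eventually_elim
        case (elim z)
        from mult_left_mono[OF abs_le_one_plus_sq elim, of "V k z"] elim show ?case
          by (simp add: abs_mult distrib_left)
      qed
      have e: "(\<integral>z. f (u k) z + f (u k) z * (V k z)\<^sup>2 \<partial>N) = 1 + (\<integral>z. f (u k) z * (V k z)\<^sup>2 \<partial>N)"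
        "(\<integral>z. f \<theta> z + f \<theta> z * (H \<theta> z)\<^sup>2 \<partial>N) = 1 + (\<integral>z. f \<theta> z * (H \<theta> z)\<^sup>2 \<partial>N)" for k
        using f_1[OF u(1)] VN(1)[of k] f_1[OF th] H2 by simp_all
      show "(\<lambda>k. \<integral>z. f (u k) z + f (u k) z * (V k z)\<^sup>2 \<partial>N) \<longlonglongrightarrow> (\<integral>z. f \<theta> z + f \<theta> z * (H \<theta> z)\<^sup>2 \<partial>N)"
        unfolding e by (intro tendsto_intros lim)
    qed (use f_1[OF u(1)] f_1[OF th] VN(1) H2 in auto)
    have "(\<integral>z. f (u k) z * V k z \<partial>N) = 0" for k
    proof -
      have "(\<integral>z. f (u k) z * V k z \<partial>N) = (\<integral>z. V k z \<partial>P (u k))" by (simp add: int_P[OF u(1)])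
      also have "\<dots> = (\<integral>z. S (u k) z / (u k - \<theta>) \<partial>P (u k))" using u(2)[of k] by (simp add: V_def slope_def)
      also have "\<dots> = 0" using score_mean[OF u(1)[of k]] by simp
      finally show ?thesis .
    qed
    with mean have "(\<integral>z. f \<theta> z * H \<theta> z \<partial>N) = 0" by (simp add: LIMSEQ_const_iff)
    then have 1: "(\<integral>z. H \<theta> z \<partial>P \<theta>) = 0" by (simp add: int_P[OF th])
    have 2: "integrable (P \<theta>) (\<lambda>z. (H \<theta> z)\<^sup>2)" using H2 by (simp add: int_P[OF th])
    have "(\<lambda>k. \<integral>z. (slope \<theta> (u k) z)\<^sup>2 \<partial>P (u k)) \<longlonglongrightarrow> (\<integral>z. (H \<theta> z)\<^sup>2 \<partial>P \<theta>)"
      using lim unfolding V_def[symmetric] by (simp add: int_P[OF th] int_P[OF u(1)])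
    then have "(\<lambda>k. \<integral>z. (slope \<theta> (t k) z)\<^sup>2 \<partial>P (t k)) \<longlonglongrightarrow> (\<integral>z. (H \<theta> z)\<^sup>2 \<partial>P \<theta>)"
      unfolding u_def by (rule LIMSEQ_offset)
    with 1 2 show ?thesis by blast
  qed
  obtain t where "\<And>k. t k \<in> \<Theta> - {\<theta>}" "t \<longlonglongrightarrow> \<theta>"
    using limpt[OF th] unfolding islimpt_sequential by blast
  from H2[OF this] show "integrable (P \<theta>) (\<lambda>z. (H \<theta> z)\<^sup>2)" "(\<integral>z. H \<theta> z \<partial>P \<theta>) = 0" by auto
  have "slope \<theta> \<theta> = H \<theta>" by (auto simp: slope_def)
  with H2 show "continuous (at \<theta> within \<Theta>) (\<lambda>t. \<integral>z. (slope \<theta> t z)\<^sup>2 \<partial>P t)"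
    unfolding continuous_within tendsto_at_iff_sequentially by (auto simp: comp_def)
qed

end

section \<open>Coverage along convergent parameter sequences\<close>

lemma
  fixes V :: "'a \<Rightarrow> real"
  assumes M: "prob_space M" and V [measurable]: "V \<in> borel_measurable M"
    and sq: "integrable M (\<lambda>x. (V x)\<^sup>2)" and mean: "(\<integral>x. V x \<partial>M) = 0"
  shows PiM_sum_mean: "(\<integral>y. (\<Sum>i=1..n. V (y i)) \<partial>(\<Pi>\<^sub>M i\<in>{1..n::nat}. M)) = 0"
    and PiM_sum_square: "(\<integral>y. (\<Sum>i=1..n. V (y i))\<^sup>2 \<partial>(\<Pi>\<^sub>M i\<in>{1..n::nat}. M)) = n * (\<integral>x. (V x)\<^sup>2 \<partial>M)"
proof -
  interpret prob_space M by fact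
  interpret Q: product_prob_space "\<lambda>_::nat. M" "{1..n}" by unfold_locales
  let ?Q = "\<Pi>\<^sub>M i\<in>{1..n}. M"
  have Vi: "integrable M V" by (rule square_integrable_imp_integrable[OF V sq])
  have comp: "integrable ?Q (\<lambda>y. g (y i))" "(\<integral>y. g (y i) \<partial>?Q) = (\<integral>x. g x \<partial>M)"
    if i: "i \<in> {1..n}" and g: "integrable M g" for i and g :: "'a \<Rightarrow> real"
  proof -
    have [measurable]: "g \<in> borel_measurable M" using g by auto
    have d: "distr ?Q M (\<lambda>y. y i) = M" by (rule distr_PiM_component) (use i prob_space_axioms in auto)
    have "integrable (distr ?Q M (\<lambda>y. y i)) g" using d g by simp
    then show "integrable ?Q (\<lambda>y. g (y i))" using i by (subst (asm) integrable_distr_eq) auto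
    have "(\<integral>x. g x \<partial>distr ?Q M (\<lambda>y. y i)) = (\<integral>y. g (y i) \<partial>?Q)" by (rule integral_distr) (use i in auto)
    then show "(\<integral>y. g (y i) \<partial>?Q) = (\<integral>x. g x \<partial>M)" using d by simp
  qed
  show "(\<integral>y. (\<Sum>i=1..n. V (y i)) \<partial>?Q) = 0" using comp[OF _ Vi] mean by simp
  have prod: "integrable ?Q (\<lambda>y. V (y i) * V (y j))" "(\<integral>y. V (y i) * V (y j) \<partial>?Q) = 0"
    if ij: "i \<in> {1..n}" "j \<in> {1..n}" "i \<noteq> j" for i j
  proof -
    \<comment> \<open>Factors one at the other coordinates turn the product of two coordinates into
      a product over all of them, to which independence applies.\<close>
    let ?g = "\<lambda>k x. if k \<in> {i, j} then V x else 1"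
    have eq: "V (y i) * V (y j) = (\<Prod>k\<in>{1..n}. ?g k (y k))" for y
    proof -
      have "(\<Prod>k\<in>{1..n}. ?g k (y k)) = (\<Prod>k\<in>{1..n} \<inter> {i, j}. V (y k))" by (rule prod.inter_restrict[symmetric]) simp
      also have "{1..n} \<inter> {i, j} = {i, j}" using ij by auto
      finally show ?thesis using ij by simp
    qed
    have gi: "integrable M (?g k)" for k using Vi by (cases "k \<in> {i,j}") auto
    show "integrable ?Q (\<lambda>y. V (y i) * V (y j))" unfolding eq by (rule Q.product_integrable_prod) (use gi in auto)
    have "(\<integral>y. V (y i) * V (y j) \<partial>?Q) = (\<Prod>k\<in>{1..n}. \<integral>x. ?g k x \<partial>M)"
      unfolding eq by (rule Q.product_integral_prod) (use gi in auto)
    also have "\<dots> = 0" by (rule prod_zero) (use ij mean in \<open>auto intro!: bexI[of _ i]\<close>)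
    finally show "(\<integral>y. V (y i) * V (y j) \<partial>?Q) = 0" .
  qed
  have all: "integrable ?Q (\<lambda>y. V (y i) * V (y j))" if "i \<in> {1..n}" "j \<in> {1..n}" for i j
    using prod(1)[OF that] comp(1)[OF that(1) sq] by (cases "i = j") (auto simp: power2_eq_square)
  have "(\<integral>y. (\<Sum>i=1..n. V (y i))\<^sup>2 \<partial>?Q) = (\<integral>y. (\<Sum>i=1..n. \<Sum>j=1..n. V (y i) * V (y j)) \<partial>?Q)"
    by (simp add: power2_eq_square sum_product)
  also have "\<dots> = (\<Sum>i=1..n. \<Sum>j=1..n. \<integral>y. V (y i) * V (y j) \<partial>?Q)"
    by (subst Bochner_Integration.integral_sum; (intro Bochner_Integration.integrable_sum)?; (intro sum.cong refl Bochner_Integration.integral_sum)?; use all in simp)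
  also have "\<dots> = (\<Sum>i=1..n. \<Sum>j=1..n. if i = j then (\<integral>x. (V x)\<^sup>2 \<partial>M) else 0)"
    by (intro sum.cong refl) (use prod(2) comp(2)[OF _ sq] in \<open>auto simp: power2_eq_square\<close>)
  also have "\<dots> = n * (\<integral>x. (V x)\<^sup>2 \<partial>M)" by simp
  finally show "(\<integral>y. (\<Sum>i=1..n. V (y i))\<^sup>2 \<partial>?Q) = n * (\<integral>x. (V x)\<^sup>2 \<partial>M)" .
qed

text \<open>At a critical point \<open>H\<close> has mean zero, so the second moment required to be
  positive is its variance.\<close>

locale nondegenerate_family = smooth_family +
  assumes hess_pos: "\<And>\<theta>. \<theta> \<in> \<Theta> \<Longrightarrow> (\<integral>z. (S \<theta> z)\<^sup>2 \<partial>P \<theta>) = 0 \<Longrightarrow> 0 < (\<integral>z. (H \<theta> z)\<^sup>2 \<partial>P \<theta>)"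
begin

text \<open>Near \<open>\<theta>\<close> this is proportional to the (modified) score, with a factor that depends on \<open>t\<close> only,
  and it does not degenerate as \<open>t\<close> tends to \<open>\<theta>\<close>.\<close>

definition rescaled where
  "rescaled \<theta> t z = (if (\<integral>z. (S \<theta> z)\<^sup>2 \<partial>P \<theta>) = 0 then slope \<theta> t z else S t z)"

definition info where
  "info \<theta> t = (\<integral>z. (rescaled \<theta> t z)\<^sup>2 \<partial>P t)"

lemma rescaled_meas [measurable]: "\<theta> \<in> \<Theta> \<Longrightarrow> t \<in> \<Theta> \<Longrightarrow> rescaled \<theta> t \<in> borel_measurable N"
  unfolding rescaled_def[abs_def] by auto

lemma rescaled_continuous:
  assumes th: "\<theta> \<in> \<Theta>"
  shows "AE z in N. continuous (at \<theta> within \<Theta>) (\<lambda>t. rescaled \<theta> t z)"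
proof (cases "(\<integral>z. (S \<theta> z)\<^sup>2 \<partial>P \<theta>) = 0")
  case True
  from critical_score_zero[OF th True] show ?thesis
    by (rule AE_mp) (auto intro!: AE_I2 slope_continuous th simp: rescaled_def True)
next
  case False
  then show ?thesis by (auto intro!: AE_I2 f_continuous th simp: rescaled_def)
qed

lemma
  assumes th: "\<theta> \<in> \<Theta>" and t: "t \<in> \<Theta>"
  shows rescaled_square: "integrable (P t) (\<lambda>z. (rescaled \<theta> t z)\<^sup>2)"
    and rescaled_mean: "(\<integral>z. rescaled \<theta> t z \<partial>P t) = 0"
proof -
  have "integrable (P t) (\<lambda>z. (rescaled \<theta> t z)\<^sup>2) \<and> (\<integral>z. rescaled \<theta> t z \<partial>P t) = 0"
  proof (cases "(\<integral>z. (S \<theta> z)\<^sup>2 \<partial>P \<theta>) = 0")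
    case True
    show ?thesis
    proof (cases "t = \<theta>")
      case eq: True
      show ?thesis using critical_slope(1,2)[OF th True] by (simp add: rescaled_def True slope_def eq)
    next
      case False
      then show ?thesis using score_square[OF t] score_mean[OF t] by (simp add: rescaled_def True slope_def power_divide)
    qed
  next
    case False
    then show ?thesis using score_square[OF t] score_mean[OF t] by (simp add: rescaled_def)
  qed
  then show "integrable (P t) (\<lambda>z. (rescaled \<theta> t z)\<^sup>2)" "(\<integral>z. rescaled \<theta> t z \<partial>P t) = 0" by auto
qed

lemma
  assumes th: "\<theta> \<in> \<Theta>"
  shows info_pos: "0 < info \<theta> \<theta>" and info_continuous: "continuous (at \<theta> within \<Theta>) (info \<theta>)"
proof -
  have nn: "0 \<le> (\<integral>z. (S \<theta> z)\<^sup>2 \<partial>P \<theta>)" by (rule integral_nonneg_AE) simp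
  have "slope \<theta> \<theta> = H \<theta>" by (auto simp: slope_def)
  then show "0 < info \<theta> \<theta>"
    using order.not_eq_order_implies_strict[OF _ nn] hess_pos[OF th]
    by (cases "(\<integral>z. (S \<theta> z)\<^sup>2 \<partial>P \<theta>) = 0") (auto simp: info_def rescaled_def)
  show "continuous (at \<theta> within \<Theta>) (info \<theta>)"
    using critical_slope(3)[OF th] Fisher_continuous[OF th]
    by (cases "(\<integral>z. (S \<theta> z)\<^sup>2 \<partial>P \<theta>) = 0") (simp_all add: info_def[abs_def] rescaled_def)
qed

lemma coverage:
  fixes t :: "nat \<Rightarrow> real" and n :: "nat \<Rightarrow> nat"
  assumes th: "\<theta> \<in> \<Theta>" and t: "\<And>k. t k \<in> \<Theta>" "t \<longlonglongrightarrow> \<theta>" and n: "filterlim n at_top sequentially"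
    and \<alpha>: "0 < \<alpha>" "\<alpha> < 1"
  shows "(\<lambda>k. measure (\<Pi>\<^sub>M i\<in>{1..n k}. P (t k)) {y \<in> space (\<Pi>\<^sub>M i\<in>{1..n k}. P (t k)).
      (\<Sum>i=1..n k. rescaled \<theta> (t k) (y i))\<^sup>2 / (n k * info \<theta> (t k)) \<le> quantile (chi_square 1) (1 - \<alpha>)}) \<longlonglongrightarrow> 1 - \<alpha>"
    (is "?C \<longlonglongrightarrow> _")
proof -
  let ?q = "quantile (chi_square 1) (1 - \<alpha>)"
  have il: "(\<lambda>k. info \<theta> (t k)) \<longlonglongrightarrow> info \<theta> \<theta>" by (rule continuous_within_tendsto_compose'[OF info_continuous[OF th] t])
  then have "\<forall>\<^sub>F k in sequentially. 0 < info \<theta> (t k)" by (rule order_tendstoD) (rule info_pos[OF th])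
  \<comment> \<open>The central limit theorem asks for positive variances in every row, so the
    sequence is started where \<open>info\<close> has become positive.\<close>
  then obtain m where m: "\<And>k. m \<le> k \<Longrightarrow> 0 < info \<theta> (t k)" by (auto simp: eventually_sequentially)
  define u where "u k = t (k + m)" for k
  define n' where "n' k = n (k + m)" for k
  have u: "u k \<in> \<Theta>" for k using t by (simp add: u_def)
  have ul: "u \<longlonglongrightarrow> \<theta>" unfolding u_def by (rule LIMSEQ_ignore_initial_segment[OF t(2)])
  have n': "filterlim n' at_top sequentially"
    unfolding n'_def by (rule filterlim_compose[OF n]) (simp add: filterlim_add_const_nat_at_top)
  have n'r: "filterlim (\<lambda>k. real (n' k)) at_top sequentially"
    using n' filterlim_compose[OF filterlim_real_sequentially] by blast
  define V where "V k = rescaled \<theta> (u k)" for k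
  have Vm [measurable]: "V k \<in> borel_measurable N" for k unfolding V_def by (rule rescaled_meas[OF th u])
  have Rm [measurable]: "rescaled \<theta> \<theta> \<in> borel_measurable N" by (rule rescaled_meas[OF th th])
  have fm [measurable]: "f (u k) \<in> borel_measurable N" "f \<theta> \<in> borel_measurable N" for k by (rule f_meas[OF u], rule f_meas[OF th])
  have Vlim: "AE z in N. (\<lambda>k. V k z) \<longlonglongrightarrow> rescaled \<theta> \<theta> z"
    using rescaled_continuous[OF th]
    by eventually_elim (auto simp: V_def intro!: continuous_within_tendsto_compose'[OF _ u ul])
  have flim: "AE z in N. (\<lambda>k. f (u k) z) \<longlonglongrightarrow> f \<theta> z"
    by (intro AE_I2 continuous_within_tendsto_compose'[OF f_continuous(1)[OF th] u ul])
  have fnn: "AE z in N. 0 \<le> f (u k) z" for k by (rule AE_f[OF u])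
  have V2: "integrable (P (u k)) (\<lambda>z. (V k z)\<^sup>2)" for k unfolding V_def by (rule rescaled_square[OF th u])
  have vlim: "(\<lambda>k. info \<theta> (u k)) \<longlonglongrightarrow> info \<theta> \<theta>" unfolding u_def by (rule LIMSEQ_ignore_initial_segment[OF il])
  have info: "info \<theta> (u k) = (\<integral>z. f (u k) z * (V k z)\<^sup>2 \<partial>N)" "info \<theta> \<theta> = (\<integral>z. f \<theta> z * (rescaled \<theta> \<theta> z)\<^sup>2 \<partial>N)" for k
    unfolding info_def V_def[symmetric] by (rule int_P[OF u] int_P[OF th]; measurable)+
  have wc: "weak_conv_m (\<lambda>k. distr (\<Pi>\<^sub>M i\<in>{1..n' k}. P (u k)) borel (\<lambda>y. (\<Sum>i=1..n' k. V k (y i)) / sqrt (n' k * info \<theta> (u k)))) std_normal_distribution"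
  proof (rule triangular_clt[where v="\<lambda>k. info \<theta> (u k)" and v'="info \<theta> \<theta>"])
    show "prob_space (P (u k))" for k by (rule f_prob[OF u])
    show "V k \<in> borel_measurable (P (u k))" for k by simp
    show "(\<integral>z. V k z \<partial>P (u k)) = 0" for k unfolding V_def by (rule rescaled_mean[OF th u])
    show "(\<integral>z. (V k z)\<^sup>2 \<partial>P (u k)) = info \<theta> (u k)" for k by (simp add: V_def info_def)
    show "0 < info \<theta> (u k)" for k unfolding u_def by (rule m) simp
    fix e :: real assume e: "e > 0"
    let ?I = "\<lambda>k. indicat_real {z. e * sqrt (real (n' k)) < \<bar>V k z\<bar>}"
    \<comment> \<open>At a fixed \<open>z\<close> the values \<open>V k z\<close> converge while the
      level tends to infinity, so the indicator is eventually zero. The majorant is the full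
      second-moment integrand; convergence of its integrals is continuity of \<open>info\<close> at
      \<open>\<theta>\<close>.\<close>
    have "(\<lambda>k. \<integral>z. f (u k) z * ((V k z)\<^sup>2 * ?I k z) \<partial>N) \<longlonglongrightarrow> (\<integral>z. 0 \<partial>N)"
    proof (rule Pratt(2)[where G="\<lambda>k z. f (u k) z * (V k z)\<^sup>2" and G'="\<lambda>z. f \<theta> z * (rescaled \<theta> \<theta> z)\<^sup>2"])
      show "AE z in N. (\<lambda>k. f (u k) z * ((V k z)\<^sup>2 * ?I k z)) \<longlonglongrightarrow> 0"
        using Vlim
      proof eventually_elim
        case (elim z)
        have "filterlim (\<lambda>k. e * sqrt (real (n' k))) at_top sequentially"
          by (rule filterlim_tendsto_pos_mult_at_top[OF tendsto_const e filterlim_compose[OF sqrt_at_top n'r]])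
        then have "\<forall>\<^sub>F k in sequentially. \<bar>rescaled \<theta> \<theta> z\<bar> + 1 < e * sqrt (real (n' k))"
          unfolding filterlim_at_top_dense by blast
        moreover have "\<forall>\<^sub>F k in sequentially. \<bar>V k z\<bar> < \<bar>rescaled \<theta> \<theta> z\<bar> + 1"
          by (rule order_tendstoD(2)[OF tendsto_rabs[OF elim]]) simp
        ultimately have "\<forall>\<^sub>F k in sequentially. f (u k) z * ((V k z)\<^sup>2 * ?I k z) = 0"
          by eventually_elim (simp add: indicator_def)
        then show ?case by (rule tendsto_eventually)
      qed
      show "AE z in N. (\<lambda>k. f (u k) z * (V k z)\<^sup>2) \<longlonglongrightarrow> f \<theta> z * (rescaled \<theta> \<theta> z)\<^sup>2"
        using Vlim flim by eventually_elim (intro tendsto_intros)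
      show "AE z in N. \<bar>f (u k) z * ((V k z)\<^sup>2 * ?I k z)\<bar> \<le> f (u k) z * (V k z)\<^sup>2" for k
        using fnn[of k] by eventually_elim (auto simp: indicator_def)
      show "integrable N (\<lambda>z. f (u k) z * (V k z)\<^sup>2)" for k using V2[of k] by (simp add: int_P[OF u])
      show "integrable N (\<lambda>z. f \<theta> z * (rescaled \<theta> \<theta> z)\<^sup>2)" using rescaled_square[OF th th] by (simp add: int_P[OF th])
      show "(\<lambda>k. \<integral>z. f (u k) z * (V k z)\<^sup>2 \<partial>N) \<longlonglongrightarrow> (\<integral>z. f \<theta> z * (rescaled \<theta> \<theta> z)\<^sup>2 \<partial>N)"
        using vlim unfolding info .
    qed measurable
    then show "(\<lambda>k. \<integral>z. (V k z)\<^sup>2 * ?I k z \<partial>P (u k)) \<longlonglongrightarrow> 0" by (simp add: int_P[OF u])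
  qed (use V2 vlim info_pos[OF th] n' in auto)
  have "(\<lambda>k. measure (distr (\<Pi>\<^sub>M i\<in>{1..n' k}. P (u k)) borel (\<lambda>y. (\<Sum>i=1..n' k. V k (y i)) / sqrt (n' k * info \<theta> (u k)))) {z. z\<^sup>2 \<le> ?q})
      \<longlonglongrightarrow> measure std_normal_distribution {z. z\<^sup>2 \<le> ?q}"
  proof (rule weak_conv_imp_continuity_set_conv[OF _ real_dist_normal_dist wc])
    show "real_distribution (distr (\<Pi>\<^sub>M i\<in>{1..n' k}. P (u k)) borel (\<lambda>y. (\<Sum>i=1..n' k. V k (y i)) / sqrt (n' k * info \<theta> (u k))))" for k
    proof -
      interpret prob_space "P (u k)" by (rule f_prob[OF u])
      interpret Q: product_prob_space "\<lambda>_::nat. P (u k)" "{1..n' k}" by unfold_locales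
      show ?thesis by (rule Q.real_distribution_distr) measurable
    qed
    show "emeasure std_normal_distribution (frontier {z. z\<^sup>2 \<le> ?q}) = 0" by (rule chi_square_1_quantile(2)[OF \<alpha>])
  qed simp
  moreover have "measure (distr (\<Pi>\<^sub>M i\<in>{1..n' k}. P (u k)) borel (\<lambda>y. (\<Sum>i=1..n' k. V k (y i)) / sqrt (n' k * info \<theta> (u k)))) {z. z\<^sup>2 \<le> ?q} = ?C (k + m)" for k
  proof -
    have "0 < info \<theta> (u k)" unfolding u_def by (rule m) simp
    then have "((\<Sum>i=1..n' k. V k (y i)) / sqrt (n' k * info \<theta> (u k)))\<^sup>2 = (\<Sum>i=1..n' k. V k (y i))\<^sup>2 / (n' k * info \<theta> (u k))" for y
      by (simp add: power_divide)
    moreover have "(\<lambda>y. (\<Sum>i=1..n' k. V k (y i)) / sqrt (n' k * info \<theta> (u k))) \<in> borel_measurable (\<Pi>\<^sub>M i\<in>{1..n' k}. P (u k))"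
      by measurable
    ultimately show ?thesis
      by (subst measure_distr) (auto simp: vimage_def Int_def conj_commute V_def u_def[symmetric] n'_def[symmetric])
  qed
  ultimately have "(\<lambda>k. ?C (k + m)) \<longlonglongrightarrow> 1 - \<alpha>" using chi_square_1_quantile(1)[OF \<alpha>] by simp
  then show ?thesis by (rule LIMSEQ_offset)
qed

end

section \<open>Remainder estimates\<close>

text \<open>Jensen's inequality on the unit interval, by way of Young's inequality for
  \<open>g s\<close> and the power \<open>p - 1\<close> of the mean: after integration the conjugate
  term is the power \<open>p\<close> of the mean divided by \<open>q\<close>, and is absorbed on the
  left. The right-hand side is a nonnegative integral so that Tonelli's theorem can follow.\<close>

lemma powr_integral_le:
  fixes g :: "real \<Rightarrow> real"
  assumes g: "continuous_on {0..1} g" and nn: "\<And>s. s \<in> {0..1} \<Longrightarrow> 0 \<le> g s" and p: "1 < p"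
  shows "ennreal ((\<integral>s. indicator {0..1} s *\<^sub>R g s \<partial>lborel) powr p) \<le> (\<integral>\<^sup>+s. ennreal ((indicator {0..1} s *\<^sub>R g s) powr p) \<partial>lborel)"
proof -
  let ?g = "\<lambda>s. indicator {0..1} s *\<^sub>R g s :: real"
  define A where "A = (\<integral>s. ?g s \<partial>lborel)"
  define q where "q = p / (p - 1)"
  have q: "1 < q" "1 / p + 1 / q = 1" using p by (auto simp: q_def field_simps)
  have gi: "integrable lborel ?g" using borel_integrable_atLeastAtMost'[OF g] by (simp add: set_integrable_def)
  have gp: "integrable lborel (\<lambda>s. ?g s powr p)"
  proof -
    have "continuous_on {0..1} (\<lambda>s. g s powr p)" using g nn p by (intro continuous_on_powr' continuous_intros) auto
    from borel_integrable_atLeastAtMost'[OF this]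
    have "integrable lborel (\<lambda>s. indicator {0..1} s *\<^sub>R (g s powr p))" by (simp add: set_integrable_def)
    moreover have "indicator {0..1} s *\<^sub>R (g s powr p) = ?g s powr p" for s by (simp add: indicator_def)
    ultimately show ?thesis by simp
  qed
  have A0: "0 \<le> A" unfolding A_def by (rule integral_nonneg_AE) (auto simp: indicator_def nn)
  have ind: "integrable lborel (indicat_real {0..1::real})" "(\<integral>s. indicat_real {0..1::real} s \<partial>lborel) = 1"
    by (auto simp: integrable_indicator_iff)
  have Y: "A powr (p - 1) * ?g s \<le> ?g s powr p / p + A powr p / q * indicat_real {0..1} s" for s
  proof (cases "s \<in> {0..1}")
    case True
    have "(A powr (p - 1)) powr q = A powr p" using p by (simp add: powr_powr q_def)
    with Youngs_inequality[OF p q, of "g s" "A powr (p - 1)"] nn[OF True] True show ?thesis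
      by (simp add: mult.commute)
  qed simp
  have "A powr p = A powr (p - 1) * A" using A0 p by (cases "A = 0") (simp_all add: powr_mult_base' powr_diff)
  also have "\<dots> = (\<integral>s. A powr (p - 1) * ?g s \<partial>lborel)" using gi by (simp add: A_def)
  also have "\<dots> \<le> (\<integral>s. ?g s powr p / p + A powr p / q * indicat_real {0..1} s \<partial>lborel)"
    by (rule integral_mono) (use gi gp ind Y in auto)
  also have "\<dots> = (\<integral>s. ?g s powr p \<partial>lborel) / p + A powr p / q" using gp ind by simp
  finally have "A powr p - A powr p / q \<le> (\<integral>s. ?g s powr p \<partial>lborel) / p" by simp
  moreover have "A powr p - A powr p / q = A powr p / p"
  proof -
    have "A powr p * (1 / p + 1 / q) = A powr p" using q by simp
    then show ?thesis by (simp add: distrib_left)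
  qed
  ultimately have "A powr p \<le> (\<integral>s. ?g s powr p \<partial>lborel)" using p by (simp add: divide_le_cancel)
  then have "ennreal (A powr p) \<le> ennreal (\<integral>s. ?g s powr p \<partial>lborel)" by (rule ennreal_leI)
  also have "\<dots> = (\<integral>\<^sup>+s. ennreal (?g s powr p) \<partial>lborel)" by (rule nn_integral_eq_integral[symmetric, OF gp]) simp
  finally show ?thesis by (simp add: A_def)
qed

text \<open>Both remainders are controlled by the same average, which makes its moments the only quantity to estimate.\<close>

lemma second_order_remainder:
  fixes l l' l'' :: "real \<Rightarrow> real"
  assumes d: "\<And>t. t \<in> ball \<theta> r \<Longrightarrow> (l has_real_derivative l' t) (at t)" "\<And>t. t \<in> ball \<theta> r \<Longrightarrow> (l' has_real_derivative l'' t) (at t)"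
    and c: "continuous_on (ball \<theta> r) l''" and t: "t \<in> ball \<theta> r"
  defines "A \<equiv> \<integral>s. indicator {0..1} s *\<^sub>R \<bar>l'' (\<theta> + s * (t - \<theta>))\<bar> \<partial>lborel"
  shows "\<bar>l' t - l' \<theta>\<bar> \<le> \<bar>t - \<theta>\<bar> * A" "\<bar>l t - l \<theta> - (t - \<theta>) * l' \<theta>\<bar> \<le> (t - \<theta>)\<^sup>2 * A" "0 \<le> A"
    "continuous_on {0..1} (\<lambda>s. l'' (\<theta> + s * (t - \<theta>)))"
proof -
  let ?h = "t - \<theta>"
  let ?p = "\<lambda>s. \<theta> + s * ?h"
  have inb: "?p s \<in> ball \<theta> r" if "s \<in> {0..1}" for s
  proof -
    have "\<bar>s * ?h\<bar> \<le> \<bar>?h\<bar>" using that by (simp add: abs_mult mult_left_le_one_le)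
    then show ?thesis using t by (auto simp: dist_real_def)
  qed
  show c': "continuous_on {0..1} (\<lambda>s. l'' (?p s))"
    by (rule continuous_on_compose2[OF c]) (use inb in \<open>auto intro!: continuous_intros\<close>)
  then have ca: "continuous_on {0..1} (\<lambda>s. \<bar>l'' (?p s)\<bar>)" by (intro continuous_intros)
  show A0: "0 \<le> A" unfolding A_def by (rule integral_nonneg_AE) (auto simp: indicator_def)
  have A: "A = integral {0..1} (\<lambda>s. \<bar>l'' (?p s)\<bar>)"
    unfolding A_def using set_borel_integral_eq_integral(2)[OF borel_integrable_atLeastAtMost'[OF ca]]
    by (simp add: set_lebesgue_integral_def)
  have d1: "\<bar>l' (?p s) - l' \<theta>\<bar> \<le> \<bar>?h\<bar> * A" if s: "s \<in> {0..1}" for s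
  proof -
    have sub: "{0..s} \<subseteq> {0..1}" using s by auto
    have hi: "((\<lambda>x. ?h * l'' (?p x)) has_integral (l' (?p s) - l' (?p 0))) {0..s}"
    proof (rule fundamental_theorem_of_calculus)
      fix x assume "x \<in> {0..s}"
      then have "(l' has_real_derivative l'' (?p x)) (at (?p x))" using sub by (intro d(2) inb) auto
      then have "((\<lambda>x. l' (?p x)) has_real_derivative l'' (?p x) * ?h) (at x within {0..s})"
        by (rule DERIV_chain2[THEN has_field_derivative_at_within]) (auto intro!: derivative_eq_intros)
      then show "((\<lambda>x. l' (?p x)) has_vector_derivative ?h * l'' (?p x)) (at x within {0..s})"
        by (simp add: has_real_derivative_iff_has_vector_derivative mult.commute)
    qed (use s in auto)
    have "\<bar>l' (?p s) - l' \<theta>\<bar> = \<bar>integral {0..s} (\<lambda>x. ?h * l'' (?p x))\<bar>"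
      unfolding integral_unique[OF hi] by simp
    also have "\<dots> = \<bar>?h\<bar> * \<bar>integral {0..s} (\<lambda>x. l'' (?p x))\<bar>" by (simp add: abs_mult)
    also have "\<bar>integral {0..s} (\<lambda>x. l'' (?p x))\<bar> \<le> integral {0..s} (\<lambda>x. \<bar>l'' (?p x)\<bar>)"
      using integral_norm_bound_integral[of "\<lambda>x. l'' (?p x)" "{0..s}" "\<lambda>x. \<bar>l'' (?p x)\<bar>"]
      by (simp add: integrable_continuous_real continuous_on_subset[OF c' sub] continuous_on_subset[OF ca sub])
    also have "\<dots> \<le> A" unfolding A
      by (rule integral_subset_le[OF sub]) (auto intro!: integrable_continuous_real continuous_on_subset[OF ca sub] ca)
    finally show ?thesis by (simp add: mult_left_mono)
  qed
  from d1[of 1] show "\<bar>l' t - l' \<theta>\<bar> \<le> \<bar>?h\<bar> * A" by simp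
  \<comment> \<open>Along the segment the linear term is subtracted, so the derivative in
    \<open>s\<close> is \<open>?h\<close> times an increment of \<open>l'\<close>; by the
    first-order bound it is at most \<open>?h\<^sup>2 * A\<close>. The factor one half of the exact
    Taylor remainder is given up.\<close>
  have "norm ((l (?p 1) - 1 * ?h * l' \<theta>) - (l (?p 0) - 0 * ?h * l' \<theta>)) \<le> (\<bar>?h\<bar> * (\<bar>?h\<bar> * A)) * norm (1 - 0 :: real)"
  proof (rule field_differentiable_bound[where S="{0..1}" and f'="\<lambda>s. ?h * (l' (?p s) - l' \<theta>)"])
    fix s :: real assume s: "s \<in> {0..1}"
    have "((\<lambda>x. l (?p x)) has_real_derivative l' (?p s) * ?h) (at s)"
      by (rule DERIV_chain2[where f=l and g="?p", OF d(1)[OF inb[OF s]]]) (auto intro!: derivative_eq_intros)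
    moreover have "((\<lambda>x. x * ?h * l' \<theta>) has_real_derivative ?h * l' \<theta>) (at s)"
      by (auto intro!: derivative_eq_intros)
    ultimately have "((\<lambda>x. l (?p x) - x * ?h * l' \<theta>) has_real_derivative l' (?p s) * ?h - ?h * l' \<theta>) (at s)"
      by (rule DERIV_diff)
    moreover have "l' (?p s) * ?h - ?h * l' \<theta> = ?h * (l' (?p s) - l' \<theta>)" by (simp add: algebra_simps)
    ultimately show "((\<lambda>x. l (?p x) - x * ?h * l' \<theta>) has_real_derivative ?h * (l' (?p s) - l' \<theta>)) (at s within {0..1})"
      by (simp add: has_field_derivative_at_within)
    show "norm (?h * (l' (?p s) - l' \<theta>)) \<le> \<bar>?h\<bar> * (\<bar>?h\<bar> * A)"
      using d1[OF s] by (simp add: abs_mult mult_left_mono)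
  qed auto
  then show "\<bar>l t - l \<theta> - ?h * l' \<theta>\<bar> \<le> ?h\<^sup>2 * A"
  proof -
    assume *: "norm ((l (?p 1) - 1 * ?h * l' \<theta>) - (l (?p 0) - 0 * ?h * l' \<theta>)) \<le> (\<bar>?h\<bar> * (\<bar>?h\<bar> * A)) * norm (1 - 0 :: real)"
    have e1: "\<bar>?h\<bar> * (\<bar>?h\<bar> * A) = ?h\<^sup>2 * A" by (simp only: mult.assoc[symmetric] abs_mult_self_eq power2_eq_square)
    have e2: "(l (?p 1) - 1 * ?h * l' \<theta>) - (l (?p 0) - 0 * ?h * l' \<theta>) = l t - l \<theta> - ?h * l' \<theta>" by simp
    show ?thesis using * unfolding e1 e2 by simp
  qed
qed

lemma scaled_average_tendsto_0:
  fixes l'' :: "real \<Rightarrow> real"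
  assumes c: "continuous_on (ball \<theta> r) l''" and r: "0 < r"
  shows "((\<lambda>t. (t - \<theta>) * (\<integral>s. indicator {0..1} s *\<^sub>R \<bar>l'' (\<theta> + s * (t - \<theta>))\<bar> \<partial>lborel)) \<longlongrightarrow> 0) (at \<theta> within T)"
proof -
  let ?A = "\<lambda>t. \<integral>s. indicator {0..1} s *\<^sub>R \<bar>l'' (\<theta> + s * (t - \<theta>))\<bar> \<partial>lborel"
  have "isCont l'' \<theta>" using c r by (simp add: continuous_on_eq_continuous_at)
  then have "\<forall>\<^sub>F x in nhds \<theta>. \<bar>l'' x\<bar> < \<bar>l'' \<theta>\<bar> + 1"
    by (intro order_tendstoD(2)[OF tendsto_rabs]) (auto simp: isCont_def tendsto_at_iff_tendsto_nhds)
  then obtain e where e: "e > 0" "\<And>x. dist x \<theta> < e \<Longrightarrow> \<bar>l'' x\<bar> < \<bar>l'' \<theta>\<bar> + 1" by (auto simp: eventually_nhds_metric)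
  have A: "\<bar>?A t\<bar> \<le> \<bar>l'' \<theta>\<bar> + 1" if t: "dist t \<theta> < e" for t
  proof -
    have b: "\<bar>l'' (\<theta> + s * (t - \<theta>))\<bar> \<le> \<bar>l'' \<theta>\<bar> + 1" if s: "s \<in> {0..1}" for s
    proof -
      have "\<bar>s * (t - \<theta>)\<bar> \<le> \<bar>t - \<theta>\<bar>" using s by (simp add: abs_mult mult_left_le_one_le)
      then show ?thesis using t by (intro less_imp_le e(2)) (auto simp: dist_real_def)
    qed
    have "0 \<le> ?A t" by (rule integral_nonneg_AE) (auto simp: indicator_def)
    moreover have "?A t \<le> (\<integral>s. (\<bar>l'' \<theta>\<bar> + 1) * indicat_real {0..1::real} s \<partial>lborel)"
    \<comment> \<open>The radius \<open>e\<close> may exceed \<open>r\<close>, so the segment can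
      leave the ball on which \<open>l''\<close> is continuous; if the integral fails to exist
      there, its default value zero still obeys the bound.\<close>
    proof (cases "integrable lborel (\<lambda>s. indicator {0..1} s *\<^sub>R \<bar>l'' (\<theta> + s * (t - \<theta>))\<bar>)")
      case True
      then show ?thesis by (rule Bochner_Integration.integral_mono) (auto simp: b split: split_indicator)
    next
      case False
      then show ?thesis by (simp add: not_integrable_integral_eq)
    qed
    ultimately show ?thesis by simp
  qed
  have 0: "((\<lambda>t. \<bar>t - \<theta>\<bar> * (\<bar>l'' \<theta>\<bar> + 1)) \<longlongrightarrow> 0) (at \<theta> within T)"
    by (rule tendsto_eq_intros refl | simp)+
  show ?thesis
  proof (rule Lim_null_comparison[OF _ 0])
    show "\<forall>\<^sub>F t in at \<theta> within T. norm ((t - \<theta>) * ?A t) \<le> \<bar>t - \<theta>\<bar> * (\<bar>l'' \<theta>\<bar> + 1)"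
      using e(1) A unfolding eventually_at by (auto simp: abs_mult intro!: exI[of _ e] mult_left_mono)
  qed
qed

text \<open>Jensen's inequality in \<open>s\<close> at each observation, followed by Tonelli's
  theorem, reduces the moment of the average to the uniform bound along the segment. The joint
  measurability this requires comes from continuity on the product, the Borel sets of a second
  countable product being the product sigma-algebra.\<close>

lemma average_moment:
  fixes L'' :: "real \<Rightarrow> 'a::second_countable_topology \<Rightarrow> real"
  assumes c: "continuous_on (ball \<theta> r \<times> Y) (\<lambda>(t, z). L'' t z)" and Y: "Y \<in> sets borel"
    and M: "prob_space M" "sets M = sets borel" and t: "t \<in> ball \<theta> r" and p: "1 < p"
    and K: "\<And>t. t \<in> ball \<theta> r \<Longrightarrow> (\<integral>\<^sup>+z. ennreal (indicator Y z * \<bar>L'' t z\<bar> powr p) \<partial>M) \<le> ennreal K"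
  defines "A \<equiv> \<lambda>z. indicator Y z * (\<integral>s. indicator {0..1} s *\<^sub>R \<bar>L'' (\<theta> + s * (t - \<theta>)) z\<bar> \<partial>lborel)"
  shows "A \<in> borel_measurable borel" "(\<integral>\<^sup>+z. ennreal (A z powr p) \<partial>M) \<le> ennreal K"
proof -
  let ?p = "\<lambda>s. \<theta> + s * (t - \<theta>)"
  interpret M: prob_space M by fact
  interpret LM: pair_sigma_finite lborel M by unfold_locales
  define F where "F s z = indicator ({0..1} \<times> Y) (s, z) *\<^sub>R \<bar>L'' (?p s) z\<bar>" for s z
  have inb: "?p s \<in> ball \<theta> r" if "s \<in> {0..1}" for s
  proof -
    have "\<bar>s * (t - \<theta>)\<bar> \<le> \<bar>t - \<theta>\<bar>" using that by (simp add: abs_mult mult_left_le_one_le)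
    then show ?thesis using t by (auto simp: dist_real_def)
  qed
  have c2: "continuous_on ({0..1} \<times> Y) (\<lambda>x. L'' (?p (fst x)) (snd x))"
  proof -
    have "continuous_on ({0..1} \<times> Y) (\<lambda>x. (?p (fst x), snd x))" by (intro continuous_intros)
    moreover have "(\<lambda>x. (?p (fst x), snd x)) ` ({0..1} \<times> Y) \<subseteq> ball \<theta> r \<times> Y" using inb by force
    ultimately show ?thesis using continuous_on_compose2[OF c] by fastforce
  qed
  have "(\<lambda>x. indicator ({0..1} \<times> Y) x *\<^sub>R \<bar>L'' (?p (fst x)) (snd x)\<bar>) \<in> borel_measurable borel"
    by (intro borel_measurable_continuous_on_indicator continuous_intros c2 borel_Times Y) simp
  then have Fm: "(\<lambda>(s, z). F s z) \<in> borel_measurable (borel \<Otimes>\<^sub>M borel)"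
    unfolding borel_prod F_def by (simp add: case_prod_beta')
  have FmM [measurable]: "(\<lambda>(s, z). F s z) \<in> borel_measurable (lborel \<Otimes>\<^sub>M M)"
    using Fm by (subst measurable_cong_sets[OF sets_pair_measure_cong refl]) (use M in auto)
  have FmM2: "(\<lambda>(z, s). F s z) \<in> borel_measurable (borel \<Otimes>\<^sub>M lborel)"
  proof -
    have "(\<lambda>x. (\<lambda>(s, z). F s z) ((\<lambda>(z, s). (s, z)) x)) \<in> borel_measurable (borel \<Otimes>\<^sub>M (lborel :: real measure))"
      by (rule measurable_compose[OF measurable_pair_swap']) (use Fm in \<open>subst measurable_cong_sets[OF sets_pair_measure_cong refl]; simp\<close>)
    then show ?thesis by (simp add: case_prod_beta')
  qed
  have AF: "A z = (\<integral>s. F s z \<partial>lborel)" for z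
    by (cases "z \<in> Y") (auto simp: A_def F_def indicator_def intro!: Bochner_Integration.integral_cong)
  show "A \<in> borel_measurable borel" unfolding AF[abs_def]
    by (rule lborel.borel_measurable_lebesgue_integral) (use FmM2 in simp)
  have "(\<integral>\<^sup>+z. ennreal (A z powr p) \<partial>M) \<le> (\<integral>\<^sup>+z. (\<integral>\<^sup>+s. ennreal (F s z powr p) \<partial>lborel) \<partial>M)"
  proof (rule nn_integral_mono)
    fix z
    show "ennreal (A z powr p) \<le> (\<integral>\<^sup>+s. ennreal (F s z powr p) \<partial>lborel)"
    proof (cases "z \<in> Y")
      case True
      have "continuous_on {0..1} (\<lambda>s. \<bar>L'' (?p s) z\<bar>)"
      proof -
        have "continuous_on {0..1} (\<lambda>s::real. (s, z))" "(\<lambda>s. (s, z)) ` {0..1} \<subseteq> {0..1} \<times> Y"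
          using True by (auto intro!: continuous_intros)
        from continuous_on_compose2[OF c2 this] show ?thesis by (simp add: continuous_on_rabs)
      qed
      from powr_integral_le[OF this _ p] True show ?thesis by (simp add: A_def F_def indicator_def)
    next
      case False
      then show ?thesis by (simp add: A_def F_def)
    qed
  qed
  also have "\<dots> = (\<integral>\<^sup>+s. (\<integral>\<^sup>+z. ennreal (F s z powr p) \<partial>M) \<partial>lborel)"
    by (rule LM.Fubini') (simp add: case_prod_beta' measurable_compose[OF FmM, simplified case_prod_beta'])
  also have "\<dots> \<le> (\<integral>\<^sup>+s. ennreal K * indicator {0..1::real} s \<partial>lborel)"
  proof (rule nn_integral_mono)
    fix s :: real
    show "(\<integral>\<^sup>+z. ennreal (F s z powr p) \<partial>M) \<le> ennreal K * indicator {0..1} s"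
    proof (cases "s \<in> {0..1}")
      case True
      have "(\<integral>\<^sup>+z. ennreal (F s z powr p) \<partial>M) = (\<integral>\<^sup>+z. ennreal (indicator Y z * \<bar>L'' (?p s) z\<bar> powr p) \<partial>M)"
        using True by (intro nn_integral_cong) (auto simp: F_def indicator_def)
      also have "\<dots> \<le> ennreal K" by (rule K[OF inb[OF True]])
      finally show ?thesis using True by simp
    next
      case False
      then have "F s z = 0" for z by (auto simp: F_def)
      then show ?thesis by simp
    qed
  qed
  also have "\<dots> = ennreal K" by (subst nn_integral_cmult_indicator) auto
  finally show "(\<integral>\<^sup>+z. ennreal (A z powr p) \<partial>M) \<le> ennreal K" .
qed

section \<open>The statistical model\<close>

lemma countable_ball_cover:
  fixes X :: "'a::{metric_space, second_countable_topology} set"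
  assumes "\<And>x. x \<in> X \<Longrightarrow> 0 < r x"
  obtains D where "D \<subseteq> X" "countable D" "X \<subseteq> (\<Union>x\<in>D. ball x (r x))"
proof -
  let ?F = "(\<lambda>x. ball x (r x)) ` X"
  have "open S" if "S \<in> ?F" for S using that by auto
  then obtain F where F: "F \<subseteq> ?F" "countable F" "\<Union>F = \<Union>?F" by (rule Lindelof)
  have "\<exists>D. countable D \<and> D \<subseteq> X \<and> F = (\<lambda>x. ball x (r x)) ` D"
    using F(1,2) countable_subset_image[of F "\<lambda>x. ball x (r x)" X] by simp
  then obtain D where D: "countable D" "D \<subseteq> X" "F = (\<lambda>x. ball x (r x)) ` D"
    by (elim exE conjE)
  have "X \<subseteq> \<Union>F" unfolding F(3) using assms by force
  then show thesis by (intro that[OF D(2,1)]) (simp add: D(3))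
qed

text \<open>Around each point there is a ball containing no other point of \<open>X\<close>. In a
  countable subcover by such balls every point must therefore be its own center.\<close>

lemma countable_isolated_points:
  fixes X :: "'a::{metric_space, second_countable_topology} set"
  assumes "\<And>x. x \<in> X \<Longrightarrow> \<not> x islimpt X"
  shows "countable X"
proof -
  have "\<forall>x\<in>X. \<exists>e>0. \<forall>y\<in>X. y \<noteq> x \<longrightarrow> e \<le> dist y x"
    using assms unfolding islimpt_approachable by (metis not_less)
  then obtain e where e: "\<And>x. x \<in> X \<Longrightarrow> 0 < e x" "\<And>x y. x \<in> X \<Longrightarrow> y \<in> X \<Longrightarrow> y \<noteq> x \<Longrightarrow> e x \<le> dist y x"
    by metis
  obtain D where D: "D \<subseteq> X" "countable D" "X \<subseteq> (\<Union>x\<in>D. ball x (e x))"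
    by (rule countable_ball_cover[OF e(1)])
  have "X \<subseteq> D"
  proof
    fix y assume y: "y \<in> X"
    then obtain x where x: "x \<in> D" "dist y x < e x" using D(3) by (auto simp: dist_commute)
    with e(2)[of x y] y D(1) show "y \<in> D" by force
  qed
  with D(2) show ?thesis using countable_subset by blast
qed

section \<open>Almost everywhere equality and completed measures\<close>

lemma borel_measurable_completion_AE:
  fixes g g' :: "'a \<Rightarrow> 'b::topological_space"
  assumes g': "g' \<in> borel_measurable M" and ae: "AE x in M. g x = g' x"
  shows "g \<in> borel_measurable (completion M)"
proof (rule borel_measurableI)
  fix U :: "'b set" assume U: "open U"
  show "g -` U \<inter> space (completion M) \<in> sets (completion M)"
  proof (rule completion.in_sets_AE)
    show "g' -` U \<inter> space M \<in> sets (completion M)"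
      using measurable_sets[OF g', of U] U by auto
    show "AE x in completion M. (x \<in> g' -` U \<inter> space M) = (x \<in> g -` U \<inter> space (completion M))"
      using AE_completion[OF ae] by eventually_elim auto
  qed simp
qed

lemma integral_completion_AE:
  fixes g g' :: "'a \<Rightarrow> real"
  assumes g': "g' \<in> borel_measurable M" and ae: "AE x in M. g x = g' x"
  shows "(\<integral>x. g x \<partial>completion M) = (\<integral>x. g' x \<partial>M)"
proof -
  have "(\<integral>x. g x \<partial>completion M) = (\<integral>x. g' x \<partial>completion M)"
    by (rule integral_cong_AE[OF borel_measurable_completion_AE[OF assms] measurable_completion[OF g'] AE_completion[OF ae]])
  then show ?thesis by (simp add: integral_completion[OF g'])
qed

lemma measure_completion_AE:
  assumes A: "{x \<in> space M. Q x} \<in> sets M" and ae: "AE x in M. R x \<longleftrightarrow> Q x"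
  shows "measure (completion M) {x \<in> space (completion M). R x} = measure M {x \<in> space M. Q x}"
proof -
  have "measure (completion M) {x \<in> space M. R x} = measure (completion M) {x \<in> space M. Q x}"
  proof (rule measure_eq_AE)
    show ae': "AE x in completion M. (x \<in> {x \<in> space M. R x}) = (x \<in> {x \<in> space M. Q x})"
      using AE_completion[OF ae] by eventually_elim auto
    show "{x \<in> space M. R x} \<in> sets (completion M)"
      by (rule completion.in_sets_AE[of "{x \<in> space M. Q x}"]) (use A ae' in \<open>auto elim: eventually_mono\<close>)
  qed (use A in auto)
  then show ?thesis using A by simp
qed

declare One_nat_def [simp del]

section \<open>A common set of good observations, and derivatives within the parameter set\<close>

locale regular_model =
  fixes \<Theta> :: "real set"
    and \<gamma> :: "nat \<Rightarrow> ('a::{second_countable_topology, metric_space}) measure"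
    and f :: "nat \<Rightarrow> real \<Rightarrow> 'a \<Rightarrow> real"
  assumes dominating: "\<And>i. i \<ge> 1 \<Longrightarrow> sets (\<gamma> i) = sets borel"
    and measurable: "\<And>i \<theta>. i \<ge> 1 \<Longrightarrow> \<theta> \<in> \<Theta> \<Longrightarrow> f i \<theta> \<in> borel_measurable (\<gamma> i)"
    and nonneg: "\<And>i \<theta> z. i \<ge> 1 \<Longrightarrow> \<theta> \<in> \<Theta> \<Longrightarrow> f i \<theta> z \<ge> 0"
    and density: "\<And>i \<theta>. i \<ge> 1 \<Longrightarrow> \<theta> \<in> \<Theta> \<Longrightarrow> prob_space (obs_law \<gamma> f i \<theta>)"
    and limpt: "\<And>\<theta>. \<theta> \<in> \<Theta> \<Longrightarrow> \<theta> islimpt \<Theta>"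
    and identically_distributed:
      "\<And>i \<theta>. i \<ge> 1 \<Longrightarrow> \<theta> \<in> \<Theta> \<Longrightarrow> obs_law \<gamma> f i \<theta> = obs_law \<gamma> f 1 \<theta> \<and> f i \<theta> = f 1 \<theta>"
    and regular:
      "\<And>\<theta>'. \<theta>' \<in> \<Theta> \<Longrightarrow> \<exists>r>0. \<exists>\<delta>>0. regular_on_ball \<Theta> \<gamma> f (ball \<theta>' r) \<delta>"
begin

abbreviation "\<mu> \<equiv> obs_law \<gamma> f 1"

lemma borel_\<gamma>: "borel_measurable (\<gamma> 1) = borel_measurable borel"
  by (rule measurable_cong_sets) (simp_all add: dominating)

lemma sets_\<mu>: "sets (\<mu> \<theta>) = sets borel"
  using dominating[of 1] by (simp add: obs_law_def)

lemma borel_\<mu>: "borel_measurable (\<mu> \<theta>) = borel_measurable borel"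
  by (rule measurable_cong_sets) (simp_all add: sets_\<mu>)

text \<open>The content of \<open>regular_on_ball\<close> with its witnesses named, the exponent
  written as \<open>p\<close>, and the supremum replaced by a real bound. In this form it survives
  shrinking the set of observations and moving the center within the ball.\<close>

definition smooth_near where
  "smooth_near Y \<theta> r p K L L' L'' \<longleftrightarrow> 0 < r \<and> 2 < p \<and>
    (\<forall>z\<in>Y. \<forall>t\<in>ball \<theta> r \<inter> \<Theta>. 0 < f 1 t z \<and> L t z = ln (f 1 t z)) \<and>
    (\<forall>z\<in>Y. \<forall>t\<in>ball \<theta> r. ((\<lambda>t. L t z) has_real_derivative L' t z) (at t) \<and>
      ((\<lambda>t. L' t z) has_real_derivative L'' t z) (at t)) \<and>
    continuous_on (ball \<theta> r \<times> Y) (\<lambda>(t, z). L'' t z) \<and>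
    (\<forall>u\<in>ball \<theta> r \<inter> \<Theta>. \<forall>t\<in>ball \<theta> r. (\<integral>\<^sup>+ z. ennreal (\<bar>L'' t z\<bar> powr p * f 1 u z) \<partial>\<gamma> 1) \<le> ennreal K)"

definition smooth_at where
  "smooth_at Y \<theta> \<longleftrightarrow> (\<exists>r p K L L' L''. smooth_near Y \<theta> r p K L L' L'')"

lemma smooth_near_subset:
  assumes "smooth_near Y \<theta> r p K L L' L''" "Y' \<subseteq> Y" "t \<in> ball \<theta> r"
  shows "smooth_near Y' t (r - dist \<theta> t) p K L L' L''"
proof -
  have sub: "ball t (r - dist \<theta> t) \<subseteq> ball \<theta> r" using dist_triangle[of \<theta> _ t] by (auto simp: subset_iff) (smt (verit))
  have c: "continuous_on (ball \<theta> r \<times> Y) (\<lambda>(t, z). L'' t z)" using assms(1) by (simp add: smooth_near_def)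
  have "continuous_on (ball t (r - dist \<theta> t) \<times> Y') (\<lambda>(t, z). L'' t z)"
    by (rule continuous_on_subset[OF c]) (use sub assms(2) in blast)
  moreover have "0 < r - dist \<theta> t" using assms(3) by simp
  ultimately show ?thesis using assms(1,2) sub unfolding smooth_near_def by blast
qed

lemma regular_smooth_near:
  assumes th: "\<theta> \<in> \<Theta>"
  shows "\<exists>Y r p K L L' L''. (\<forall>\<theta>\<in>\<Theta>. full_measure (\<mu> \<theta>) Y) \<and> smooth_near Y \<theta> r p K L L' L''"
proof -
  obtain r \<delta> where r: "0 < r" "0 < \<delta>" "regular_on_ball \<Theta> \<gamma> f (ball \<theta> r) \<delta>" using regular[OF th] by blast
  then obtain Y L L' L'' where Y: "\<forall>\<theta>\<in>\<Theta>. full_measure (\<mu> \<theta>) Y"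
    and L: "\<forall>z\<in>Y. \<forall>t\<in>ball \<theta> r \<inter> \<Theta>. 0 < f 1 t z \<and> L t z = ln (f 1 t z)"
      "\<forall>z\<in>Y. \<forall>t\<in>ball \<theta> r. ((\<lambda>t. L t z) has_real_derivative L' t z) (at t) \<and>
      ((\<lambda>t. L' t z) has_real_derivative L'' t z) (at t)"
      "continuous_on (ball \<theta> r \<times> Y) (\<lambda>(t, z). L'' t z)"
    and s: "(SUP (u, t) \<in> (ball \<theta> r \<inter> \<Theta>) \<times> ball \<theta> r.
        \<integral>\<^sup>+ z. ennreal (\<bar>L'' t z\<bar> powr (2 + \<delta>) * f 1 u z) \<partial>\<gamma> 1) < \<infinity>"
    unfolding regular_on_ball_def by blast
  define K where "K = enn2real (SUP (u, t) \<in> (ball \<theta> r \<inter> \<Theta>) \<times> ball \<theta> r.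
        \<integral>\<^sup>+ z. ennreal (\<bar>L'' t z\<bar> powr (2 + \<delta>) * f 1 u z) \<partial>\<gamma> 1)"
  have "(\<integral>\<^sup>+ z. ennreal (\<bar>L'' t z\<bar> powr (2 + \<delta>) * f 1 u z) \<partial>\<gamma> 1) \<le> ennreal K"
    if "u \<in> ball \<theta> r \<inter> \<Theta>" "t \<in> ball \<theta> r" for u t
    unfolding K_def using s that by (subst ennreal_enn2real) (auto intro!: SUP_upper2[of "(u, t)"])
  with r L have "smooth_near Y \<theta> r (2 + \<delta>) K L L' L''" unfolding smooth_near_def by auto
  with Y show ?thesis by blast
qed

text \<open>Regularity provides a separate set of observations for every parameter, and an
  uncountable intersection could be too small. Countably many of the balls cover
  \<open>\<Theta>\<close>; the sets belonging to them are intersected.\<close>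

lemma full_measure_smooth:
  "\<exists>Y. Y \<in> sets borel \<and> (\<forall>\<theta>\<in>\<Theta>. AE z in \<mu> \<theta>. z \<in> Y) \<and> (\<forall>\<theta>\<in>\<Theta>. smooth_at Y \<theta>)"
proof -
  obtain Y r p K L L' L'' where Y: "\<And>d. d \<in> \<Theta> \<Longrightarrow> \<forall>\<theta>\<in>\<Theta>. full_measure (\<mu> \<theta>) (Y d)"
    and s: "\<And>d. d \<in> \<Theta> \<Longrightarrow> smooth_near (Y d) d (r d) (p d) (K d) (L d) (L' d) (L'' d)"
    using regular_smooth_near by metis
  have r: "0 < r d" if "d \<in> \<Theta>" for d using s[OF that] by (simp add: smooth_near_def)
  obtain D where D: "D \<subseteq> \<Theta>" "countable D" "\<Theta> \<subseteq> (\<Union>x\<in>D. ball x (r x))"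
    by (rule countable_ball_cover[of \<Theta> r]) (use r in auto)
  define Y0 where "Y0 = (\<Inter>d\<in>D. Y d)"
  have Yd: "Y d \<in> sets borel" "\<And>\<theta>. \<theta> \<in> \<Theta> \<Longrightarrow> AE z in \<mu> \<theta>. z \<in> Y d" if "d \<in> D" for d
  proof -
    have d: "d \<in> \<Theta>" using that D by auto
    show "Y d \<in> sets borel" "\<And>\<theta>. \<theta> \<in> \<Theta> \<Longrightarrow> AE z in \<mu> \<theta>. z \<in> Y d" using Y[OF d] d by (auto simp: full_measure_def sets_\<mu>)
  qed
  have "Y0 \<in> sets borel"
    unfolding Y0_def using D(2) Yd(1) by (cases "D = {}") (auto intro!: sets.countable_INT'')
  moreover have "AE z in \<mu> \<theta>. z \<in> Y0" if "\<theta> \<in> \<Theta>" for \<theta>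
    unfolding Y0_def INT_iff using Yd(2)[OF _ that] D(2) by (simp add: AE_ball_countable)
  moreover have "smooth_at Y0 \<theta>" if th: "\<theta> \<in> \<Theta>" for \<theta>
  proof -
    obtain d where d: "d \<in> D" "\<theta> \<in> ball d (r d)" using D(3) th by auto
    have sub: "Y0 \<subseteq> Y d" using d by (auto simp: Y0_def)
    have dT: "d \<in> \<Theta>" using d(1) D(1) by auto
    have sn: "smooth_near Y0 \<theta> (r d - dist d \<theta>) (p d) (K d) (L d) (L' d) (L'' d)"
      by (rule smooth_near_subset[OF s[OF dT] sub d(2)])
    show ?thesis unfolding smooth_at_def by (rule exI)+ (rule sn)
  qed
  ultimately show ?thesis by blast
qed

definition Y0 where
  "Y0 = (SOME Y. Y \<in> sets borel \<and> (\<forall>\<theta>\<in>\<Theta>. AE z in \<mu> \<theta>. z \<in> Y) \<and> (\<forall>\<theta>\<in>\<Theta>. smooth_at Y \<theta>))"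

lemma Y0: "Y0 \<in> sets borel" "\<And>\<theta>. \<theta> \<in> \<Theta> \<Longrightarrow> AE z in \<mu> \<theta>. z \<in> Y0"
    "\<And>\<theta>. \<theta> \<in> \<Theta> \<Longrightarrow> \<exists>r p K L L' L''. smooth_near Y0 \<theta> r p K L L' L''"
  using someI_ex[OF full_measure_smooth, folded Y0_def] unfolding smooth_at_def[symmetric] by blast+

definition S where "S \<theta> z = vector_derivative (\<lambda>t. ln (f 1 t z)) (at \<theta> within \<Theta>)"
definition H where "H \<theta> z = vector_derivative (\<lambda>t. S t z) (at \<theta> within \<Theta>)"

lemma at_nonbot: "\<theta> \<in> \<Theta> \<Longrightarrow> at \<theta> within \<Theta> \<noteq> bot"
  using limpt by (simp add: trivial_limit_within)

text \<open>As \<open>\<Theta>\<close> has no isolated points, derivatives within it are unique and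
  can be computed from any extension to the ball; the choice of extension on overlapping balls thus
  does not affect them.\<close>

lemma derivative_within_eqI:
  assumes "t \<in> ball \<theta> r" "t \<in> \<Theta>" and d: "(l has_real_derivative y) (at t)"
    and eq: "\<And>u. u \<in> ball \<theta> r \<Longrightarrow> u \<in> \<Theta> \<Longrightarrow> g u = l u"
  shows "(g has_vector_derivative y) (at t within \<Theta>)" "vector_derivative g (at t within \<Theta>) = y"
proof -
  have "(l has_vector_derivative y) (at t within \<Theta>)"
    using d by (simp add: has_real_derivative_iff_has_vector_derivative has_vector_derivative_at_within)
  then show *: "(g has_vector_derivative y) (at t within \<Theta>)"
  proof (rule has_vector_derivative_transform_within[where d="r - dist \<theta> t"])
    fix u assume u: "u \<in> \<Theta>" "dist u t < r - dist \<theta> t"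
    then have "u \<in> ball \<theta> r" using dist_triangle[of \<theta> u t] by (simp add: dist_commute)
    from eq[OF this u(1)] show "l u = g u" by simp
  qed (use assms in auto)
  show "vector_derivative g (at t within \<Theta>) = y"
    by (rule vector_derivative_within[OF at_nonbot[OF assms(2)] *])
qed

lemma smooth_near_S:
  assumes sm: "smooth_near Y0 \<theta> r p K L L' L''" and z: "z \<in> Y0" and t: "t \<in> ball \<theta> r" "t \<in> \<Theta>"
  shows "S t z = L' t z" "((\<lambda>t. ln (f 1 t z)) has_vector_derivative S t z) (at t within \<Theta>)"
    "H t z = L'' t z" "((\<lambda>t. S t z) has_vector_derivative H t z) (at t within \<Theta>)"
proof -
  have d: "((\<lambda>t. L t z) has_real_derivative L' u z) (at u)" "((\<lambda>t. L' t z) has_real_derivative L'' u z) (at u)"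
    if "u \<in> ball \<theta> r" for u using sm z that by (auto simp: smooth_near_def)
  have L: "ln (f 1 u z) = L u z" if "u \<in> ball \<theta> r" "u \<in> \<Theta>" for u using sm z that by (auto simp: smooth_near_def)
  have S: "S u z = L' u z" "((\<lambda>t. ln (f 1 t z)) has_vector_derivative L' u z) (at u within \<Theta>)"
    if "u \<in> ball \<theta> r" "u \<in> \<Theta>" for u
    using derivative_within_eqI[of u \<theta> r, OF that d(1)[OF that(1)] L] by (auto simp: S_def)
  from S t show "S t z = L' t z" "((\<lambda>t. ln (f 1 t z)) has_vector_derivative S t z) (at t within \<Theta>)" by auto
  from derivative_within_eqI[of t \<theta> r, OF t d(2)[OF t(1)] S(1)]
  show "H t z = L'' t z" "((\<lambda>t. S t z) has_vector_derivative H t z) (at t within \<Theta>)" by (auto simp: H_def)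
qed

lemma derivatives:
  assumes "\<theta> \<in> \<Theta>" "z \<in> Y0"
  shows "((\<lambda>t. ln (f 1 t z)) has_vector_derivative S \<theta> z) (at \<theta> within \<Theta>)"
    "((\<lambda>t. S t z) has_vector_derivative H \<theta> z) (at \<theta> within \<Theta>)"
proof -
  obtain r p K L L' L'' where sm: "smooth_near Y0 \<theta> r p K L L' L''" using Y0(3)[OF assms(1)] by blast
  then have "\<theta> \<in> ball \<theta> r" by (simp add: smooth_near_def)
  from smooth_near_S(2,4)[OF sm assms(2) this assms(1)]
  show "((\<lambda>t. ln (f 1 t z)) has_vector_derivative S \<theta> z) (at \<theta> within \<Theta>)"
    "((\<lambda>t. S t z) has_vector_derivative H \<theta> z) (at \<theta> within \<Theta>)" .
qed

lemma quotient_tendsto: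
  fixes g :: "real \<Rightarrow> real"
  assumes "(g has_vector_derivative y) (at \<theta> within \<Theta>)"
  shows "((\<lambda>t. (g t - g \<theta>) / (t - \<theta>)) \<longlongrightarrow> y) (at \<theta> within \<Theta>)"
  using assms by (simp add: has_real_derivative_iff_has_vector_derivative[symmetric] has_field_derivative_iff)

text \<open>Off the set \<open>Y0\<close> of full measure the functions are replaced by constants for which all pointwise
  estimates are trivial, and \<open>N\<close> vanishes there.\<close>

definition "N = density (\<gamma> 1) (indicator Y0)"
definition "f' \<theta> z = (if z \<in> Y0 then f 1 \<theta> z else 1)"
definition "S' \<theta> z = (if z \<in> Y0 then S \<theta> z else 0)"
definition "H' \<theta> z = (if z \<in> Y0 then H \<theta> z else 0)"

lemma sets_N: "sets N = sets borel" "space N = UNIV"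
  using dominating[of 1] sets_eq_imp_space_eq[OF dominating[of 1]] by (auto simp: N_def)

lemma borel_N: "borel_measurable N = borel_measurable borel"
  by (rule measurable_cong_sets[OF sets_N(1) refl])

lemma f_borel: "\<theta> \<in> \<Theta> \<Longrightarrow> f 1 \<theta> \<in> borel_measurable borel"
  using measurable[of 1 \<theta>] by (simp add: borel_\<gamma>)

lemma f'_borel: "\<theta> \<in> \<Theta> \<Longrightarrow> f' \<theta> \<in> borel_measurable borel"
  unfolding f'_def[abs_def] using f_borel Y0(1) by (intro measurable_If_set) auto

lemma f'_pos: "\<theta> \<in> \<Theta> \<Longrightarrow> 0 < f' \<theta> z"
proof -
  assume th: "\<theta> \<in> \<Theta>"
  obtain r p K L L' L'' where "smooth_near Y0 \<theta> r p K L L' L''" using Y0(3)[OF th] by blast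
  with th show "0 < f' \<theta> z" by (auto simp: smooth_near_def f'_def)
qed

text \<open>\<open>Y0\<close> has full measure under \<open>\<mu> \<theta>\<close>, so off it the
  original density vanishes \<open>\<gamma> 1\<close>-almost everywhere, and \<open>N\<close> has no
  mass there either; on it the two densities agree.\<close>

lemma density_N: "\<theta> \<in> \<Theta> \<Longrightarrow> density N (\<lambda>z. ennreal (f' \<theta> z)) = \<mu> \<theta>"
proof -
  assume th: "\<theta> \<in> \<Theta>"
  have [measurable]: "f 1 \<theta> \<in> borel_measurable (\<gamma> 1)" "f' \<theta> \<in> borel_measurable (\<gamma> 1)" "Y0 \<in> sets (\<gamma> 1)"
    using measurable[of 1 \<theta>] f'_borel[OF th] th Y0(1) dominating[of 1] by (auto simp: borel_\<gamma>)
  have "density N (\<lambda>z. ennreal (f' \<theta> z)) = density (\<gamma> 1) (\<lambda>z. indicator Y0 z * ennreal (f' \<theta> z))"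
    unfolding N_def by (rule density_density_eq) measurable
  also have "\<dots> = density (\<gamma> 1) (\<lambda>z. ennreal (f 1 \<theta> z))"
  proof (rule density_cong)
    have "AE z in \<gamma> 1. 0 < ennreal (f 1 \<theta> z) \<longrightarrow> z \<in> Y0"
      using Y0(2)[OF th] unfolding obs_law_def by (subst (asm) AE_density) auto
    then show "AE z in \<gamma> 1. indicator Y0 z * ennreal (f' \<theta> z) = ennreal (f 1 \<theta> z)"
      by eventually_elim (use nonneg[of 1 \<theta>] th in \<open>auto simp: f'_def indicator_def ennreal_neg not_less intro: antisym\<close>)
  qed measurable
  finally show ?thesis by (simp add: obs_law_def)
qed

text \<open>Measurability of the score is inherited from the densities, through difference quotients
  along one sequence in \<open>\<Theta>\<close>; no regularity of the first derivative in the
  observation is at hand.\<close>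

lemma S'_borel: "\<theta> \<in> \<Theta> \<Longrightarrow> S' \<theta> \<in> borel_measurable borel"
proof -
  assume th: "\<theta> \<in> \<Theta>"
  obtain t where t: "\<And>k::nat. t k \<in> \<Theta> - {\<theta>}" "t \<longlonglongrightarrow> \<theta>"
    using limpt[OF th] unfolding islimpt_sequential by blast
  have [measurable]: "f' (t k) \<in> borel_measurable borel" "f' \<theta> \<in> borel_measurable borel" for k
    using t f'_borel th by auto
  show ?thesis
  proof (rule borel_measurable_LIMSEQ_real)
    show "(\<lambda>z. (ln (f' (t k) z) - ln (f' \<theta> z)) / (t k - \<theta>)) \<in> borel_measurable borel" for k by measurable
    fix z
    show "(\<lambda>k. (ln (f' (t k) z) - ln (f' \<theta> z)) / (t k - \<theta>)) \<longlonglongrightarrow> S' \<theta> z"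
    proof (cases "z \<in> Y0")
      case True
      from quotient_tendsto[OF derivatives(1)[OF th True]] t
      have "((\<lambda>u. (ln (f 1 u z) - ln (f 1 \<theta> z)) / (u - \<theta>)) \<circ> t) \<longlonglongrightarrow> S \<theta> z"
        unfolding tendsto_at_iff_sequentially by blast
      then show ?thesis using True by (simp add: f'_def S'_def comp_def)
    qed (simp add: f'_def S'_def)
  qed
qed

lemma H'_borel: "\<theta> \<in> \<Theta> \<Longrightarrow> H' \<theta> \<in> borel_measurable borel"
proof -
  assume th: "\<theta> \<in> \<Theta>"
  obtain r p K L L' L'' where sm: "smooth_near Y0 \<theta> r p K L L' L''" using Y0(3)[OF th] by blast
  then have r: "\<theta> \<in> ball \<theta> r" and c: "continuous_on (ball \<theta> r \<times> Y0) (\<lambda>(t, z). L'' t z)" by (auto simp: smooth_near_def)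
  have "continuous_on Y0 (\<lambda>z. case (\<theta>, z) of (t, z) \<Rightarrow> L'' t z)"
    by (rule continuous_on_compose2[OF c]) (use r in \<open>auto intro!: continuous_intros\<close>)
  then have "(\<lambda>z. indicator Y0 z *\<^sub>R L'' \<theta> z) \<in> borel_measurable borel"
    by (intro borel_measurable_continuous_on_indicator Y0) simp
  also have "(\<lambda>z. indicator Y0 z *\<^sub>R L'' \<theta> z) = H' \<theta>"
    using smooth_near_S(3)[OF sm _ r th] by (auto simp: H'_def fun_eq_iff indicator_def)
  finally show ?thesis .
qed

lemma moment_bound:
  assumes sm: "smooth_near Y0 \<theta> r p K L L' L''" and u: "u \<in> ball \<theta> r" "u \<in> \<Theta>" and t: "t \<in> ball \<theta> r"
  shows "(\<integral>\<^sup>+z. ennreal (indicator Y0 z * \<bar>L'' t z\<bar> powr p) \<partial>\<mu> u) \<le> ennreal K"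
proof -
  have c: "continuous_on (ball \<theta> r \<times> Y0) (\<lambda>(t, z). L'' t z)" using sm by (simp add: smooth_near_def)
  have "continuous_on Y0 (\<lambda>z. case (t, z) of (t, z) \<Rightarrow> L'' t z)"
    by (rule continuous_on_compose2[OF c]) (use t in \<open>auto intro!: continuous_intros\<close>)
  then have m: "(\<lambda>z. indicator Y0 z *\<^sub>R L'' t z) \<in> borel_measurable borel"
    by (intro borel_measurable_continuous_on_indicator Y0) simp
  have "(\<lambda>z. indicator Y0 z * \<bar>indicator Y0 z *\<^sub>R L'' t z\<bar> powr p) \<in> borel_measurable borel"
    using m Y0(1) by measurable
  also have "(\<lambda>z. indicator Y0 z * \<bar>indicator Y0 z *\<^sub>R L'' t z\<bar> powr p) = (\<lambda>z. indicator Y0 z * \<bar>L'' t z\<bar> powr p)"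
    by (auto simp: fun_eq_iff indicator_def)
  finally have [measurable]: "(\<lambda>z. indicator Y0 z * \<bar>L'' t z\<bar> powr p) \<in> borel_measurable (\<gamma> 1)"
    by (simp add: borel_\<gamma>)
  have [measurable]: "f 1 u \<in> borel_measurable (\<gamma> 1)" using measurable[of 1 u] u by simp
  have "(\<integral>\<^sup>+z. ennreal (indicator Y0 z * \<bar>L'' t z\<bar> powr p) \<partial>\<mu> u)
      = (\<integral>\<^sup>+z. ennreal (f 1 u z) * ennreal (indicator Y0 z * \<bar>L'' t z\<bar> powr p) \<partial>\<gamma> 1)"
    unfolding obs_law_def by (rule nn_integral_density) measurable
  also have "\<dots> \<le> (\<integral>\<^sup>+ z. ennreal (\<bar>L'' t z\<bar> powr p * f 1 u z) \<partial>\<gamma> 1)"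
    by (intro nn_integral_mono) (use nonneg[of 1 u] u in \<open>auto simp: indicator_def ennreal_mult'[symmetric] mult.commute\<close>)
  also have "\<dots> \<le> ennreal K" using sm u t by (simp add: smooth_near_def)
  finally show ?thesis .
qed

sublocale smooth_family N \<Theta> f' S' H'
proof (rule smooth_family.intro)
  fix \<theta> assume th: "\<theta> \<in> \<Theta>"
  show "f' \<theta> \<in> borel_measurable N" "S' \<theta> \<in> borel_measurable N" "H' \<theta> \<in> borel_measurable N"
    using f'_borel[OF th] S'_borel[OF th] H'_borel[OF th] by (simp_all add: borel_N)
  show "prob_space (density N (\<lambda>z. ennreal (f' \<theta> z)))" using density[of 1 \<theta>] th by (simp add: density_N)
  show "\<theta> islimpt \<Theta>" by (rule limpt[OF th])
  show "0 < f' \<theta> z" for z by (rule f'_pos[OF th])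
  show "((\<lambda>t. (S' t z - S' \<theta> z) / (t - \<theta>)) \<longlongrightarrow> H' \<theta> z) (at \<theta> within \<Theta>)" for z
    using quotient_tendsto[OF derivatives(2)[OF th]] by (cases "z \<in> Y0") (simp_all add: S'_def H'_def)
  obtain r p K L L' L'' where sm: "smooth_near Y0 \<theta> r p K L L' L''" using Y0(3)[OF th] by blast
  then have r: "0 < r" and p: "2 < p"
    and L: "\<And>z t. z \<in> Y0 \<Longrightarrow> t \<in> ball \<theta> r \<inter> \<Theta> \<Longrightarrow> L t z = ln (f 1 t z)"
    and d: "\<And>z t. z \<in> Y0 \<Longrightarrow> t \<in> ball \<theta> r \<Longrightarrow> ((\<lambda>t. L t z) has_real_derivative L' t z) (at t)"
      "\<And>z t. z \<in> Y0 \<Longrightarrow> t \<in> ball \<theta> r \<Longrightarrow> ((\<lambda>t. L' t z) has_real_derivative L'' t z) (at t)"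
    and c: "continuous_on (ball \<theta> r \<times> Y0) (\<lambda>(t, z). L'' t z)"
    by (auto simp: smooth_near_def)
  have cz: "continuous_on (ball \<theta> r) (\<lambda>t. L'' t z)" if "z \<in> Y0" for z
  proof -
    have "continuous_on (ball \<theta> r) (\<lambda>t. (t, z))" "(\<lambda>t. (t, z)) ` ball \<theta> r \<subseteq> ball \<theta> r \<times> Y0"
      using that by (auto intro!: continuous_intros)
    from continuous_on_compose2[OF c this] show ?thesis by simp
  qed
  \<comment> \<open>The average of the absolute second derivative over the segment from
    \<open>\<theta>\<close> to \<open>t\<close>, set to zero off \<open>Y0\<close>, where both
    remainders vanish.\<close>
  define A where "A t z = indicator Y0 z * (\<integral>s. indicator {0..1} s *\<^sub>R \<bar>L'' (\<theta> + s * (t - \<theta>)) z\<bar> \<partial>lborel)" for t z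
  have A: "A t \<in> borel_measurable borel" "(\<integral>\<^sup>+z. ennreal (A t z powr p) \<partial>\<mu> u) \<le> ennreal K"
    if "t \<in> ball \<theta> r" "u \<in> ball \<theta> r" "u \<in> \<Theta>" for t u
    unfolding A_def[abs_def]
    by (rule average_moment[OF c Y0(1) density[of 1 u] sets_\<mu> that(1) _ moment_bound[OF sm that(2,3)]]; use p that in simp)+
  have thb: "\<theta> \<in> ball \<theta> r" using r by simp
  show "\<exists>r>0. \<exists>p>2. \<exists>K. \<exists>A. (\<forall>t\<in>\<Theta> \<inter> ball \<theta> r. A t \<in> borel_measurable N \<and>
        (\<forall>z\<in>space N. 0 \<le> A t z \<and> \<bar>ln (f' t z) - ln (f' \<theta> z) - (t - \<theta>) * S' \<theta> z\<bar> \<le> (t - \<theta>)\<^sup>2 * A t z \<and>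
          \<bar>S' t z - S' \<theta> z\<bar> \<le> \<bar>t - \<theta>\<bar> * A t z) \<and>
        (\<forall>u\<in>\<Theta> \<inter> ball \<theta> r. integrable (density N (\<lambda>z. ennreal (f' u z))) (\<lambda>z. A t z powr p) \<and>
          (\<integral>z. A t z powr p \<partial>density N (\<lambda>z. ennreal (f' u z))) \<le> K)) \<and>
      (\<forall>z\<in>space N. ((\<lambda>t. (t - \<theta>) * A t z) \<longlongrightarrow> 0) (at \<theta> within \<Theta>))"
  \<comment> \<open>\<open>ennreal\<close> sends a negative \<open>K\<close> to zero, so as a bound
    on real integrals it has to be replaced by \<open>max 0 K\<close>.\<close>
  proof (rule exI[of _ r], rule conjI[OF r], rule exI[of _ p], rule conjI[OF p], rule exI[of _ "max 0 K"],
      rule exI[of _ A], intro conjI ballI)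
    fix t assume t: "t \<in> \<Theta> \<inter> ball \<theta> r"
    then have tb: "t \<in> ball \<theta> r" by simp
    show "A t \<in> borel_measurable N" using A(1)[OF tb thb th] by (simp add: borel_N)
    fix z
    show "0 \<le> A t z" "\<bar>ln (f' t z) - ln (f' \<theta> z) - (t - \<theta>) * S' \<theta> z\<bar> \<le> (t - \<theta>)\<^sup>2 * A t z" "\<bar>S' t z - S' \<theta> z\<bar> \<le> \<bar>t - \<theta>\<bar> * A t z"
    proof (atomize (full), cases "z \<in> Y0")
      case True
      note R = second_order_remainder[of \<theta> r "\<lambda>t. L t z" "\<lambda>t. L' t z" "\<lambda>t. L'' t z", OF d(1)[OF True] d(2)[OF True] cz[OF True] tb]
      show "0 \<le> A t z \<and> \<bar>ln (f' t z) - ln (f' \<theta> z) - (t - \<theta>) * S' \<theta> z\<bar> \<le> (t - \<theta>)\<^sup>2 * A t z \<and> \<bar>S' t z - S' \<theta> z\<bar> \<le> \<bar>t - \<theta>\<bar> * A t z"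
        using R(1-3) True L[OF True, of t] L[OF True, of \<theta>] t th thb
          smooth_near_S(1)[OF sm True thb th] smooth_near_S(1)[OF sm True tb] by (simp add: A_def f'_def S'_def)
    qed (simp add: A_def f'_def S'_def)
  next
    fix t u assume t: "t \<in> \<Theta> \<inter> ball \<theta> r" and u: "u \<in> \<Theta> \<inter> ball \<theta> r"
    have uT: "u \<in> \<Theta>" using u by simp
    have m: "(\<lambda>z. A t z powr p) \<in> borel_measurable (\<mu> u)"
      using A(1)[of t \<theta>] t th thb by (simp add: borel_\<mu>)
    have "(\<integral>\<^sup>+z. ennreal (A t z powr p) \<partial>\<mu> u) \<le> ennreal K" by (rule A(2)) (use t u in auto)
    then have le: "(\<integral>\<^sup>+z. ennreal (A t z powr p) \<partial>\<mu> u) \<le> ennreal (max 0 K)" by (rule order_trans) (simp add: ennreal_leI)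
    have i: "integrable (\<mu> u) (\<lambda>z. A t z powr p)"
      by (rule integrableI_nonneg[OF m]) (use le in \<open>auto simp: less_top[symmetric] top_unique\<close>)
    then show "integrable (density N (\<lambda>z. ennreal (f' u z))) (\<lambda>z. A t z powr p)" by (simp add: density_N[OF uT])
    have "ennreal (\<integral>z. A t z powr p \<partial>\<mu> u) \<le> ennreal (max 0 K)"
      using le by (subst nn_integral_eq_integral[symmetric, OF i]) auto
    then have "(\<integral>z. A t z powr p \<partial>\<mu> u) \<le> max 0 K" by (subst (asm) ennreal_le_iff) simp
    then show "(\<integral>z. A t z powr p \<partial>density N (\<lambda>z. ennreal (f' u z))) \<le> max 0 K" by (simp add: density_N[OF uT])
  next
    fix z
    show "((\<lambda>t. (t - \<theta>) * A t z) \<longlongrightarrow> 0) (at \<theta> within \<Theta>)"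
      using scaled_average_tendsto_0[OF cz r, of z] by (cases "z \<in> Y0") (simp_all add: A_def)
  qed
qed

end

section \<open>Score, information and second derivative of a sample\<close>

context regular_model
begin

abbreviation "PM n \<theta> \<equiv> (\<Pi>\<^sub>M i\<in>{1..n::nat}. \<mu> \<theta>)"

definition "Fisher \<theta> = (\<integral>z. (S' \<theta> z)\<^sup>2 \<partial>\<mu> \<theta>)"

definition "crit = {\<theta> \<in> \<Theta>. Fisher \<theta> = 0}"

lemma crit_iff: "\<theta> \<in> \<Theta> \<Longrightarrow> \<theta> \<in> crit \<longleftrightarrow> (\<integral>z. (S' \<theta> z)\<^sup>2 \<partial>P \<theta>) = 0"
  by (simp add: crit_def Fisher_def density_N)

lemma prob_\<mu>: "\<theta> \<in> \<Theta> \<Longrightarrow> prob_space (\<mu> \<theta>)"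
  by (rule density) simp_all

lemma data_law_eq: "\<theta> \<in> \<Theta> \<Longrightarrow> data_law \<gamma> f n \<theta> = completion (PM n \<theta>)"
  unfolding data_law_def using identically_distributed
  by (intro arg_cong[of _ _ completion] PiM_cong refl) (metis atLeastAtMost_iff)

lemma AE_PM:
  assumes th: "\<theta> \<in> \<Theta>" and Y: "AE z in \<mu> \<theta>. z \<in> Y"
  shows "AE y in PM n \<theta>. \<forall>i\<in>{1..n}. y i \<in> Y"
proof (rule AE_finite_allI)
  fix i assume "i \<in> {1..n}"
  then show "AE y in PM n \<theta>. y i \<in> Y"
    by (rule AE_PiM_component[rotated]) (use prob_\<mu>[OF th] Y in auto)
qed simp

lemma
  assumes th: "\<theta> \<in> \<Theta>" and y: "\<And>i. i \<in> {1..n} \<Longrightarrow> y i \<in> Y0"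
  shows score_eq: "score \<Theta> f n \<theta> y = (\<Sum>i=1..n. S \<theta> (y i))"
    and hess_eq: "hess \<Theta> f n \<theta> y = (\<Sum>i=1..n. H \<theta> (y i))"
proof -
  have ll: "loglik f n t y = (\<Sum>i=1..n. ln (f 1 t (y i)))" if "t \<in> \<Theta>" for t
    unfolding loglik_def
  proof (rule sum.cong[OF refl])
    fix i assume "i \<in> {1..n}"
    then have "f i t = f 1 t" using identically_distributed[of i t] that by simp
    then show "ln (f i t (y i)) = ln (f 1 t (y i))" by (rule arg_cong)
  qed
  have sc: "score \<Theta> f n t y = (\<Sum>i=1..n. S t (y i))" if t: "t \<in> \<Theta>" for t
  proof -
    have "((\<lambda>t. \<Sum>i=1..n. ln (f 1 t (y i))) has_vector_derivative (\<Sum>i=1..n. S t (y i))) (at t within \<Theta>)"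
      by (intro has_vector_derivative_sum derivatives t y)
    then have "((\<lambda>t. loglik f n t y) has_vector_derivative (\<Sum>i=1..n. S t (y i))) (at t within \<Theta>)"
      by (rule has_vector_derivative_transform[OF t, rotated]) (simp add: ll)
    then show ?thesis unfolding score_def by (rule vector_derivative_within[OF at_nonbot[OF t]])
  qed
  show "score \<Theta> f n \<theta> y = (\<Sum>i=1..n. S \<theta> (y i))" by (rule sc[OF th])
  have "((\<lambda>t. \<Sum>i=1..n. S t (y i)) has_vector_derivative (\<Sum>i=1..n. H \<theta> (y i))) (at \<theta> within \<Theta>)"
    by (intro has_vector_derivative_sum derivatives th y)
  then have "((\<lambda>t. score \<Theta> f n t y) has_vector_derivative (\<Sum>i=1..n. H \<theta> (y i))) (at \<theta> within \<Theta>)"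
    by (rule has_vector_derivative_transform[OF th, rotated]) (simp add: sc)
  then show "hess \<Theta> f n \<theta> y = (\<Sum>i=1..n. H \<theta> (y i))"
    unfolding hess_def by (rule vector_derivative_within[OF at_nonbot[OF th]])
qed

lemma
  assumes th: "\<theta> \<in> \<Theta>" and y: "\<And>i. i \<in> {1..n} \<Longrightarrow> y i \<in> Y0"
  shows score_eq': "score \<Theta> f n \<theta> y = (\<Sum>i=1..n. S' \<theta> (y i))"
    and hess_eq': "hess \<Theta> f n \<theta> y = (\<Sum>i=1..n. H' \<theta> (y i))"
proof -
  have "(\<Sum>i=1..n. S \<theta> (y i)) = (\<Sum>i=1..n. S' \<theta> (y i))" "(\<Sum>i=1..n. H \<theta> (y i)) = (\<Sum>i=1..n. H' \<theta> (y i))"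
    by (rule sum.cong[OF refl]; use y in \<open>simp add: S'_def H'_def\<close>)+
  then show "score \<Theta> f n \<theta> y = (\<Sum>i=1..n. S' \<theta> (y i))" "hess \<Theta> f n \<theta> y = (\<Sum>i=1..n. H' \<theta> (y i))"
    using score_eq[OF th y] hess_eq[OF th y] by simp_all
qed

text \<open>Score and second derivative are uncontrolled at samples with an observation outside
  \<open>Y0\<close>. Hence \<open>g\<close> is tied to a sum only on the remaining samples, which
  have full measure, and the completed law makes it measurable all the same.\<close>

lemma variance_sum:
  fixes g :: "(nat \<Rightarrow> 'a) \<Rightarrow> real"
  assumes th: "\<theta> \<in> \<Theta>" and V: "V \<in> borel_measurable borel"
    and sq: "integrable (\<mu> \<theta>) (\<lambda>z. (V z)\<^sup>2)" and mean: "(\<integral>z. V z \<partial>\<mu> \<theta>) = 0"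
    and g: "\<And>y. (\<And>i. i \<in> {1..n} \<Longrightarrow> y i \<in> Y0) \<Longrightarrow> g y = (\<Sum>i=1..n. V (y i))"
  shows "prob_space.variance (data_law \<gamma> f n \<theta>) g = n * (\<integral>z. (V z)\<^sup>2 \<partial>\<mu> \<theta>)"
proof -
  have [measurable]: "V \<in> borel_measurable (\<mu> \<theta>)" using V by (simp add: borel_\<mu>)
  have ae: "AE y in PM n \<theta>. g y = (\<Sum>i=1..n. V (y i))"
    using AE_PM[OF th Y0(2)[OF th], of n] by eventually_elim (auto intro: g)
  have "(\<integral>y. g y \<partial>data_law \<gamma> f n \<theta>) = (\<integral>y. (\<Sum>i=1..n. V (y i)) \<partial>PM n \<theta>)"
    unfolding data_law_eq[OF th] by (rule integral_completion_AE[OF _ ae]) measurable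
  also have "\<dots> = 0" by (rule PiM_sum_mean[OF prob_\<mu>[OF th] _ sq mean]) measurable
  finally have m: "(\<integral>y. g y \<partial>data_law \<gamma> f n \<theta>) = 0" .
  have "(\<integral>y. (g y - 0)\<^sup>2 \<partial>data_law \<gamma> f n \<theta>) = (\<integral>y. (\<Sum>i=1..n. V (y i))\<^sup>2 \<partial>PM n \<theta>)"
    unfolding data_law_eq[OF th]
  proof (rule integral_completion_AE)
    show "AE y in PM n \<theta>. (g y - 0)\<^sup>2 = (\<Sum>i=1..n. V (y i))\<^sup>2" using ae by eventually_elim simp
  qed measurable
  also have "\<dots> = n * (\<integral>z. (V z)\<^sup>2 \<partial>\<mu> \<theta>)" by (rule PiM_sum_square[OF prob_\<mu>[OF th] _ sq mean]) measurable
  finally show ?thesis unfolding m .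
qed

lemma score_moments:
  assumes "\<theta> \<in> \<Theta>"
  shows "integrable (\<mu> \<theta>) (\<lambda>z. (S' \<theta> z)\<^sup>2)" "(\<integral>z. S' \<theta> z \<partial>\<mu> \<theta>) = 0"
  using score_square[OF assms] score_mean[OF assms] by (simp_all add: density_N[OF assms])

lemma fisher_info_eq: "\<theta> \<in> \<Theta> \<Longrightarrow> fisher_info \<Theta> \<gamma> f n \<theta> = n * Fisher \<theta>"
  unfolding fisher_info_def Fisher_def
  by (rule variance_sum[OF _ S'_borel score_moments score_eq'])

lemma critical_eq: "1 \<le> n \<Longrightarrow> critical \<Theta> \<gamma> f n = crit"
  by (auto simp: critical_def crit_def fisher_info_eq)

lemma hess_variance_eq:
  assumes "\<theta> \<in> crit"
  shows "prob_space.variance (data_law \<gamma> f n \<theta>) (hess \<Theta> f n \<theta>) = n * (\<integral>z. (H' \<theta> z)\<^sup>2 \<partial>\<mu> \<theta>)"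
proof -
  have th: "\<theta> \<in> \<Theta>" using assms by (simp add: crit_def)
  note c = assms[unfolded crit_iff[OF th]]
  show ?thesis
    by (rule variance_sum[OF th H'_borel[OF th] _ _ hess_eq'[OF th]])
      (use critical_slope(1,2)[OF th c] in \<open>simp_all add: density_N[OF th]\<close>)
qed

end

section \<open>Isolated critical points and continuity of the extended statistic\<close>

locale nondegenerate_model = regular_model +
  assumes hess_variance:
    "\<And>\<theta>. \<theta> \<in> critical \<Theta> \<gamma> f 1 \<Longrightarrow> prob_space.variance (data_law \<gamma> f 1 \<theta>) (hess \<Theta> f 1 \<theta>) > 0"
begin

sublocale nondegenerate_family N \<Theta> f' S' H'
proof (rule nondegenerate_family.intro[OF smooth_family_axioms nondegenerate_family_axioms.intro])
  fix \<theta> assume th: "\<theta> \<in> \<Theta>" and "(\<integral>z. (S' \<theta> z)\<^sup>2 \<partial>P \<theta>) = 0"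
  then have c: "\<theta> \<in> crit" by (simp add: crit_iff)
  then have "0 < prob_space.variance (data_law \<gamma> f 1 \<theta>) (hess \<Theta> f 1 \<theta>)"
    by (intro hess_variance) (simp add: critical_eq)
  then show "0 < (\<integral>z. (H' \<theta> z)\<^sup>2 \<partial>P \<theta>)" unfolding hess_variance_eq[OF c] density_N[OF th] by simp
qed

lemma info_eq:
  assumes t: "t \<in> \<Theta>"
  shows "\<theta> \<in> \<Theta> - crit \<Longrightarrow> info \<theta> t = Fisher t"
    "\<theta> \<in> crit \<Longrightarrow> t \<noteq> \<theta> \<Longrightarrow> info \<theta> t = Fisher t / (t - \<theta>)\<^sup>2"
    "\<theta> \<in> crit \<Longrightarrow> t = \<theta> \<Longrightarrow> info \<theta> t = (\<integral>z. (H' t z)\<^sup>2 \<partial>\<mu> t)"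
  using crit_iff[of \<theta>] t
  by (auto simp: info_def rescaled_def slope_def Fisher_def density_N power_divide crit_def)

text \<open>For \<open>t\<close> different from a critical \<open>\<theta>\<close>,
  \<open>info \<theta> t\<close> is the Fisher information divided by
  \<open>(t - \<theta>)\<^sup>2\<close>. Positivity of the continuous function \<open>info\<close>
  at \<open>\<theta>\<close> thus keeps other critical points away; at a non-critical center it
  keeps all of them away, and the disjunction treats both cases together.\<close>

lemma info_pos_near:
  assumes th: "\<theta> \<in> \<Theta>"
  obtains e where "0 < e" "\<And>t. t \<in> \<Theta> \<Longrightarrow> dist t \<theta> < e \<Longrightarrow> 0 < info \<theta> t"
    "\<And>t. t \<in> \<Theta> \<Longrightarrow> dist t \<theta> < e \<Longrightarrow> t \<noteq> \<theta> \<or> \<theta> \<notin> crit \<Longrightarrow> t \<notin> crit"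
proof -
  have "\<forall>\<^sub>F t in at \<theta> within \<Theta>. 0 < info \<theta> t"
    by (rule order_tendstoD(1)[OF info_continuous[OF th, unfolded continuous_within] info_pos[OF th]])
  then obtain e where e: "0 < e" "\<And>t. t \<in> \<Theta> \<Longrightarrow> t \<noteq> \<theta> \<Longrightarrow> dist t \<theta> < e \<Longrightarrow> 0 < info \<theta> t"
    by (auto simp: eventually_at)
  have pos: "0 < info \<theta> t" if "t \<in> \<Theta>" "dist t \<theta> < e" for t
    using e(2)[of t] info_pos[OF th] that by (cases "t = \<theta>") auto
  have "t \<notin> crit" if t: "t \<in> \<Theta>" "dist t \<theta> < e" "t \<noteq> \<theta> \<or> \<theta> \<notin> crit" for t
    using pos[OF t(1,2)] info_eq(1,2)[OF t(1), of \<theta>] t(3) th by (cases "\<theta> \<in> crit") (auto simp: crit_def)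
  with e(1) pos show thesis by (rule that)
qed

lemma crit_countable: "countable crit"
proof (rule countable_isolated_points)
  fix \<theta> assume c: "\<theta> \<in> crit"
  then have th: "\<theta> \<in> \<Theta>" by (simp add: crit_def)
  obtain e where e: "0 < e" "\<And>t. t \<in> \<Theta> \<Longrightarrow> dist t \<theta> < e \<Longrightarrow> t \<noteq> \<theta> \<or> \<theta> \<notin> crit \<Longrightarrow> t \<notin> crit"
    using info_pos_near[OF th] by metis
  show "\<not> \<theta> islimpt crit"
    unfolding islimpt_approachable using e by (auto simp: crit_def)
qed

lemma approximate_crit:
  assumes "\<theta> \<in> crit"
  obtains t where "\<And>k::nat. t k \<in> \<Theta> - crit" "t \<longlonglongrightarrow> \<theta>"
proof -
  have th: "\<theta> \<in> \<Theta>" using assms by (simp add: crit_def)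
  obtain e where e: "0 < e" "\<And>t. t \<in> \<Theta> \<Longrightarrow> dist t \<theta> < e \<Longrightarrow> t \<noteq> \<theta> \<or> \<theta> \<notin> crit \<Longrightarrow> t \<notin> crit"
    using info_pos_near[OF th] by metis
  obtain u where u: "\<And>k::nat. u k \<in> \<Theta> - {\<theta>}" "u \<longlonglongrightarrow> \<theta>"
    using limpt[OF th] unfolding islimpt_sequential by blast
  obtain m where m: "\<And>k. m \<le> k \<Longrightarrow> dist (u k) \<theta> < e"
    using tendstoD[OF u(2) e(1)] by (auto simp: eventually_sequentially)
  show thesis
    by (rule that[of "\<lambda>k. u (k + m)"]) (use u e(2) m LIMSEQ_ignore_initial_segment[OF u(2)] in auto)
qed

text \<open>At each critical point the score vanishes only off an exceptional null set. Removing all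
  these sets at once preserves full measure because the critical points, being isolated, are
  countable.\<close>

definition "Y1 = {z \<in> Y0. \<forall>\<theta>\<in>crit. S' \<theta> z = 0}"

lemma Y1: "Y1 \<in> sets borel" "\<theta> \<in> \<Theta> \<Longrightarrow> AE z in \<mu> \<theta>. z \<in> Y1" "z \<in> Y1 \<Longrightarrow> z \<in> Y0" "z \<in> Y1 \<Longrightarrow> \<theta>' \<in> crit \<Longrightarrow> S' \<theta>' z = 0"
proof -
  have cs: "crit \<subseteq> \<Theta>" by (auto simp: crit_def)
  have "{z. S' \<theta> z = 0} \<in> sets borel" if "\<theta> \<in> crit" for \<theta>
    using measurable_sets[OF S'_borel, of \<theta> "{0}"] that cs by (auto simp: vimage_def)
  then have "Y0 \<inter> (\<Inter>\<theta>\<in>crit. {z. S' \<theta> z = 0}) \<in> sets borel"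
    using crit_countable Y0(1) by (cases "crit = {}") (auto intro!: sets.countable_INT'')
  also have "Y0 \<inter> (\<Inter>\<theta>\<in>crit. {z. S' \<theta> z = 0}) = Y1" by (auto simp: Y1_def)
  finally show "Y1 \<in> sets borel" .
  show "AE z in \<mu> \<theta>. z \<in> Y1" if th: "\<theta> \<in> \<Theta>"
  proof -
    have "AE z in N. S' \<theta>' z = 0" if "\<theta>' \<in> crit" for \<theta>'
      using that cs by (intro critical_score_zero) (auto simp: crit_iff)
    then have "AE z in N. \<forall>\<theta>'\<in>crit. S' \<theta>' z = 0" using crit_countable by (simp add: AE_ball_countable)
    then have "AE z in \<mu> \<theta>. \<forall>\<theta>'\<in>crit. S' \<theta>' z = 0"
      using AE_P_iff[OF th, of "\<lambda>z. \<forall>\<theta>'\<in>crit. S' \<theta>' z = 0"] by (simp only: density_N[OF th])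
    with Y0(2)[OF th] show ?thesis by eventually_elim (simp add: Y1_def)
  qed
  show "z \<in> Y1 \<Longrightarrow> z \<in> Y0" "z \<in> Y1 \<Longrightarrow> \<theta>' \<in> crit \<Longrightarrow> S' \<theta>' z = 0" by (auto simp: Y1_def)
qed

definition "Yn n = (\<Pi>\<^sub>E i\<in>{1..n::nat}. Y1)"

lemma Yn_D: "y \<in> Yn n \<Longrightarrow> i \<in> {1..n} \<Longrightarrow> y i \<in> Y1"
  by (auto simp: Yn_def)

lemma Yn_full: assumes th: "\<theta> \<in> \<Theta>" shows "full_measure (data_law \<gamma> f n \<theta>) (Yn n)"
  unfolding full_measure_def data_law_eq[OF th]
proof
  have "Yn n \<in> sets (PM n \<theta>)" unfolding Yn_def
    by (rule sets_PiM_I_finite) (use Y1(1) in \<open>auto simp: sets_\<mu>\<close>)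
  then show "Yn n \<in> sets (completion (PM n \<theta>))" by simp
  have "AE y in PM n \<theta>. y \<in> Yn n"
    using AE_PM[OF th Y1(2)[OF th], of n] AE_space
    by eventually_elim (auto simp: Yn_def space_PiM PiE_iff)
  then show "AE y in completion (PM n \<theta>). y \<in> Yn n" by (rule AE_completion)
qed

abbreviation "T n \<theta> y \<equiv> mod_score_stat \<Theta> \<gamma> f n \<theta> y"

lemma T_eq:
  assumes n: "1 \<le> n" and t: "t \<in> \<Theta>" and y: "\<And>i. i \<in> {1..n} \<Longrightarrow> y i \<in> Y0"
  shows "t \<in> crit \<Longrightarrow> T n t y = (\<Sum>i=1..n. H' t (y i))\<^sup>2 / (n * (\<integral>z. (H' t z)\<^sup>2 \<partial>\<mu> t))"
    "t \<notin> crit \<Longrightarrow> T n t y = (\<Sum>i=1..n. S' t (y i))\<^sup>2 / (n * Fisher t)"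
    "t \<notin> crit \<Longrightarrow> score_stat \<Theta> \<gamma> f n t y = T n t y"
proof -
  have s: "score \<Theta> f n t y = (\<Sum>i=1..n. S' t (y i))" by (rule score_eq'[OF t]) (rule y)
  have s2: "hess \<Theta> f n t y = (\<Sum>i=1..n. H' t (y i))" by (rule hess_eq'[OF t]) (rule y)
  show "T n t y = (\<Sum>i=1..n. H' t (y i))\<^sup>2 / (n * (\<integral>z. (H' t z)\<^sup>2 \<partial>\<mu> t))" if c: "t \<in> crit"
  proof -
    have "mod_score \<Theta> \<gamma> f n t = hess \<Theta> f n t" using c n by (simp add: mod_score_def fun_eq_iff critical_eq)
    then show ?thesis unfolding mod_score_stat_def using hess_variance_eq[OF c, of n] s2 by simp
  qed
  assume c: "t \<notin> crit"
  have m: "mod_score \<Theta> \<gamma> f n t = score \<Theta> f n t" using c n by (simp add: mod_score_def fun_eq_iff critical_eq)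
  show "T n t y = (\<Sum>i=1..n. S' t (y i))\<^sup>2 / (n * Fisher t)"
    unfolding mod_score_stat_def m fisher_info_def[symmetric] fisher_info_eq[OF t] s ..
  show "score_stat \<Theta> \<gamma> f n t y = T n t y"
    unfolding mod_score_stat_def m fisher_info_def[symmetric] score_stat_def ..
qed

text \<open>The factor \<open>t - \<theta>\<close> appears squared both in the square of the sum and
  in \<open>info\<close>, and cancels. Excluding further critical points near
  \<open>\<theta>\<close> ensures that the modified score at \<open>t\<close> is the score
  itself.\<close>

lemma T_rescaled:
  assumes n: "1 \<le> n" and th: "\<theta> \<in> \<Theta>" and t: "t \<in> \<Theta>" and y: "\<And>i. i \<in> {1..n} \<Longrightarrow> y i \<in> Y0"
    and tc: "t \<noteq> \<theta> \<or> \<theta> \<notin> crit \<Longrightarrow> t \<notin> crit"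
  shows "T n t y = (\<Sum>i=1..n. rescaled \<theta> t (y i))\<^sup>2 / (n * info \<theta> t)"
proof (cases "\<theta> \<in> crit")
  case c: True
  then have Z: "(\<integral>z. (S' \<theta> z)\<^sup>2 \<partial>P \<theta>) = 0" by (simp add: crit_iff[OF th])
  show ?thesis
  proof (cases "t = \<theta>")
    case True
    then show ?thesis using T_eq(1)[OF n t y] c info_eq(3)[OF t c True] by (simp add: rescaled_def Z slope_def)
  next
    case False
    then show ?thesis using T_eq(2)[OF n t y] tc info_eq(2)[OF t c False]
      by (simp add: rescaled_def Z slope_def sum_divide_distrib[symmetric] power_divide)
  qed
next
  case False
  then have "(\<integral>z. (S' \<theta> z)\<^sup>2 \<partial>P \<theta>) \<noteq> 0" by (simp add: crit_iff[OF th])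
  then show ?thesis using T_eq(2)[OF n t y] tc False info_eq(1)[OF t] th by (simp add: rescaled_def)
qed

lemma T_continuous:
  assumes n: "1 \<le> n" and th: "\<theta> \<in> \<Theta>" and y: "y \<in> Yn n"
  shows "continuous (at \<theta> within \<Theta>) (\<lambda>t. T n t y)"
proof -
  obtain e where e: "0 < e" "\<And>t. t \<in> \<Theta> \<Longrightarrow> dist t \<theta> < e \<Longrightarrow> t \<noteq> \<theta> \<or> \<theta> \<notin> crit \<Longrightarrow> t \<notin> crit"
    using info_pos_near[OF th] by metis
  have R: "continuous (at \<theta> within \<Theta>) (\<lambda>t. rescaled \<theta> t (y i))" if i: "i \<in> {1..n}" for i
  proof (cases "\<theta> \<in> crit")
    case True
    then have Z: "(\<integral>z. (S' \<theta> z)\<^sup>2 \<partial>P \<theta>) = 0" by (simp add: crit_iff[OF th])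
    \<comment> \<open>This is the purpose of \<open>Y1\<close>: the slope is continuous for the
      given sample, not merely for almost every one.\<close>
    have "S' \<theta> (y i) = 0" by (rule Y1(4)[OF Yn_D[OF y i] True])
    then show ?thesis using slope_continuous[OF th, of "y i"] by (simp add: rescaled_def Z sets_N)
  next
    case False
    then have Z: "(\<integral>z. (S' \<theta> z)\<^sup>2 \<partial>P \<theta>) \<noteq> 0" by (simp add: crit_iff[OF th])
    show ?thesis using f_continuous(2)[OF th, of "y i"] by (simp add: rescaled_def Z sets_N)
  qed
  have "continuous (at \<theta> within \<Theta>) (\<lambda>t. (\<Sum>i=1..n. rescaled \<theta> t (y i))\<^sup>2 / (n * info \<theta> t))"
    by (intro continuous_intros R info_continuous[OF th]) (use info_pos[OF th] n in auto)
  then show ?thesis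
  proof (rule continuous_transform_within[OF _ e(1) th])
    fix t assume "t \<in> \<Theta>" "dist t \<theta> < e"
    then show "(\<Sum>i=1..n. rescaled \<theta> t (y i))\<^sup>2 / (n * info \<theta> t) = T n t y"
      by (intro T_rescaled[symmetric] n th e(2) Y1(3) Yn_D[OF y])
  qed
qed

text \<open>On \<open>Y1\<close> the score vanishes at \<open>\<theta>\<close>, so by the mean value
  theorem the slope at \<open>t\<close> equals the second derivative at an intermediate point,
  whatever the observation. Joint continuity of the second derivative on a box around
  \<open>(\<theta>, z)\<close> then finishes the argument.\<close>

lemma rescaled_jointly_continuous:
  assumes c: "\<theta> \<in> crit" and z: "z \<in> Y1"
  shows "continuous (at (\<theta>, z) within \<Theta> \<times> Y1) (\<lambda>(t, w). rescaled \<theta> t w)"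
proof -
  have th: "\<theta> \<in> \<Theta>" using c by (simp add: crit_def)
  have Z: "(\<integral>z. (S' \<theta> z)\<^sup>2 \<partial>P \<theta>) = 0" using c by (simp add: crit_iff[OF th])
  obtain r p K L L' L'' where sm: "smooth_near Y0 \<theta> r p K L L' L''" using Y0(3)[OF th] by blast
  then have r: "0 < r" and d: "\<And>z t. z \<in> Y0 \<Longrightarrow> t \<in> ball \<theta> r \<Longrightarrow> ((\<lambda>t. L' t z) has_real_derivative L'' t z) (at t)"
    and cL: "continuous_on (ball \<theta> r \<times> Y0) (\<lambda>(t, z). L'' t z)"
    by (auto simp: smooth_near_def)
  have thb: "\<theta> \<in> ball \<theta> r" using r by simp
  have R0: "rescaled \<theta> \<theta> z = L'' \<theta> z" using Y1(3)[OF z] smooth_near_S(3)[OF sm _ thb th, of z]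
    by (simp add: rescaled_def Z slope_def H'_def)
  show ?thesis unfolding continuous_within case_prod_conv R0
  proof (rule tendstoI)
    fix e :: real assume e: "0 < e"
    have "(\<theta>, z) \<in> ball \<theta> r \<times> Y0" using thb Y1(3)[OF z] by simp
    with cL have "((\<lambda>(t, z). L'' t z) \<longlongrightarrow> L'' \<theta> z) (at (\<theta>, z) within ball \<theta> r \<times> Y0)"
      by (auto simp: continuous_on_def)
    from tendstoD[OF this e] obtain W where W: "open W" "(\<theta>, z) \<in> W"
        "\<And>x. x \<in> W \<Longrightarrow> x \<noteq> (\<theta>, z) \<Longrightarrow> x \<in> ball \<theta> r \<times> Y0 \<Longrightarrow> dist (case x of (t, z) \<Rightarrow> L'' t z) (L'' \<theta> z) < e"
      unfolding eventually_at_topological by blast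
    obtain A B where AB: "open A" "open B" "(\<theta>, z) \<in> A \<times> B" "A \<times> B \<subseteq> W"
      by (rule open_prod_elim[OF W(1,2)])
    obtain s where s: "0 < s" "ball \<theta> s \<subseteq> A" using AB by (auto elim: openE)
    define q where "q = min r s"
    have q: "0 < q" "ball \<theta> q \<subseteq> A" "ball \<theta> q \<subseteq> ball \<theta> r" using r s by (auto simp: q_def)
    have L: "dist (L'' t w) (L'' \<theta> z) < e" if "t \<in> ball \<theta> q" "w \<in> B" "w \<in> Y0" for t w
    proof -
      have "(t, w) \<in> W" "(t, w) \<in> ball \<theta> r \<times> Y0" using that q AB(4) by blast+
      with W(3)[of "(t, w)"] e show ?thesis by (cases "(t, w) = (\<theta>, z)") auto
    qed
    have main: "dist (rescaled \<theta> t w) (L'' \<theta> z) < e" if t: "t \<in> ball \<theta> q" "t \<in> \<Theta>" and w: "w \<in> B" "w \<in> Y1" for t w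
    proof -
      have wY: "w \<in> Y0" by (rule Y1(3)[OF w(2)])
      have tb: "t \<in> ball \<theta> r" using t q by auto
      obtain x where x: "x \<in> ball \<theta> q" "rescaled \<theta> t w = L'' x w"
      proof (cases "t = \<theta>")
        case True
        then have "rescaled \<theta> t w = L'' \<theta> w" using wY smooth_near_S(3)[OF sm wY thb th]
          by (simp add: rescaled_def Z slope_def H'_def)
        with q(1) show thesis by (intro that[of \<theta>]) auto
      next
        case False
        have S0: "S' \<theta> w = 0" by (rule Y1(4)[OF w(2) c])
        then have L0: "L' \<theta> w = 0" using wY smooth_near_S(1)[OF sm wY thb th] by (simp add: S'_def)
        have Lt: "S' t w = L' t w" using wY smooth_near_S(1)[OF sm wY tb t(2)] by (simp add: S'_def)
        obtain x where x: "x \<in> ball \<theta> q" "L' t w - L' \<theta> w = (t - \<theta>) * L'' x w"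
        proof (cases "\<theta> < t")
          case True
          have "\<exists>x>\<theta>. x < t \<and> L' t w - L' \<theta> w = (t - \<theta>) * L'' x w"
            by (rule MVT2[OF True]) (use tb wY in \<open>auto intro!: d simp: dist_real_def\<close>)
          then obtain x where "\<theta> < x" "x < t" "L' t w - L' \<theta> w = (t - \<theta>) * L'' x w" by blast
          with t(1) show thesis by (intro that[of x]) (auto simp: dist_real_def)
        next
          case False
          then have lt: "t < \<theta>" using \<open>t \<noteq> \<theta>\<close> by simp
          have "\<exists>x>t. x < \<theta> \<and> L' \<theta> w - L' t w = (\<theta> - t) * L'' x w"
            by (rule MVT2[OF lt]) (use tb wY in \<open>auto intro!: d simp: dist_real_def\<close>)
          then obtain x where "t < x" "x < \<theta>" "L' \<theta> w - L' t w = (\<theta> - t) * L'' x w" by blast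
          with t(1) show thesis by (intro that[of x]) (auto simp: dist_real_def algebra_simps)
        qed
        with False Lt L0 show thesis by (intro that[of x]) (auto simp: rescaled_def Z slope_def)
      qed
      with L[OF x(1) w(1) wY] show ?thesis by simp
    qed
    show "\<forall>\<^sub>F x in at (\<theta>, z) within \<Theta> \<times> Y1. dist (case x of (t, w) \<Rightarrow> rescaled \<theta> t w) (L'' \<theta> z) < e"
      unfolding eventually_at_topological
      by (rule exI[of _ "ball \<theta> q \<times> B"]) (use main AB q(1) in \<open>auto intro!: open_Times\<close>)
  qed
qed

lemma T_jointly_continuous:
  assumes n: "1 \<le> n" and c: "\<theta> \<in> crit" and y: "y \<in> Yn n"
  shows "continuous (at (\<theta>, y) within \<Theta> \<times> Yn n) (\<lambda>(t, y). T n t y)"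
proof -
  have th: "\<theta> \<in> \<Theta>" using c by (simp add: crit_def)
  obtain e where e: "0 < e" "\<And>t. t \<in> \<Theta> \<Longrightarrow> dist t \<theta> < e \<Longrightarrow> t \<noteq> \<theta> \<or> \<theta> \<notin> crit \<Longrightarrow> t \<notin> crit"
    using info_pos_near[OF th] by metis
  let ?F = "at (\<theta>, y) within \<Theta> \<times> Yn n"
  have ev: "\<forall>\<^sub>F x in ?F. x \<in> \<Theta> \<times> Yn n" by (auto simp: eventually_at_filter)
  have fs: "(fst \<longlongrightarrow> \<theta>) ?F" "(snd \<longlongrightarrow> y) ?F"
    using tendsto_fst[OF tendsto_ident_at, of "(\<theta>, y)" "\<Theta> \<times> Yn n"] tendsto_snd[OF tendsto_ident_at, of "(\<theta>, y)" "\<Theta> \<times> Yn n"] by auto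
  have co: "((\<lambda>x. snd x i) \<longlongrightarrow> y i) ?F" for i
  proof -
    have "isCont (\<lambda>x::nat \<Rightarrow> 'a. x i) y"
    proof -
      have "continuous_on UNIV (\<lambda>x::nat \<Rightarrow> 'a. x i)" by (rule continuous_on_product_coordinates)
      then show ?thesis unfolding continuous_on_eq_continuous_at[OF open_UNIV] by blast
    qed
    from isCont_tendsto_compose[OF this fs(2)] show ?thesis .
  qed
  have R: "((\<lambda>x. rescaled \<theta> (fst x) (snd x i)) \<longlongrightarrow> rescaled \<theta> \<theta> (y i)) ?F" if i: "i \<in> {1..n}" for i
  proof -
    have l: "((\<lambda>x. (fst x, snd x i)) \<longlongrightarrow> (\<theta>, y i)) ?F" by (intro tendsto_Pair fs co)
    have "\<forall>\<^sub>F x in ?F. (fst x, snd x i) \<in> \<Theta> \<times> Y1"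
      using ev by eventually_elim (use i in \<open>auto dest: Yn_D\<close>)
    from continuous_within_tendsto_compose[OF rescaled_jointly_continuous[OF c Yn_D[OF y i]] this l]
    show ?thesis by simp
  qed
  have I: "((\<lambda>x. info \<theta> (fst x)) \<longlongrightarrow> info \<theta> \<theta>) ?F"
    by (rule continuous_within_tendsto_compose[OF info_continuous[OF th] _ fs(1)]) (use ev in eventually_elim, auto)
  have lim: "((\<lambda>x. (\<Sum>i=1..n. rescaled \<theta> (fst x) (snd x i))\<^sup>2 / (n * info \<theta> (fst x)))
      \<longlongrightarrow> (\<Sum>i=1..n. rescaled \<theta> \<theta> (y i))\<^sup>2 / (n * info \<theta> \<theta>)) ?F"
    by (intro tendsto_intros R I) (use info_pos[OF th] n in auto)
  have eq: "(\<Sum>i=1..n. rescaled \<theta> t (w i))\<^sup>2 / (n * info \<theta> t) = T n t w" if "t \<in> \<Theta>" "dist t \<theta> < e" "w \<in> Yn n" for t w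
    by (rule T_rescaled[symmetric, OF n th that(1) Y1(3)[OF Yn_D[OF that(3)]] e(2)[OF that(1,2)]])
  have "\<forall>\<^sub>F x in ?F. dist (fst x) \<theta> < e" by (rule tendstoD[OF fs(1) e(1)])
  with ev have "\<forall>\<^sub>F x in ?F. (\<Sum>i=1..n. rescaled \<theta> (fst x) (snd x i))\<^sup>2 / (n * info \<theta> (fst x)) = (case x of (t, y) \<Rightarrow> T n t y)"
    by eventually_elim (auto simp: eq)
  from Lim_transform_eventually[OF lim this] show ?thesis
    unfolding continuous_within using eq[OF th _ y] e(1) by simp
qed

end

section \<open>Uniqueness of the extension, and uniform coverage\<close>

context nondegenerate_model
begin

text \<open>Existence is the continuity of \<open>T\<close>. Uniqueness holds because every critical
  point is a limit of non-critical ones, where \<open>G\<close> is prescribed.\<close>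

lemma extension_fixed:
  assumes n: "1 \<le> n" and y: "y \<in> Yn n"
  shows "continuous_extension (\<lambda>\<theta>. score_stat \<Theta> \<gamma> f n \<theta> y) (\<Theta> - crit) \<Theta> G \<longleftrightarrow> (\<forall>\<theta>\<in>\<Theta>. G \<theta> = T n \<theta> y)"
proof
  assume G: "\<forall>\<theta>\<in>\<Theta>. G \<theta> = T n \<theta> y"
  have "continuous_on \<Theta> (\<lambda>t. T n t y)"
    using T_continuous[OF n _ y] by (simp add: continuous_on_eq_continuous_within)
  then have "continuous_on \<Theta> G" by (rule continuous_on_cong[THEN iffD1, rotated 2]) (use G in auto)
  moreover have "G \<theta> = score_stat \<Theta> \<gamma> f n \<theta> y" if "\<theta> \<in> \<Theta> - crit" for \<theta>
  proof -
    have "score_stat \<Theta> \<gamma> f n \<theta> y = T n \<theta> y" by (rule T_eq(3)[OF n _ Y1(3)[OF Yn_D[OF y]]]) (use that in auto)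
    then show ?thesis using G that by simp
  qed
  ultimately show "continuous_extension (\<lambda>\<theta>. score_stat \<Theta> \<gamma> f n \<theta> y) (\<Theta> - crit) \<Theta> G"
    by (auto simp: continuous_extension_def)
next
  assume ext: "continuous_extension (\<lambda>\<theta>. score_stat \<Theta> \<gamma> f n \<theta> y) (\<Theta> - crit) \<Theta> G"
  have eq: "G \<theta> = T n \<theta> y" if "\<theta> \<in> \<Theta> - crit" for \<theta>
  proof -
    have "score_stat \<Theta> \<gamma> f n \<theta> y = T n \<theta> y" by (rule T_eq(3)[OF n _ Y1(3)[OF Yn_D[OF y]]]) (use that in auto)
    then show ?thesis using ext that by (simp add: continuous_extension_def)
  qed
  have "G \<theta> = T n \<theta> y" if c: "\<theta> \<in> crit" for \<theta>
  proof -
    have th: "\<theta> \<in> \<Theta>" using c by (simp add: crit_def)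
    obtain t where t: "\<And>k::nat. t k \<in> \<Theta> - crit" "t \<longlonglongrightarrow> \<theta>" by (rule approximate_crit[OF c]) (rule that, assumption+)
    have tT: "t k \<in> \<Theta>" for k using t by auto
    have "continuous (at \<theta> within \<Theta>) G"
      using ext th by (simp add: continuous_extension_def continuous_on_eq_continuous_within)
    then have "(\<lambda>k. G (t k)) \<longlonglongrightarrow> G \<theta>" by (rule continuous_within_tendsto_compose'[OF _ tT t(2)])
    moreover have "(\<lambda>k. T n (t k) y) \<longlonglongrightarrow> T n \<theta> y"
      by (rule continuous_within_tendsto_compose'[OF T_continuous[OF n th y] tT t(2)])
    ultimately show ?thesis unfolding eq[OF t(1)] by (rule LIMSEQ_unique)
  qed
  with eq show "\<forall>\<theta>\<in>\<Theta>. G \<theta> = T n \<theta> y" by blast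
qed

text \<open>Uniqueness is inherited section by section from the case of a fixed sample. For
  existence, critical points are handled by the joint continuity of \<open>T\<close>; any other
  parameter has a neighborhood free of critical points, on which the assumed continuity of the score
  statistic takes over.\<close>

lemma extension_joint:
  assumes n: "1 \<le> n" and Z: "Z \<subseteq> Yn n"
    and cont: "continuous_on ((\<Theta> - crit) \<times> Z) (\<lambda>(\<theta>, y). score_stat \<Theta> \<gamma> f n \<theta> y)"
  shows "continuous_extension (\<lambda>(\<theta>, y). score_stat \<Theta> \<gamma> f n \<theta> y) ((\<Theta> - crit) \<times> Z) (\<Theta> \<times> Z) G \<longleftrightarrow>
    (\<forall>\<theta>\<in>\<Theta>. \<forall>y\<in>Z. G (\<theta>, y) = T n \<theta> y)"
proof
  have st: "score_stat \<Theta> \<gamma> f n \<theta> y = T n \<theta> y" if "\<theta> \<in> \<Theta> - crit" "y \<in> Z" for \<theta> y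
    by (rule T_eq(3)[OF n _ Y1(3)[OF Yn_D[of y]]]) (use that Z in auto)
  have Tc: "continuous_on ((\<Theta> - crit) \<times> Z) (\<lambda>(\<theta>, y). T n \<theta> y)"
    by (rule continuous_on_cong[THEN iffD1, OF refl _ cont]) (auto simp: st)
  show "continuous_extension (\<lambda>(\<theta>, y). score_stat \<Theta> \<gamma> f n \<theta> y) ((\<Theta> - crit) \<times> Z) (\<Theta> \<times> Z) G"
    if G: "\<forall>\<theta>\<in>\<Theta>. \<forall>y\<in>Z. G (\<theta>, y) = T n \<theta> y"
  proof -
    have "continuous (at (\<theta>, y) within \<Theta> \<times> Z) (\<lambda>(\<theta>, y). T n \<theta> y)" if th: "\<theta> \<in> \<Theta>" and y: "y \<in> Z" for \<theta> y
    proof (cases "\<theta> \<in> crit")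
      case True
      show ?thesis
        by (rule continuous_within_subset[OF T_jointly_continuous[OF n True]]) (use y Z in auto)
    next
      case False
      obtain e where e: "0 < e" "\<And>t. t \<in> \<Theta> \<Longrightarrow> dist t \<theta> < e \<Longrightarrow> t \<noteq> \<theta> \<or> \<theta> \<notin> crit \<Longrightarrow> t \<notin> crit"
        using info_pos_near[OF th] by metis
      have "at (\<theta>, y) within \<Theta> \<times> Z = at (\<theta>, y) within (\<Theta> - crit) \<times> Z"
        by (rule at_within_nhd[of _ "ball \<theta> e \<times> UNIV"])
          (use e False in \<open>auto intro!: open_Times simp: dist_commute\<close>)
      moreover have "continuous (at (\<theta>, y) within (\<Theta> - crit) \<times> Z) (\<lambda>(\<theta>, y). T n \<theta> y)"
        using Tc th y False by (simp add: continuous_on_eq_continuous_within)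
      ultimately show ?thesis by simp
    qed
    then have "continuous_on (\<Theta> \<times> Z) (\<lambda>(\<theta>, y). T n \<theta> y)"
      by (auto simp: continuous_on_eq_continuous_within)
    then have "continuous_on (\<Theta> \<times> Z) G" by (rule continuous_on_cong[THEN iffD1, rotated 2]) (use G in auto)
    then show ?thesis using G st by (auto simp: continuous_extension_def)
  qed
  assume ext: "continuous_extension (\<lambda>(\<theta>, y). score_stat \<Theta> \<gamma> f n \<theta> y) ((\<Theta> - crit) \<times> Z) (\<Theta> \<times> Z) G"
  have sect: "continuous_extension (\<lambda>\<theta>. score_stat \<Theta> \<gamma> f n \<theta> y) (\<Theta> - crit) \<Theta> (\<lambda>\<theta>. G (\<theta>, y))" if y: "y \<in> Z" for y
  proof -
    have "continuous_on (\<Theta> \<times> Z) G" using ext by (simp add: continuous_extension_def)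
    then have "continuous_on \<Theta> (\<lambda>\<theta>. G (\<theta>, y))"
      by (rule continuous_on_compose2) (use y in \<open>auto intro!: continuous_intros\<close>)
    then show ?thesis using ext y by (auto simp: continuous_extension_def)
  qed
  show "\<forall>\<theta>\<in>\<Theta>. \<forall>y\<in>Z. G (\<theta>, y) = T n \<theta> y"
  proof (intro ballI)
    fix \<theta> y assume th: "\<theta> \<in> \<Theta>" and y: "y \<in> Z"
    have "y \<in> Yn n" using y Z by auto
    from bspec[OF extension_fixed[OF n this, THEN iffD1, OF sect[OF y]] th]
    show "G (\<theta>, y) = T n \<theta> y" .
  qed
qed

lemma coverage_eq:
  assumes n: "1 \<le> n" and th: "\<theta> \<in> \<Theta>" and t: "t \<in> \<Theta>" and tc: "t \<noteq> \<theta> \<or> \<theta> \<notin> crit \<Longrightarrow> t \<notin> crit"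
  shows "measure (data_law \<gamma> f n t) {y \<in> space (data_law \<gamma> f n t). t \<in> conf_region \<Theta> \<gamma> f n \<alpha> y}
    = measure (PM n t) {y \<in> space (PM n t). (\<Sum>i=1..n. rescaled \<theta> t (y i))\<^sup>2 / (n * info \<theta> t) \<le> quantile (chi_square 1) (1 - \<alpha>)}"
  unfolding data_law_eq[OF t]
proof (rule measure_completion_AE)
  have [measurable]: "rescaled \<theta> t \<in> borel_measurable (\<mu> t)"
    using rescaled_meas[OF th t] by (simp add: borel_N borel_\<mu>)
  show "{y \<in> space (PM n t). (\<Sum>i=1..n. rescaled \<theta> t (y i))\<^sup>2 / (n * info \<theta> t) \<le> quantile (chi_square 1) (1 - \<alpha>)} \<in> sets (PM n t)"
    by measurable
  show "AE y in PM n t. (t \<in> conf_region \<Theta> \<gamma> f n \<alpha> y) = ((\<Sum>i=1..n. rescaled \<theta> t (y i))\<^sup>2 / (n * info \<theta> t) \<le> quantile (chi_square 1) (1 - \<alpha>))"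
    using AE_PM[OF t Y0(2)[OF t], of n]
  proof eventually_elim
    case (elim y)
    then have "T n t y = (\<Sum>i=1..n. rescaled \<theta> t (y i))\<^sup>2 / (n * info \<theta> t)"
      by (intro T_rescaled n th t tc) auto
    then show ?case using t by (simp add: conf_region_def)
  qed
qed

text \<open>The limit \<open>\<theta>\<close> of parameters in \<open>C\<close> stays in
  \<open>C\<close>, hence in \<open>\<Theta>\<close>, so the rescaling centered at
  \<open>\<theta>\<close> is available. It represents the statistic at all nearby parameters,
  critical or not, and the central limit theorem applies to it.\<close>

lemma coverage_uniform:
  assumes \<alpha>: "0 < \<alpha>" "\<alpha> < 1" and C: "compact C" "C \<noteq> {}" "C \<subseteq> \<Theta>"
  shows "(\<lambda>n. INF \<theta>\<in>C. \<P>(y in data_law \<gamma> f n \<theta>. \<theta> \<in> conf_region \<Theta> \<gamma> f n \<alpha> y)) \<longlonglongrightarrow> 1 - \<alpha>"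
proof (rule tendsto_INF_uniform[OF uniform_limit_on_compactI[OF C(1)] C(2)])
  fix r :: "nat \<Rightarrow> nat" and t \<theta> assume r: "strict_mono r" and t: "\<And>k. t k \<in> C" and th: "\<theta> \<in> C" and lim: "t \<longlonglongrightarrow> \<theta>"
  have tT: "t k \<in> \<Theta>" for k using t C(3) by auto
  have thT: "\<theta> \<in> \<Theta>" using th C(3) by auto
  obtain e where e: "0 < e" "\<And>t. t \<in> \<Theta> \<Longrightarrow> dist t \<theta> < e \<Longrightarrow> t \<noteq> \<theta> \<or> \<theta> \<notin> crit \<Longrightarrow> t \<notin> crit"
    using info_pos_near[OF thT] by metis
  have rl: "filterlim r at_top sequentially" by (rule filterlim_subseq[OF r])
  let ?c = "\<lambda>k. measure (PM (r k) (t k)) {y \<in> space (PM (r k) (t k)).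
      (\<Sum>i=1..r k. rescaled \<theta> (t k) (y i))\<^sup>2 / (r k * info \<theta> (t k)) \<le> quantile (chi_square 1) (1 - \<alpha>)}"
  have "?c \<longlonglongrightarrow> 1 - \<alpha>"
    using coverage[of \<theta> t r \<alpha>, OF thT tT lim rl \<alpha>] unfolding density_N[OF tT] .
  \<comment> \<open>Sample sizes must be at least one, since for the empty sample every parameter is
    critical; the parameter must be so close to \<open>\<theta>\<close> that no critical point other
    than \<open>\<theta>\<close> interferes.\<close>
  moreover have "\<forall>\<^sub>F k in sequentially. ?c k = \<P>(y in data_law \<gamma> f (r k) (t k). t k \<in> conf_region \<Theta> \<gamma> f (r k) \<alpha> y)"
    using tendstoD[OF lim e(1)] rl[unfolded filterlim_at_top, rule_format, of 1]
    by eventually_elim (intro coverage_eq[symmetric] thT tT e(2); assumption)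
  ultimately show "(\<lambda>k. \<P>(y in data_law \<gamma> f (r k) (t k). t k \<in> conf_region \<Theta> \<gamma> f (r k) \<alpha> y)) \<longlonglongrightarrow> 1 - \<alpha>"
    by (rule Lim_transform_eventually)
qed

end

text \<open>The extension is characterized by equivalences over all candidates \<open>G\<close>:
  from right to left they say that the modified statistic is a continuous extension, from left to
  right that there is no other. The joint version ranges over sets \<open>Z\<close> because
  continuity in the sample away from critical points depends on the score itself.\<close>

theorem corollary2p7:
  fixes \<Theta> :: "real set"
    and \<gamma> :: "nat \<Rightarrow> (real ^ 'r) measure"
    and f :: "nat \<Rightarrow> real \<Rightarrow> real ^ 'r \<Rightarrow> real"
  assumes dominating: "\<And>i. i \<ge> 1 \<Longrightarrow> sets (\<gamma> i) = sets borel"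
    and measurable: "\<And>i \<theta>. i \<ge> 1 \<Longrightarrow> \<theta> \<in> \<Theta> \<Longrightarrow> f i \<theta> \<in> borel_measurable (\<gamma> i)"
    and nonneg: "\<And>i \<theta> z. i \<ge> 1 \<Longrightarrow> \<theta> \<in> \<Theta> \<Longrightarrow> f i \<theta> z \<ge> 0"
    and density: "\<And>i \<theta>. i \<ge> 1 \<Longrightarrow> \<theta> \<in> \<Theta> \<Longrightarrow> prob_space (obs_law \<gamma> f i \<theta>)"
    and derivative_defined: "\<And>\<theta>. \<theta> \<in> \<Theta> \<Longrightarrow> \<theta> islimpt \<Theta>"
    and identically_distributed:
      "\<And>i \<theta>. i \<ge> 1 \<Longrightarrow> \<theta> \<in> \<Theta> \<Longrightarrow> obs_law \<gamma> f i \<theta> = obs_law \<gamma> f 1 \<theta> \<and> f i \<theta> = f 1 \<theta>"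
    and same_null_sets:
      "\<And>i \<theta> \<theta>'. i \<ge> 1 \<Longrightarrow> \<theta> \<in> \<Theta> \<Longrightarrow> \<theta>' \<in> \<Theta> \<Longrightarrow>
         null_sets (obs_law \<gamma> f i \<theta>) = null_sets (obs_law \<gamma> f i \<theta>')"
    and regular:
      "\<And>\<theta>'. \<theta>' \<in> \<Theta> \<Longrightarrow> \<exists>r>0. \<exists>\<delta>>0. regular_on_ball \<Theta> \<gamma> f (ball \<theta>' r) \<delta>"
    and hess_variance:
      "\<And>\<theta>. \<theta> \<in> critical \<Theta> \<gamma> f 1 \<Longrightarrow> prob_space.variance (data_law \<gamma> f 1 \<theta>) (hess \<Theta> f 1 \<theta>) > 0"
  shows
    "(\<forall>n\<ge>1. \<exists>Yn. (\<forall>\<theta>\<in>\<Theta>. full_measure (data_law \<gamma> f n \<theta>) Yn) \<and>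
        (\<forall>y\<in>Yn. \<forall>G.
          continuous_extension (\<lambda>\<theta>. score_stat \<Theta> \<gamma> f n \<theta> y) (\<Theta> - critical \<Theta> \<gamma> f n) \<Theta> G \<longleftrightarrow>
          (\<forall>\<theta>\<in>\<Theta>. G \<theta> = mod_score_stat \<Theta> \<gamma> f n \<theta> y)) \<and>
        (\<forall>\<theta>\<in>critical \<Theta> \<gamma> f n. \<forall>y\<in>Yn.
          continuous (at (\<theta>, y) within \<Theta> \<times> Yn) (\<lambda>(\<theta>, y). mod_score_stat \<Theta> \<gamma> f n \<theta> y)) \<and>
        (\<forall>Z\<subseteq>Yn.
          continuous_on ((\<Theta> - critical \<Theta> \<gamma> f n) \<times> Z) (\<lambda>(\<theta>, y). score_stat \<Theta> \<gamma> f n \<theta> y) \<longrightarrow>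
          (\<forall>G.
            continuous_extension (\<lambda>(\<theta>, y). score_stat \<Theta> \<gamma> f n \<theta> y)
              ((\<Theta> - critical \<Theta> \<gamma> f n) \<times> Z) (\<Theta> \<times> Z) G \<longleftrightarrow>
            (\<forall>\<theta>\<in>\<Theta>. \<forall>y\<in>Z. G (\<theta>, y) = mod_score_stat \<Theta> \<gamma> f n \<theta> y))))
     \<and> (\<forall>\<alpha> C. 0 < \<alpha> \<longrightarrow> \<alpha> < 1 \<longrightarrow> compact C \<longrightarrow> C \<noteq> {} \<longrightarrow> C \<subseteq> \<Theta> \<longrightarrow>
        (\<lambda>n. INF \<theta>\<in>C. \<P>(y in data_law \<gamma> f n \<theta>. \<theta> \<in> conf_region \<Theta> \<gamma> f n \<alpha> y))
          \<longlonglongrightarrow> 1 - \<alpha>)"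
proof -
  interpret nondegenerate_model \<Theta> \<gamma> f
    by (rule nondegenerate_model.intro[OF regular_model.intro nondegenerate_model_axioms.intro])
      (fact dominating measurable nonneg density derivative_defined identically_distributed regular hess_variance)+
  show ?thesis
  proof (rule conjI, goal_cases)
    case 1
    show ?case
    proof (intro allI impI, goal_cases)
      case (1 n)
      show ?case
        unfolding critical_eq[OF 1]
        by (rule exI[of _ "Yn n"], intro conjI ballI allI impI Yn_full extension_fixed[OF 1]
            T_jointly_continuous[OF 1] extension_joint[OF 1])
    qed
  next
    case 2
    show ?case by (intro allI impI coverage_uniform)
  qed
qed

end
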